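(* Assume the setting described in the context, and assume in addition that the Robin coefficient satisfies $\varphi\in\Phi_{ad}$, i.e. $\varphi\in C^0(\overline{\Gamma_R})$ and $0\le \varphi\le \xi\Lambda$ on $\overline{\Gamma_R}$ for some $\xi\in(0,1)$. Then problem $(S)$ admits a weak solution $u\in V$. Moreover, this solution is unique in the closed ball $\overline{B_V(0,M_0)}=\{v\in V:\ \|v\|_V\le M_0\}$: if $v_1,v_2\in V$ are weak solutions of $(S)$ with $\|v_1\|_V\le M_0$ and $\|v_2\|_V\le M_0$, then $v_1=v_2$.
   Context: Let $\Omega=D(0,1)\subset\mathbb R^2$ be the open unit disk and $\Gamma=\partial\Omega=S(0,1)$ the unit circle, with arc-length measure $\sigma$. Assume $\Gamma$ is decomposed into three relatively open subsets $\Gamma_D,\Gamma_N,\Gamma_R$ that are pairwise disjoint, satisfy $\Gamma=\overline{\Gamma_D}\cup\overline{\Gamma_N}\cup\overline{\Gamma_R}$, and satisfy $\sigma(\Gamma_D)>0$, $\sigma(\Gamma_N)>0$, $\sigma(\Gamma_R)>0$. Data: $\phi\in L^2(\Gamma_N)$ with $\phi\not\equiv0$ (Neumann datum), $g\in L^2(\Gamma_R)$, a Robin coefficient $\varphi\in C^0(\overline{\Gamma_R})$, and $\alpha\in(0,1)$. Define $f_\alpha:\mathbb R\to\mathbb R$ by $f_\alpha(r)=\frac{e^{\alpha r}-e^{-(1-\alpha)r}}{r}$ for $r\neq0$ and $f_\alpha(0)=1$. Problem $(S)$ is: $\Delta u=0$ in $\Omega$, $u=0$ on $\Gamma_D$,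 $\partial u/\partial n=\phi$ on $\Gamma_N$, $\partial u/\partial n+\varphi(x)\big(e^{\alpha u}-e^{-(1-\alpha)u}\big)=g$ on $\Gamma_R$ (equivalently $\partial u/\partial n+\varphi f_\alpha(u)u=g$ on $\Gamma_R$). Let $V=\{v\in H^1(\Omega): v=0 \text{ on }\Gamma_D \text{ (in the trace sense)}\}$ with inner product $\langle u,v\rangle_V=\int_\Omega\nabla u\cdot\nabla v\,dx$ and norm $\|u\|_V=\|\nabla u\|_{L^2(\Omega)}$ (a Hilbert space). A weak solution of $(S)$ is $u\in V$ such that for all $v\in V$: $\int_\Omega\nabla u\cdot\nabla v\,dx+\int_{\Gamma_R}\varphi f_\alpha(u)uv\,d\sigma=\int_{\Gamma_N}\phi v\,d\sigma+\int_{\Gamma_R}gv\,d\sigma$ (traces understood). For $2\le p<\infty$, let $\beta_p=\inf\{c>0:\ \|u\|_{L^p(\Gamma)}\le c\|u\|_V\ \forall u\in V\}\in(0,\infty)$. Set $M_0=\beta_2\big(\|\phi\|_{L^2(\Gamma_N)}+\|g\|_{L^2(\Gamma_R)}\big)$. Fix a constant $C>0$ such that $\|u\|_{L^p(\Gamma)}^p\le C^{p-2}p^{(p-2)/2}\|u\|_V^p$ for all $p\ge3$ and all $u\in V$ (such a constant exists by the periodic Sobolev embedding on the circle). Define the entire function $R(z)=\sum_{m=3}^\infty q_m z^{m-3}$, $q_m=\frac{4}{(m+1)!}(m+2)^{\frac{m+2}{2}}$. Define $\Lambda=\big[\beta_3^3M_0+\beta_4^4M_0^2+(CM_0)^3R(CM_0)\big]^{-1}$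 and, for $\xi\in(0,1)$, the admissible set $\Phi_{ad}=\{h\in C^0(\overline{\Gamma_R}):\ 0\le h\le\xi\Lambda\}$. *)

theory Defs
  imports "HOL-Analysis.Analysis"
begin

text \<open>The plane is modelled by the type complex (= R^2 with the Euclidean inner product).
  Omega is the open unit disk, Gamma the unit circle, sigma the arc-length measure on Gamma.\<close>

definition Omega :: "complex set" where "Omega = ball 0 1"
definition Gamma :: "complex set" where "Gamma = sphere 0 1"

definition sigma :: "complex measure" where
  "sigma = distr (lebesgue_on {0..<2*pi}) borel cis"

definition C1_fun :: "(complex \<Rightarrow> real) \<Rightarrow> (complex \<Rightarrow> complex) \<Rightarrow> bool" where
  "C1_fun psi Dpsi \<longleftrightarrow> (\<forall>x. (psi has_derivative (\<lambda>h. Dpsi x \<bullet> h)) (at x)) \<and> continuous_on UNIV Dpsi"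

definition test_fun :: "(complex \<Rightarrow> real) \<Rightarrow> (complex \<Rightarrow> complex) \<Rightarrow> bool" where
  "test_fun psi Dpsi \<longleftrightarrow> C1_fun psi Dpsi \<and> compact (closure {x. psi x \<noteq> 0})
      \<and> closure {x. psi x \<noteq> 0} \<subseteq> Omega"

definition L2_Omega :: "(complex \<Rightarrow> real) \<Rightarrow> bool" where
  "L2_Omega f \<longleftrightarrow> f \<in> borel_measurable (lebesgue_on Omega)
      \<and> integrable (lebesgue_on Omega) (\<lambda>x. (f x)^2)"

definition weak_grad :: "(complex \<Rightarrow> real) \<Rightarrow> (complex \<Rightarrow> complex) \<Rightarrow> bool" where
  "weak_grad u g \<longleftrightarrow> g \<in> borel_measurable (lebesgue_on Omega)
      \<and> integrable (lebesgue_on Omega) (\<lambda>x. (norm (g x))^2)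
      \<and> (\<forall>psi Dpsi. test_fun psi Dpsi \<longrightarrow> (\<forall>b\<in>Basis.
            (\<integral>x. u x * (Dpsi x \<bullet> b) \<partial>lebesgue_on Omega)
              = - (\<integral>x. (g x \<bullet> b) * psi x \<partial>lebesgue_on Omega)))"

definition H1 :: "(complex \<Rightarrow> real) \<Rightarrow> bool" where
  "H1 u \<longleftrightarrow> L2_Omega u \<and> (\<exists>g. weak_grad u g)"

definition H1_grad :: "(complex \<Rightarrow> real) \<Rightarrow> complex \<Rightarrow> complex" where
  "H1_grad u = (SOME g. weak_grad u g)"

definition has_trace :: "(complex \<Rightarrow> real) \<Rightarrow> (complex \<Rightarrow> real) \<Rightarrow> bool" where
  "has_trace u t \<longleftrightarrow> t \<in> borel_measurable sigma \<and>
     (\<exists>phis Dphis. (\<forall>n. C1_fun (phis n) (Dphis n))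
        \<and> (\<lambda>n. \<integral>\<^sup>+x. ennreal ((phis n x - u x)^2) \<partial>lebesgue_on Omega) \<longlonglongrightarrow> 0
        \<and> (\<lambda>n. \<integral>\<^sup>+x. ennreal ((norm (Dphis n x - H1_grad u x))^2) \<partial>lebesgue_on Omega) \<longlonglongrightarrow> 0
        \<and> (\<lambda>n. \<integral>\<^sup>+x. ennreal ((phis n x - t x)^2) \<partial>sigma) \<longlonglongrightarrow> 0)"

definition trace_of :: "(complex \<Rightarrow> real) \<Rightarrow> complex \<Rightarrow> real" where
  "trace_of u = (SOME t. has_trace u t)"

definition V :: "complex set \<Rightarrow> (complex \<Rightarrow> real) set" where
  "V GD = {u. H1 u \<and> (\<exists>t. has_trace u t) \<and> (AE x in sigma. x \<in> GD \<longrightarrow> trace_of u x = 0)}"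

definition Vnorm :: "(complex \<Rightarrow> real) \<Rightarrow> real" where
  "Vnorm u = sqrt (\<integral>x. (norm (H1_grad u x))^2 \<partial>lebesgue_on Omega)"

definition L2_on :: "complex set \<Rightarrow> (complex \<Rightarrow> real) \<Rightarrow> bool" where
  "L2_on A f \<longleftrightarrow> f \<in> borel_measurable sigma \<and> set_integrable sigma A (\<lambda>x. (f x)^2)"

definition L2norm_on :: "complex set \<Rightarrow> (complex \<Rightarrow> real) \<Rightarrow> real" where
  "L2norm_on A f = sqrt (set_lebesgue_integral sigma A (\<lambda>x. (f x)^2))"

definition beta :: "complex set \<Rightarrow> real \<Rightarrow> real" where
  "beta GD p = Inf {c. c > 0 \<and> (\<forall>u\<in>V GD.
       (\<integral>\<^sup>+x. ennreal (\<bar>trace_of u x\<bar> powr p) \<partial>sigma) \<le> ennreal ((c * Vnorm u) powr p))}"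

definition f_alpha :: "real \<Rightarrow> real \<Rightarrow> real" where
  "f_alpha \<alpha> r = (if r = 0 then 1 else (exp (\<alpha> * r) - exp (- (1 - \<alpha>) * r)) / r)"

definition q_coeff :: "nat \<Rightarrow> real" where
  "q_coeff m = 4 / fact (m + 1) * (real m + 2) powr ((real m + 2) / 2)"

definition R_fun :: "real \<Rightarrow> real" where
  "R_fun z = (\<Sum>k. q_coeff (k + 3) * z ^ k)"

definition M0 :: "complex set \<Rightarrow> complex set \<Rightarrow> complex set \<Rightarrow> (complex \<Rightarrow> real) \<Rightarrow> (complex \<Rightarrow> real) \<Rightarrow> real" where
  "M0 GD GN GR phi g = beta GD 2 * (L2norm_on GN phi + L2norm_on GR g)"

definition Lambda :: "complex set \<Rightarrow> real \<Rightarrow> real \<Rightarrow> real" where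
  "Lambda GD C m0 = 1 / (beta GD 3 ^ 3 * m0 + beta GD 4 ^ 4 * m0 ^ 2 + (C * m0) ^ 3 * R_fun (C * m0))"

text \<open>Weak solutions of problem (S).  phi: Neumann datum, g: Robin datum, rob: Robin coefficient.\<close>
definition weak_solution ::
  "complex set \<Rightarrow> complex set \<Rightarrow> complex set \<Rightarrow> (complex \<Rightarrow> real) \<Rightarrow> (complex \<Rightarrow> real)
     \<Rightarrow> (complex \<Rightarrow> real) \<Rightarrow> real \<Rightarrow> (complex \<Rightarrow> real) \<Rightarrow> bool" where
  "weak_solution GD GN GR phi g rob \<alpha> u \<longleftrightarrow> u \<in> V GD \<and>
     (\<forall>v\<in>V GD.
        set_integrable sigma GR (\<lambda>x. rob x * f_alpha \<alpha> (trace_of u x) * trace_of u x * trace_of v x) \<and>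
        (\<integral>x. H1_grad u x \<bullet> H1_grad v x \<partial>lebesgue_on Omega)
          + set_lebesgue_integral sigma GR (\<lambda>x. rob x * f_alpha \<alpha> (trace_of u x) * trace_of u x * trace_of v x)
        = set_lebesgue_integral sigma GN (\<lambda>x. phi x * trace_of v x)
          + set_lebesgue_integral sigma GR (\<lambda>x. g x * trace_of v x))"

end

theory Submission
  imports Defs
begin

text \<open>Write \<open>F(r) = exp (\<alpha> r) - exp (- (1 - \<alpha>) r)\<close>, so that the boundary term is \<open>rob F(u)\<close>.
  Since \<open>F\<close> is increasing and \<open>rob \<ge> 0\<close>, problem (S) is the Euler equation of the strictly
  convex energy \<open>\<integral>\<bar>grad u\<bar>\<^sup>2 / 2 + \<integral> rob G(u) - \<integral> phi u - \<integral> g u\<close> with \<open>G' = F\<close>.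
  The embedding hypothesis makes \<open>exp \<bar>u\<bar>\<close> integrable on the circle to every power, so the energy
  is finite; a minimising sequence is Cauchy by the parallelogram law, and Fatou's lemma
  shows that its limit is a minimiser. Uniqueness follows by testing the difference
  of two equations with the difference of the solutions.\<close>

section \<open>Integration over the disk and the circle\<close>

text \<open>Weak gradients and traces are Hilbert choices, fixed only up to null sets, and the norm
  of V sees the gradient alone. This shapes the proof: before energies can be minimised, gradients
  and traces must be shown unique a.e., and a sequence in V with Cauchy gradients must be shown to
  converge in V. Uniqueness of traces and a Friedrichs inequality both come from one-dimensional
  calculus on vertical chords of the disk. Completeness is then a chain: the embedding at p = 4
  bounds the trace by the gradient, and the Friedrichs inequality bounds the function by its trace
  and gradient. The same chain turns equality of gradients into equality of solutions. The Euler
  equation is obtained without differentiating under the integral: along a line the energy is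
  bounded above by an explicit quadratic polynomial in the step, and minimality for steps of both
  signs forces its linear coefficient to vanish.\<close>

lemma lborel_complex_eq_distr:
  "(lborel :: complex measure) = distr (lborel \<Otimes>\<^sub>M lborel) borel (\<lambda>(x, y). Complex x y)"
proof (rule lborel_eqI)
  have [measurable]: "(\<lambda>(x, y). Complex x y) \<in> lborel \<Otimes>\<^sub>M lborel \<rightarrow>\<^sub>M borel"
    unfolding Complex_eq by simp
  fix l u :: complex
  assume lu: "\<And>b. b \<in> Basis \<Longrightarrow> l \<bullet> b \<le> u \<bullet> b"
  have le: "Re l \<le> Re u" "Im l \<le> Im u"
    using lu[of 1] lu[of \<i>] by (auto simp: Basis_complex_def)
  have "(\<lambda>(x, y). Complex x y) -` box l u \<inter> space (lborel \<Otimes>\<^sub>M lborel)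
      = {Re l<..<Re u} \<times> {Im l<..<Im u}"
    by (auto simp: box_def Basis_complex_def space_pair_measure)
  then show "emeasure (distr (lborel \<Otimes>\<^sub>M lborel) borel (\<lambda>(x, y). Complex x y)) (box l u)
      = ennreal (\<Prod>b\<in>Basis. (u - l) \<bullet> b)"
    using le by (simp add: emeasure_distr lborel.emeasure_pair_measure_Times Basis_complex_def
        ennreal_mult)
qed simp

lemma nn_integral_lborel_complex:
  fixes f :: "complex \<Rightarrow> ennreal"
  assumes [measurable]: "f \<in> borel_measurable borel"
  shows "(\<integral>\<^sup>+z. f z \<partial>lborel) = (\<integral>\<^sup>+x. \<integral>\<^sup>+y. f (Complex x y) \<partial>lborel \<partial>lborel)"
proof -
  have [measurable]: "(\<lambda>(x, y). Complex x y) \<in> lborel \<Otimes>\<^sub>M lborel \<rightarrow>\<^sub>M borel"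
    unfolding Complex_eq by simp
  show ?thesis
    by (subst lborel_complex_eq_distr)
       (simp add: nn_integral_distr lborel_pair.nn_integral_snd lborel.nn_integral_fst[symmetric])
qed

lemma Omega_borel [measurable]: "Omega \<in> sets borel"
  by (simp add: Omega_def)

lemma nn_integral_Omega:
  "(\<integral>\<^sup>+z. f z \<partial>lebesgue_on Omega) = (\<integral>\<^sup>+z. f z * indicator Omega z \<partial>lborel)"
  by (subst nn_integral_restrict_space) (auto simp: nn_integral_completion Omega_def)

text \<open>Valid for every real x because HOL's \<open>sqrt\<close> is odd and strictly increasing
  on the whole line: for |x| > 1 the bound is negative and no y satisfies it.\<close>

lemma Complex_in_Omega: "Complex x y \<in> Omega \<longleftrightarrow> \<bar>y\<bar> < sqrt (1 - x\<^sup>2)"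
proof -
  have "Complex x y \<in> Omega \<longleftrightarrow> x\<^sup>2 + y\<^sup>2 < 1"
    by (simp add: Omega_def cmod_def)
  also have "\<dots> \<longleftrightarrow> sqrt (y\<^sup>2) < sqrt (1 - x\<^sup>2)"
    unfolding real_sqrt_less_iff by (simp add: algebra_simps)
  finally show ?thesis by simp
qed

text \<open>Tonelli along vertical chords. Closing a chord adds only its two end points, a null set
  of the line.\<close>

lemma nn_integral_Omega_iterated:
  fixes f :: "complex \<Rightarrow> ennreal"
  assumes [measurable]: "f \<in> borel_measurable borel"
  shows "(\<integral>\<^sup>+z. f z \<partial>lebesgue_on Omega) =
    (\<integral>\<^sup>+x. (\<integral>\<^sup>+y. f (Complex x y) * indicator {- sqrt (1 - x\<^sup>2)..sqrt (1 - x\<^sup>2)} y \<partial>lborel)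
        * indicator {-1..1} x \<partial>lborel)"
proof -
  have "(\<integral>\<^sup>+z. f z \<partial>lebesgue_on Omega)
      = (\<integral>\<^sup>+x. \<integral>\<^sup>+y. f (Complex x y) * indicator Omega (Complex x y) \<partial>lborel \<partial>lborel)"
    by (simp add: nn_integral_Omega nn_integral_lborel_complex)
  also have "\<dots> = (\<integral>\<^sup>+x. (\<integral>\<^sup>+y. f (Complex x y) * indicator {- sqrt (1 - x\<^sup>2)..sqrt (1 - x\<^sup>2)} y \<partial>lborel)
        * indicator {-1..1} x \<partial>lborel)"
  proof (rule nn_integral_cong)
    fix x :: real
    let ?s = "sqrt (1 - x\<^sup>2)"
    show "(\<integral>\<^sup>+y. f (Complex x y) * indicator Omega (Complex x y) \<partial>lborel)
      = (\<integral>\<^sup>+y. f (Complex x y) * indicator {- ?s..?s} y \<partial>lborel) * indicator {-1..1} x"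
    proof (cases "x \<in> {-1..1}")
      case True
      have "AE y in lborel. y \<noteq> ?s \<and> y \<noteq> - ?s"
        using AE_lborel_singleton[of ?s] AE_lborel_singleton[of "- ?s"] by eventually_elim auto
      then have "AE y in lborel. indicator Omega (Complex x y) = (indicator {- ?s..?s} y :: ennreal)"
        by eventually_elim (auto simp: indicator_def Complex_in_Omega)
      then have "(\<integral>\<^sup>+y. f (Complex x y) * indicator Omega (Complex x y) \<partial>lborel)
        = (\<integral>\<^sup>+y. f (Complex x y) * indicator {- ?s..?s} y \<partial>lborel)"
        by (intro nn_integral_cong_AE) auto
      then show ?thesis using True by simp
    next
      case False
      then have "\<bar>x\<bar> > 1" by auto
      then have "x\<^sup>2 > 1" using one_less_power[of "\<bar>x\<bar>" 2] by simp
      then have "sqrt (1 - x\<^sup>2) < 0" by simp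
      then have "\<not> \<bar>y\<bar> < ?s" for y
        using abs_ge_zero[of y] by linarith
      then show ?thesis using False by (simp add: Complex_in_Omega indicator_def)
    qed
  qed
  finally show ?thesis .
qed

lemma cis_measurable [measurable]: "cis \<in> borel_measurable borel"
  by (intro borel_measurable_continuous_onI continuous_intros)

lemma cis_measurable_lebesgue_on: "cis \<in> lebesgue_on A \<rightarrow>\<^sub>M borel"
  by (intro measurable_restrict_space1 measurable_completion) simp

lemma sets_sigma [measurable_cong, simp]: "sets sigma = sets borel"
  by (simp add: sigma_def)

lemma space_sigma [simp]: "space sigma = UNIV"
  by (simp add: sigma_def)

text \<open>Closing the interval at \<open>2*pi\<close> changes a null set and prepares the split
  into the closed intervals of the upper and the lower half circle.\<close>

lemma nn_integral_sigma:
  assumes f: "f \<in> borel_measurable borel"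
  shows "(\<integral>\<^sup>+z. f z \<partial>sigma) = (\<integral>\<^sup>+t. f (cis t) * indicator {0..2*pi} t \<partial>lborel)"
proof -
  have "(\<integral>\<^sup>+z. f z \<partial>sigma) = (\<integral>\<^sup>+t. f (cis t) \<partial>lebesgue_on {0..<2*pi})"
    unfolding sigma_def using f by (intro nn_integral_distr cis_measurable_lebesgue_on) simp
  also have "\<dots> = (\<integral>\<^sup>+t. f (cis t) * indicator {0..<2*pi} t \<partial>lborel)"
    by (subst nn_integral_restrict_space) (auto simp: nn_integral_completion)
  also have "\<dots> = (\<integral>\<^sup>+t. f (cis t) * indicator {0..2*pi} t \<partial>lborel)"
    using AE_lborel_singleton[of "2*pi"]
    by (intro nn_integral_cong_AE, eventually_elim) (auto simp: indicator_def)
  finally show ?thesis .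
qed

lemma finite_measure_sigma: "finite_measure sigma"
proof
  have "emeasure sigma (space sigma) = (\<integral>\<^sup>+z. 1 \<partial>sigma)" by simp
  also have "\<dots> = ennreal (2*pi)"
    by (subst nn_integral_sigma) auto
  finally show "emeasure sigma (space sigma) \<noteq> \<infinity>" by simp
qed

interpretation sigma: finite_measure sigma by (rule finite_measure_sigma)

lemma finite_measure_Omega: "finite_measure (lebesgue_on Omega)"
proof
  have "emeasure (lebesgue_on Omega) Omega = emeasure lborel Omega"
    by (subst emeasure_restrict_space) (auto simp: emeasure_completion main_part_sets)
  also have "\<dots> < \<infinity>"
    unfolding Omega_def by (intro emeasure_bounded_finite) auto
  finally show "emeasure (lebesgue_on Omega) (space (lebesgue_on Omega)) \<noteq> \<infinity>" 
    by (simp add: space_restrict_space)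
qed

interpretation Omega: finite_measure "lebesgue_on Omega" by (rule finite_measure_Omega)

text \<open>The weight \<open>\<bar>Im z\<bar>\<close> is the Jacobian of \<open>x = cos t\<close>.\<close>

lemma nn_integral_sigma_Im:
  fixes h :: "complex \<Rightarrow> real"
  assumes h: "continuous_on UNIV h" and pos: "\<And>z. h z \<ge> 0"
  shows "(\<integral>\<^sup>+z. ennreal (h z * \<bar>Im z\<bar>) \<partial>sigma) =
    (\<integral>\<^sup>+x. ennreal (h (Complex x (sqrt (1 - x\<^sup>2))) + h (Complex x (- sqrt (1 - x\<^sup>2))))
        * indicator {-1..1} x \<partial>lborel)"
proof -
  have [measurable]: "h \<in> borel_measurable borel"
    using h by (rule borel_measurable_continuous_onI)
  have C [measurable]: "(\<lambda>x. h (Complex x (sqrt (1 - x\<^sup>2)))) \<in> borel_measurable borel"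
       "(\<lambda>x. h (Complex x (- sqrt (1 - x\<^sup>2)))) \<in> borel_measurable borel"
       "(\<lambda>x. h (Complex (- x) (sqrt (1 - x\<^sup>2)))) \<in> borel_measurable borel"
    unfolding Complex_eq by measurable
  have sc: "sqrt (1 - (cos t)\<^sup>2) = \<bar>sin t\<bar>" for t :: real
    by (simp flip: sin_squared_eq)
  have "(\<integral>\<^sup>+z. ennreal (h z * \<bar>Im z\<bar>) \<partial>sigma)
      = (\<integral>\<^sup>+t. ennreal (h (cis t) * \<bar>sin t\<bar>) * indicator {0..2*pi} t \<partial>lborel)"
    by (subst nn_integral_sigma) auto
  also have "\<dots> = (\<integral>\<^sup>+t. ennreal (h (cis t) * \<bar>sin t\<bar>) * indicator {0..pi} t
      + ennreal (h (cis t) * \<bar>sin t\<bar>) * indicator {pi..2*pi} t \<partial>lborel)"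
    using AE_lborel_singleton[of pi]
    by (intro nn_integral_cong_AE, eventually_elim) (auto simp: indicator_def)
  also have "\<dots> = (\<integral>\<^sup>+t. ennreal (h (cis t) * \<bar>sin t\<bar>) * indicator {0..pi} t \<partial>lborel)
      + (\<integral>\<^sup>+t. ennreal (h (cis t) * \<bar>sin t\<bar>) * indicator {pi..2*pi} t \<partial>lborel)"
    by (rule nn_integral_add) auto
  also have "(\<integral>\<^sup>+t. ennreal (h (cis t) * \<bar>sin t\<bar>) * indicator {0..pi} t \<partial>lborel)
      = (\<integral>\<^sup>+x. ennreal (h (Complex (- x) (sqrt (1 - x\<^sup>2)))) * indicator {- cos 0..- cos pi} x \<partial>lborel)"
  proof -
    \<comment> \<open>The substitution rule asks for a nonnegative derivative, and the cosine
      decreases on [0, pi]. Hence x = - cos t is used here and a reflection removes the sign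
      afterwards; on [pi, 2 pi] the cosine itself increases.\<close>
    have "(\<integral>\<^sup>+x. ennreal (h (Complex (- x) (sqrt (1 - x\<^sup>2))) * indicator {- cos 0..- cos pi} x) \<partial>lborel)
      = (\<integral>\<^sup>+t. ennreal (h (Complex (- (- cos t)) (sqrt (1 - (- cos t)\<^sup>2))) * sin t * indicator {0..pi} t) \<partial>lborel)"
    proof (rule nn_integral_substitution)
      show "((\<lambda>t. - cos t) has_real_derivative sin t) (at t)" for t
        using DERIV_minus[OF DERIV_cos[of t]] by simp
      show "continuous_on {0..pi} sin"
        by (intro continuous_intros)
    qed (use sin_ge_zero in \<open>auto simp: set_borel_measurable_def\<close>)
    also have "\<dots> = (\<integral>\<^sup>+t. ennreal (h (cis t) * \<bar>sin t\<bar>) * indicator {0..pi} t \<partial>lborel)"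
      by (intro nn_integral_cong) (auto simp: indicator_def sc cis.code sin_ge_zero)
    finally show ?thesis
      by (simp add: ennreal_mult' pos ennreal_indicator)
  qed
  also have "\<dots> = (\<integral>\<^sup>+x. ennreal (h (Complex x (sqrt (1 - x\<^sup>2)))) * indicator {-1..1} x \<partial>lborel)"
  proof -
    have "indicator {-1..1} (- x) = (indicator {- cos 0..- cos pi} x :: ennreal)" for x :: real
      by (auto simp: indicator_def)
    then show ?thesis
      using nn_integral_real_affine
        [of "\<lambda>x. ennreal (h (Complex x (sqrt (1 - x\<^sup>2)))) * indicator {-1..1} x" "-1" 0]
      by simp
  qed
  also have "(\<integral>\<^sup>+t. ennreal (h (cis t) * \<bar>sin t\<bar>) * indicator {pi..2*pi} t \<partial>lborel)
      = (\<integral>\<^sup>+x. ennreal (h (Complex x (- sqrt (1 - x\<^sup>2)))) * indicator {cos pi..cos (2*pi)} x \<partial>lborel)"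
  proof -
    have sn: "sin t \<le> 0" if "pi \<le> t" "t \<le> 2*pi" for t
      using sin_ge_zero[of "t - pi"] that by simp
    have "(\<integral>\<^sup>+x. ennreal (h (Complex x (- sqrt (1 - x\<^sup>2))) * indicator {cos pi..cos (2*pi)} x) \<partial>lborel)
      = (\<integral>\<^sup>+t. ennreal (h (Complex (cos t) (- sqrt (1 - (cos t)\<^sup>2))) * (- sin t) * indicator {pi..2*pi} t) \<partial>lborel)"
    proof (rule nn_integral_substitution)
      show "(cos has_real_derivative - sin t) (at t)" for t
        by (rule DERIV_cos)
      show "continuous_on {pi..2*pi} (\<lambda>t. - sin t)"
        by (intro continuous_intros)
    qed (use sn in \<open>auto simp: set_borel_measurable_def\<close>)
    also have "\<dots> = (\<integral>\<^sup>+t. ennreal (h (cis t) * \<bar>sin t\<bar>) * indicator {pi..2*pi} t \<partial>lborel)"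
      using sn by (intro nn_integral_cong) (auto simp: indicator_def sc cis.code)
    finally show ?thesis
      by (simp add: ennreal_mult' pos ennreal_indicator)
  qed
  also have "(\<integral>\<^sup>+x. ennreal (h (Complex x (sqrt (1 - x\<^sup>2)))) * indicator {-1..1} x \<partial>lborel) + \<dots>
     = (\<integral>\<^sup>+x. ennreal (h (Complex x (sqrt (1 - x\<^sup>2)))) * indicator {-1..1} x
        + ennreal (h (Complex x (- sqrt (1 - x\<^sup>2)))) * indicator {cos pi..cos (2*pi)} x \<partial>lborel)"
    by (rule nn_integral_add[symmetric]) auto
  also have "\<dots> = (\<integral>\<^sup>+x. ennreal (h (Complex x (sqrt (1 - x\<^sup>2))) + h (Complex x (- sqrt (1 - x\<^sup>2))))
        * indicator {-1..1} x \<partial>lborel)"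
    by (intro nn_integral_cong) (auto simp: indicator_def ennreal_plus pos)
  finally show ?thesis .
qed

section \<open>Trace inequalities for continuously differentiable functions\<close>

lemma C1_fun_continuous: "C1_fun p D \<Longrightarrow> continuous_on UNIV p"
  unfolding C1_fun_def by (meson continuous_at_imp_continuous_on has_derivative_continuous)

lemma C1_fun_measurable:
  assumes "C1_fun p D"
  shows "p \<in> borel_measurable borel" "D \<in> borel_measurable borel"
  using C1_fun_continuous[OF assms] assms unfolding C1_fun_def
  by (auto intro: borel_measurable_continuous_onI)

lemma C1_fun_diff: "C1_fun p D \<Longrightarrow> C1_fun q E \<Longrightarrow> C1_fun (\<lambda>z. p z - q z) (\<lambda>z. D z - E z)"
  unfolding C1_fun_def
  by (auto intro!: derivative_eq_intros continuous_intros simp: inner_diff_left)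

lemma C1_fun_lin: "C1_fun p D \<Longrightarrow> C1_fun q E \<Longrightarrow>
    C1_fun (\<lambda>z. a * p z + b * q z) (\<lambda>z. a *\<^sub>R D z + b *\<^sub>R E z)"
  unfolding C1_fun_def
  by (auto intro!: derivative_eq_intros continuous_intros simp: inner_add_left)

lemma C1_fun_mult: "C1_fun p D \<Longrightarrow> C1_fun q E \<Longrightarrow>
    C1_fun (\<lambda>z. p z * q z) (\<lambda>z. p z *\<^sub>R E z + q z *\<^sub>R D z)"
  using C1_fun_continuous[of p D] C1_fun_continuous[of q E] unfolding C1_fun_def
  by (auto intro!: derivative_eq_intros continuous_intros simp: inner_add_left)

lemma C1_fun_comp:
  assumes h: "\<And>t. (h has_real_derivative h' t) (at t)" and h': "continuous_on UNIV h'"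
    and p: "C1_fun p D"
  shows "C1_fun (\<lambda>z. h (p z)) (\<lambda>z. h' (p z) *\<^sub>R D z)"
proof -
  have "((\<lambda>z. h (p z)) has_derivative (\<lambda>v. (h' (p x) *\<^sub>R D x) \<bullet> v)) (at x)" for x
  proof -
    have "(h has_derivative (\<lambda>t. h' (p x) * t)) (at (p x))"
      using h[of "p x"] by (simp add: has_field_derivative_def)
    moreover have "(p has_derivative (\<lambda>v. D x \<bullet> v)) (at x)"
      using p by (simp add: C1_fun_def)
    ultimately have "(h \<circ> p has_derivative (\<lambda>t. h' (p x) * t) \<circ> (\<lambda>v. D x \<bullet> v)) (at x)"
      by (rule diff_chain_at[rotated])
    then show ?thesis by (simp add: o_def)
  qed
  moreover have "continuous_on UNIV (\<lambda>z. h' (p z) *\<^sub>R D z)"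
    using continuous_on_compose2[OF h' C1_fun_continuous[OF p]] p
    by (auto simp: C1_fun_def intro!: continuous_intros)
  ultimately show ?thesis by (simp add: C1_fun_def)
qed

lemma C1_fun_vertical_derivative:
  assumes "C1_fun p D"
  shows "((\<lambda>y. p (Complex x y)) has_real_derivative Im (D (Complex x y))) (at y)"
proof -
  have "((\<lambda>y. Complex x y) has_derivative (\<lambda>t. Complex 0 t)) (at y)"
    unfolding Complex_eq by (auto intro!: derivative_eq_intros)
  moreover have "(p has_derivative (\<lambda>v. D (Complex x y) \<bullet> v)) (at (Complex x y))"
    using assms by (simp add: C1_fun_def)
  ultimately have "(p \<circ> (\<lambda>y. Complex x y) has_derivative
      (\<lambda>v. D (Complex x y) \<bullet> v) \<circ> (\<lambda>t. Complex 0 t)) (at y)"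
    by (rule diff_chain_at)
  moreover have "(\<lambda>v. D (Complex x y) \<bullet> v) \<circ> (\<lambda>t. Complex 0 t) = (*) (Im (D (Complex x y)))"
    by (auto simp: inner_complex_def)
  ultimately show ?thesis
    by (simp add: has_field_derivative_def o_def)
qed

text \<open>Both estimates of a chord come from integrating \<open>(y p\<^sup>2)' = p\<^sup>2 + 2 y p p'\<close>
  over it, with the cross term absorbed by Young's inequality.\<close>

lemma C1_fun_chord:
  assumes p: "C1_fun p D" and x: "x \<in> {-1..1}"
  defines "s \<equiv> sqrt (1 - x\<^sup>2)"
  defines "B \<equiv> s * (p (Complex x s))\<^sup>2 + s * (p (Complex x (- s)))\<^sup>2"
  defines "I \<equiv> \<lambda>f. integral {-s..s} (\<lambda>y. f (Complex x y)) :: real"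
  shows "B \<le> 2 * I (\<lambda>z. (p z)\<^sup>2) + I (\<lambda>z. (norm (D z))\<^sup>2)"
    and "I (\<lambda>z. (p z)\<^sup>2) \<le> 2 * B + 4 * I (\<lambda>z. (norm (D z))\<^sup>2)"
proof -
  have x2: "x\<^sup>2 \<le> 1" using x by (simp add: abs_square_le_1 abs_le_iff)
  have s: "0 \<le> s" "s \<le> 1" using x2 by (auto simp: s_def)
  let ?d = "\<lambda>y. (p (Complex x y))\<^sup>2 + 2 * y * p (Complex x y) * Im (D (Complex x y))"
  have pc: "continuous_on UNIV p" and Dc: "continuous_on UNIV D"
    using C1_fun_continuous[OF p] p by (auto simp: C1_fun_def)
  have cc: "continuous_on A (\<lambda>y. Complex x y)" for A
    unfolding Complex_eq by (intro continuous_intros)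
  have c1: "continuous_on A (\<lambda>y. p (Complex x y))" and c2: "continuous_on A (\<lambda>y. D (Complex x y))" for A
    using continuous_on_compose2[OF pc cc] continuous_on_compose2[OF Dc cc] by auto
  have i1: "(\<lambda>y. (p (Complex x y))\<^sup>2) integrable_on {-s..s}"
    and i2: "(\<lambda>y. (norm (D (Complex x y)))\<^sup>2) integrable_on {-s..s}"
    and i3: "?d integrable_on {-s..s}"
    by (intro integrable_continuous_interval continuous_intros c1 c2)+
  have "(?d has_integral (s * (p (Complex x s))\<^sup>2 - (- s) * (p (Complex x (- s)))\<^sup>2)) {-s..s}"
  proof (rule fundamental_theorem_of_calculus)
    fix y
    show "((\<lambda>y. y * (p (Complex x y))\<^sup>2) has_vector_derivative ?d y) (at y within {-s..s})"
      unfolding has_real_derivative_iff_has_vector_derivative[symmetric]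
      by (rule DERIV_subset[where s = UNIV])
         (auto intro!: derivative_eq_intros C1_fun_vertical_derivative[OF p] simp: algebra_simps)
  qed (use s in simp)
  then have B: "B = integral {-s..s} ?d"
    by (simp add: B_def integral_unique)
  \<comment> \<open>The factor |y| is absorbed because half-chords of the unit disk have length at
    most 1. The weight a stays free, since the two estimates use different values.\<close>
  have young: "\<bar>2 * y * p z * Im (D z)\<bar> \<le> a * (p z)\<^sup>2 + (norm (D z))\<^sup>2 / a"
    if "y \<in> {-s..s}" "a > 0" for y z a
  proof -
    have "\<bar>Im (D z)\<bar> \<le> norm (D z)" by (rule abs_Im_le_cmod)
    moreover have "\<bar>y\<bar> \<le> 1" using that s by auto
    ultimately have "\<bar>y\<bar> * (\<bar>p z\<bar> * \<bar>Im (D z)\<bar>) \<le> 1 * (\<bar>p z\<bar> * norm (D z))"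
      by (intro mult_mono) auto
    moreover have "2 * (\<bar>p z\<bar> * norm (D z)) \<le> a * (p z)\<^sup>2 + (norm (D z))\<^sup>2 / a"
    proof -
      have "0 \<le> (a * \<bar>p z\<bar> - norm (D z))\<^sup>2 / a" using that by simp
      also have "\<dots> = a * (p z)\<^sup>2 + (norm (D z))\<^sup>2 / a - 2 * (\<bar>p z\<bar> * norm (D z))"
        using that by (simp add: power2_eq_square field_simps)
      finally show ?thesis by simp
    qed
    ultimately show ?thesis by (simp add: abs_mult)
  qed
  have "B \<le> integral {-s..s} (\<lambda>y. 2 * (p (Complex x y))\<^sup>2 + (norm (D (Complex x y)))\<^sup>2)"
    unfolding B
  proof (rule integral_le)
    show "(\<lambda>y. 2 * (p (Complex x y))\<^sup>2 + (norm (D (Complex x y)))\<^sup>2) integrable_on {-s..s}"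
      by (intro integrable_continuous_interval continuous_intros c1 c2)
    fix y assume "y \<in> {-s..s}"
    then show "?d y \<le> 2 * (p (Complex x y))\<^sup>2 + (norm (D (Complex x y)))\<^sup>2"
      using young[of y 1 "Complex x y"] by (simp add: abs_le_iff)
  qed (rule i3)
  also have "\<dots> = 2 * I (\<lambda>z. (p z)\<^sup>2) + I (\<lambda>z. (norm (D z))\<^sup>2)"
    unfolding I_def using i1 i2 by (subst integral_add) auto
  finally show "B \<le> 2 * I (\<lambda>z. (p z)\<^sup>2) + I (\<lambda>z. (norm (D z))\<^sup>2)" .
  \<comment> \<open>With weight 1/2 the cross term costs half of p^2, which is absorbed on the left;
    doubling then produces the constants 2 and 4.\<close>
  have "I (\<lambda>z. (p z)\<^sup>2) \<le> integral {-s..s} (\<lambda>y. 2 * ?d y + 4 * (norm (D (Complex x y)))\<^sup>2)"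
    unfolding I_def
  proof (rule integral_le)
    show "(\<lambda>y. 2 * ?d y + 4 * (norm (D (Complex x y)))\<^sup>2) integrable_on {-s..s}"
      by (intro integrable_continuous_interval continuous_intros c1 c2)
    fix y assume "y \<in> {-s..s}"
    then show "(p (Complex x y))\<^sup>2 \<le> 2 * ?d y + 4 * (norm (D (Complex x y)))\<^sup>2"
      using young[of y "1/2" "Complex x y"] by (simp add: abs_le_iff)
  qed (rule i1)
  also have "\<dots> = 2 * B + 4 * I (\<lambda>z. (norm (D z))\<^sup>2)"
    unfolding I_def B
    by (rule integral_unique, intro has_integral_add has_integral_mult_right integrable_integral i2 i3)
  finally show "I (\<lambda>z. (p z)\<^sup>2) \<le> 2 * B + 4 * I (\<lambda>z. (norm (D z))\<^sup>2)" .
qed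

lemma nn_integral_chord:
  fixes f :: "complex \<Rightarrow> real"
  assumes f: "continuous_on UNIV f" and pos: "\<And>z. f z \<ge> 0"
  shows "(\<integral>\<^sup>+y. ennreal (f (Complex x y)) * indicator {a..b} y \<partial>lborel)
    = ennreal (integral {a..b} (\<lambda>y. f (Complex x y)))"
proof -
  have cc: "continuous_on A (\<lambda>y. Complex x y)" for A
    unfolding Complex_eq by (intro continuous_intros)
  have c: "continuous_on A (\<lambda>y. f (Complex x y))" for A
    using continuous_on_compose2[OF f cc] by auto
  have [measurable]: "(\<lambda>y. f (Complex x y)) \<in> borel_measurable borel"
    using c by (rule borel_measurable_continuous_onI)
  have "((\<lambda>y. f (Complex x y)) has_integral integral {a..b} (\<lambda>y. f (Complex x y))) {a..b}"
    by (intro integrable_integral integrable_continuous_interval c)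
  then have "((\<lambda>y. f (Complex x y) * indicator {a..b} y) has_integral
      integral {a..b} (\<lambda>y. f (Complex x y))) UNIV"
    by (subst (asm) has_integral_restrict_UNIV[symmetric])
       (simp add: indicator_def of_bool_def if_distrib[where f = "\<lambda>c. _ * c"] cong: if_cong)
  then have "(\<integral>\<^sup>+y. ennreal (f (Complex x y) * indicator {a..b} y) \<partial>lborel)
    = ennreal (integral {a..b} (\<lambda>y. f (Complex x y)))"
    by (rule nn_integral_has_integral_lborel[rotated 2]) (auto simp: pos)
  then show ?thesis
    by (simp add: ennreal_mult' pos ennreal_indicator)
qed

text \<open>The weight \<open>(Im z)\<^sup>2\<close> vanishes at two boundary points only, which is harmless for
  the uniqueness of traces, and it lets vertical chords alone suffice.\<close>

lemma C1_fun_trace_inequalities: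
  assumes p: "C1_fun p D"
  shows "(\<integral>\<^sup>+z. ennreal ((p z)\<^sup>2 * (Im z)\<^sup>2) \<partial>sigma)
      \<le> 2 * (\<integral>\<^sup>+z. ennreal ((p z)\<^sup>2) \<partial>lebesgue_on Omega)
        + (\<integral>\<^sup>+z. ennreal ((norm (D z))\<^sup>2) \<partial>lebesgue_on Omega)" (is "?B \<le> 2 * ?P + ?D")
    and "(\<integral>\<^sup>+z. ennreal ((p z)\<^sup>2) \<partial>lebesgue_on Omega)
      \<le> 2 * (\<integral>\<^sup>+z. ennreal ((p z)\<^sup>2 * (Im z)\<^sup>2) \<partial>sigma)
        + 4 * (\<integral>\<^sup>+z. ennreal ((norm (D z))\<^sup>2) \<partial>lebesgue_on Omega)"
proof -
  have pc: "continuous_on UNIV p" and Dc: "continuous_on UNIV D"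
    using C1_fun_continuous[OF p] p by (auto simp: C1_fun_def)
  note [measurable] = C1_fun_measurable[OF p]
  define s where "s = (\<lambda>x::real. sqrt (1 - x\<^sup>2))"
  define b where "b = (\<lambda>x. s x * (p (Complex x (s x)))\<^sup>2 + s x * (p (Complex x (- s x)))\<^sup>2)"
  define I where "I = (\<lambda>f x. integral {-s x..s x} (\<lambda>y. f (Complex x y)) :: real)"
  have [measurable]: "b \<in> borel_measurable borel"
    unfolding b_def s_def Complex_eq by measurable
  have s: "s x \<ge> 0" if "x \<in> {-1..1}" for x
    using that by (simp add: s_def abs_square_le_1 abs_le_iff)
  have b0: "b x \<ge> 0" if "x \<in> {-1..1}" for x
    using s[OF that] by (simp add: b_def)
  have B: "?B = (\<integral>\<^sup>+x. ennreal (b x) * indicator {-1..1} x \<partial>lborel)"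
  proof -
    \<comment> \<open>One factor |Im z| is the Jacobian; the other becomes the half-chord length
      that multiplies the boundary values in \<open>C1_fun_chord\<close>.\<close>
    have "?B = (\<integral>\<^sup>+z. ennreal ((p z)\<^sup>2 * \<bar>Im z\<bar> * \<bar>Im z\<bar>) \<partial>sigma)"
      by (simp add: power2_eq_square mult.assoc)
    also have "\<dots> = (\<integral>\<^sup>+x. ennreal ((p (Complex x (s x)))\<^sup>2 * \<bar>s x\<bar>
        + (p (Complex x (- s x)))\<^sup>2 * \<bar>- s x\<bar>) * indicator {-1..1} x \<partial>lborel)"
      unfolding s_def by (subst nn_integral_sigma_Im) (auto intro!: continuous_intros pc)
    also have "\<dots> = (\<integral>\<^sup>+x. ennreal (b x) * indicator {-1..1} x \<partial>lborel)"
      using s by (intro nn_integral_cong) (auto simp: indicator_def b_def mult.commute)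
    finally show ?thesis .
  qed
  have iter: "(\<integral>\<^sup>+z. ennreal (f z) \<partial>lebesgue_on Omega)
      = (\<integral>\<^sup>+x. ennreal (I f x) * indicator {-1..1} x \<partial>lborel)"
    and Imeas: "(\<lambda>x. ennreal (I f x)) \<in> borel_measurable borel"
    if f: "continuous_on UNIV f" "\<And>z. f z \<ge> 0" for f
  proof -
    have [measurable]: "f \<in> borel_measurable borel"
      using f(1) by (rule borel_measurable_continuous_onI)
    show "(\<integral>\<^sup>+z. ennreal (f z) \<partial>lebesgue_on Omega)
      = (\<integral>\<^sup>+x. ennreal (I f x) * indicator {-1..1} x \<partial>lborel)"
      by (subst nn_integral_Omega_iterated) (simp_all add: nn_integral_chord[OF f] I_def s_def)
    \<comment> \<open>The chord integral has limits depending on x; its measurability is read off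
      from the joint measurability of the integrand with its indicator.\<close>
    have "(\<lambda>x. \<integral>\<^sup>+y. ennreal (f (Complex x y)) * indicator {-s x..s x} y \<partial>lborel) \<in> borel_measurable borel"
      unfolding Complex_eq s_def indicator_def atLeastAtMost_iff by measurable
    then show "(\<lambda>x. ennreal (I f x)) \<in> borel_measurable borel"
      by (simp add: nn_integral_chord[OF f] I_def)
  qed
  have I0: "I f x \<ge> 0" if f: "continuous_on UNIV f" "\<And>z. f z \<ge> 0" for f x
    unfolding I_def
  proof (intro integral_nonneg integrable_continuous_interval)
    have cc: "continuous_on A (\<lambda>y. Complex x y)" for A
      unfolding Complex_eq by (intro continuous_intros)
    show "continuous_on {-s x..s x} (\<lambda>y. f (Complex x y))"
      using continuous_on_compose2[OF f(1) cc] by auto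
  qed (use f in auto)
  have c: "continuous_on UNIV (\<lambda>z. (p z)\<^sup>2)" "continuous_on UNIV (\<lambda>z. (norm (D z))\<^sup>2)"
    by (intro continuous_intros pc Dc)+
  note [measurable] = Imeas[OF c(1), simplified] Imeas[OF c(2), simplified]
  note I0' = I0[OF c(1), simplified] I0[OF c(2), simplified]
  note iter' = iter[OF c(1), simplified] iter[OF c(2), simplified]
  have "?B \<le> (\<integral>\<^sup>+x. 2 * (ennreal (I (\<lambda>z. (p z)\<^sup>2) x) * indicator {-1..1} x)
      + ennreal (I (\<lambda>z. (norm (D z))\<^sup>2) x) * indicator {-1..1} x \<partial>lborel)"
    unfolding B
  proof (rule nn_integral_mono)
    fix x :: real
    show "ennreal (b x) * indicator {-1..1} x \<le> 2 * (ennreal (I (\<lambda>z. (p z)\<^sup>2) x) * indicator {-1..1} x)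
      + ennreal (I (\<lambda>z. (norm (D z))\<^sup>2) x) * indicator {-1..1} x"
    proof (cases "x \<in> {-1..1}")
      case True
      have "ennreal (b x) \<le> ennreal (2 * I (\<lambda>z. (p z)\<^sup>2) x + I (\<lambda>z. (norm (D z))\<^sup>2) x)"
        using C1_fun_chord(1)[OF p True] unfolding b_def s_def I_def by (intro ennreal_leI)
      then show ?thesis using True I0' by (simp add: ennreal_plus ennreal_mult)
    qed simp
  qed
  also have "\<dots> = 2 * ?P + ?D"
    unfolding iter' by (simp add: nn_integral_add nn_integral_cmult)
  finally show "?B \<le> 2 * ?P + ?D" .
  have "?P \<le> (\<integral>\<^sup>+x. 2 * (ennreal (b x) * indicator {-1..1} x)
      + 4 * (ennreal (I (\<lambda>z. (norm (D z))\<^sup>2) x) * indicator {-1..1} x) \<partial>lborel)"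
    unfolding iter'
  proof (rule nn_integral_mono)
    fix x :: real
    show "ennreal (I (\<lambda>z. (p z)\<^sup>2) x) * indicator {-1..1} x \<le> 2 * (ennreal (b x) * indicator {-1..1} x)
      + 4 * (ennreal (I (\<lambda>z. (norm (D z))\<^sup>2) x) * indicator {-1..1} x)"
    proof (cases "x \<in> {-1..1}")
      case True
      have "ennreal (I (\<lambda>z. (p z)\<^sup>2) x) \<le> ennreal (2 * b x + 4 * I (\<lambda>z. (norm (D z))\<^sup>2) x)"
        using C1_fun_chord(2)[OF p True] unfolding b_def s_def I_def by (intro ennreal_leI)
      then show ?thesis using True I0' b0[OF True] by (simp add: ennreal_plus ennreal_mult)
    qed simp
  qed
  also have "\<dots> = 2 * ?B + 4 * ?D"
    unfolding B iter' by (simp add: nn_integral_add nn_integral_cmult)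
  finally show "?P \<le> 2 * ?B + 4 * ?D" .
qed

section \<open>Test functions determine integrable functions\<close>

text \<open>\<open>ennreal\<close> truncates at 0, so the two densities below are the positive and
  negative parts of f. They are finite on boxes and agree there; boxes form a generating class
  stable under intersection, so the measures coincide. Uniqueness of densities makes both parts
  equal a.e., which forces them to be 0.\<close>

lemma AE_zero_if_integral_box_zero:
  fixes f :: "'a::euclidean_space \<Rightarrow> real"
  assumes f: "integrable lborel f"
    and box: "\<And>l u. (\<integral>x. f x * indicator (box l u) x \<partial>lborel) = 0"
  shows "AE x in lborel. f x = 0"
proof -
  have [measurable]: "f \<in> borel_measurable borel" using f by auto
  have "density lborel (\<lambda>x. ennreal (f x)) = density lborel (\<lambda>x. ennreal (- f x))"
  proof (rule measure_eqI_generator_eq)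
    let ?E = "range (\<lambda>(a, b). box a b::'a set)"
    show "Int_stable ?E"
      by (auto simp: Int_stable_def box_Int_box)
    show "?E \<subseteq> Pow UNIV" "sets (density lborel (\<lambda>x. ennreal (f x))) = sigma_sets UNIV ?E"
      "sets (density lborel (\<lambda>x. ennreal (- f x))) = sigma_sets UNIV ?E"
      by (simp_all add: borel_eq_box)
    let ?A = "\<lambda>n::nat. box (- (real n *\<^sub>R One)) (real n *\<^sub>R One) :: 'a set"
    show "range ?A \<subseteq> ?E" "(\<Union>i. ?A i) = UNIV"
      unfolding UN_box_eq_UNIV by auto
    have em: "emeasure (density lborel (\<lambda>x. ennreal (g x))) X
        = (\<integral>\<^sup>+x. ennreal (g x * indicator X x) \<partial>lborel)"
      if "X \<in> sets borel" "g \<in> borel_measurable borel" for X and g :: "'a \<Rightarrow> real"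
      using that by (subst emeasure_density) (auto intro!: nn_integral_cong simp: indicator_def)
    have int: "integrable lborel (\<lambda>x. f x * indicator X x)" if "X \<in> sets borel" for X
      using integrable_mult_indicator[of X lborel f] that f by (simp add: mult.commute)
    have fin: "(\<integral>\<^sup>+x. ennreal (f x * indicator X x) \<partial>lborel) \<noteq> \<infinity>"
      "(\<integral>\<^sup>+x. ennreal (- (f x * indicator X x)) \<partial>lborel) \<noteq> \<infinity>"
      if "X \<in> sets borel" for X
      using int[OF that] by (auto simp: real_integrable_def)
    show "emeasure (density lborel (\<lambda>x. ennreal (f x))) (?A i) \<noteq> \<infinity>" for i
      using fin(1)[of "?A i"] by (subst em) auto
    have enn: "a = b" if "a \<noteq> \<infinity>" "b \<noteq> \<infinity>" "enn2real a = enn2real b" for a b :: ennreal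
      using that by (cases a; cases b) auto
    fix X assume "X \<in> ?E"
    then obtain l u where X: "X = box l u" by auto
    have "enn2real (\<integral>\<^sup>+x. ennreal (f x * indicator X x) \<partial>lborel)
        = enn2real (\<integral>\<^sup>+x. ennreal (- (f x * indicator X x)) \<partial>lborel)"
      using box[of l u] real_lebesgue_integral_def[OF int, of X] by (simp add: X)
    then have "(\<integral>\<^sup>+x. ennreal (f x * indicator X x) \<partial>lborel)
        = (\<integral>\<^sup>+x. ennreal (- (f x * indicator X x)) \<partial>lborel)"
      by (intro enn fin) (simp_all add: X)
    then show "emeasure (density lborel (\<lambda>x. ennreal (f x))) X
        = emeasure (density lborel (\<lambda>x. ennreal (- f x))) X"
      by (simp add: em X)
  qed
  then have "AE x in lborel. ennreal (f x) = ennreal (- f x)"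
    by (intro sigma_finite_measure.density_unique[OF sigma_finite_lborel]) auto
  then show ?thesis
  proof eventually_elim
    case (elim x)
    then show ?case
      by (cases "f x \<ge> 0") (auto simp: ennreal_neg ennreal_eq_0_iff dest: sym)
  qed
qed

text \<open>A C1 approximation of the indicator of the positive half line: the square smooths the
  corner of \<open>max\<close> at 0, and the quotient keeps the values in [0, 1]. C1 regularity is
  what \<open>test_fun\<close> asks for.\<close>

definition smooth_step :: "real \<Rightarrow> real \<Rightarrow> real" where
  "smooth_step n t = n * (max 0 t)\<^sup>2 / (1 + n * (max 0 t)\<^sup>2)"

lemma has_real_derivative_max_squared:
  "((\<lambda>t. (max 0 t)\<^sup>2) has_real_derivative 2 * max 0 t) (at (t::real))"
proof -
  consider "t < 0" | "t = 0" | "t > 0" by linarith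
  then show ?thesis
  proof cases
    case 1
    have "((\<lambda>t. 0) has_real_derivative 2 * max 0 t) (at t)"
      using 1 by simp
    then show ?thesis
      by (rule has_field_derivative_transform_within_open[where S = "{..<0}"]) (use 1 in auto)
  next
    case 2
    have "((\<lambda>h. (max 0 h)\<^sup>2 / h) \<longlongrightarrow> 0) (at (0::real))"
    proof (rule Lim_null_comparison)
      show "\<forall>\<^sub>F h in at 0. norm ((max 0 h)\<^sup>2 / h) \<le> \<bar>h::real\<bar>"
        by (rule always_eventually) (auto simp: max_def power2_eq_square)
      show "((\<lambda>h. \<bar>h\<bar>) \<longlongrightarrow> 0) (at (0::real))"
        by (rule tendsto_eq_intros refl)+ simp
    qed
    then show ?thesis using 2 by (simp add: DERIV_def)
  next
    case 3
    have "((\<lambda>t. t\<^sup>2) has_real_derivative 2 * max 0 t) (at t)"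
      using 3 by (auto intro!: derivative_eq_intros)
    then show ?thesis
      by (rule has_field_derivative_transform_within_open[where S = "{0<..}"]) (use 3 in auto)
  qed
qed

lemma smooth_step_pos_denominator: "n \<ge> 0 \<Longrightarrow> 1 + n * (max 0 t)\<^sup>2 > (0::real)"
  by (intro add_pos_nonneg) auto

lemma smooth_step_bounds: "n \<ge> 0 \<Longrightarrow> 0 \<le> smooth_step n t \<and> smooth_step n t \<le> 1"
  using smooth_step_pos_denominator[of n t] by (simp add: smooth_step_def divide_le_eq)

lemma smooth_step_nonpos: "t \<le> 0 \<Longrightarrow> smooth_step n t = 0"
  by (simp add: smooth_step_def)

lemma smooth_step_tendsto: "(\<lambda>n. smooth_step (real n) t) \<longlonglongrightarrow> indicator {0<..} t"
proof (cases "t > 0")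
  case True
  have "(\<lambda>n. smooth_step (real n) t - 1) \<longlonglongrightarrow> 0"
  proof (rule Lim_null_comparison)
    have "norm (smooth_step (real n) t - 1) \<le> 1 / t\<^sup>2 * (1 / real n)" if "n > 0" for n
    proof -
      have d: "0 < 1 + real n * t\<^sup>2" by (intro add_pos_nonneg) auto
      have "smooth_step (real n) t - 1 = - (1 / (1 + real n * t\<^sup>2))"
        using True d by (simp add: smooth_step_def field_simps)
      then have "norm (smooth_step (real n) t - 1) = 1 / (1 + real n * t\<^sup>2)"
        using d by simp
      also have "\<dots> \<le> 1 / (real n * t\<^sup>2)"
        using True that by (intro divide_left_mono) (auto intro: mult_pos_pos d)
      finally show ?thesis by (simp add: mult.commute)
    qed
    then show "\<forall>\<^sub>F n in sequentially. norm (smooth_step (real n) t - 1) \<le> 1 / t\<^sup>2 * (1 / real n)"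
      by (intro eventually_sequentiallyI[of 1]) auto
    show "(\<lambda>n. 1 / t\<^sup>2 * (1 / real n)) \<longlonglongrightarrow> 0"
      by (intro tendsto_mult_right_zero lim_1_over_n)
  qed
  then show ?thesis using True by (simp add: LIM_zero_iff)
qed (simp add: smooth_step_nonpos)

lemma C1_fun_smooth_step:
  assumes "C1_fun p D" "n \<ge> 0"
  shows "\<exists>E. C1_fun (\<lambda>z. smooth_step n (p z)) E"
proof -
  let ?h' = "\<lambda>t. (n * (2 * max 0 t)) / (1 + n * (max 0 t)\<^sup>2)\<^sup>2"
  have nz: "1 + n * (max 0 t)\<^sup>2 \<noteq> 0" for t
    using smooth_step_pos_denominator[OF assms(2), of t] by simp
  have h: "(smooth_step n has_real_derivative ?h' t) (at t)" for t
    unfolding smooth_step_def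
    by (rule derivative_eq_intros has_real_derivative_max_squared refl nz)+
       (use nz[of t] in \<open>simp add: power2_eq_square field_simps\<close>)
  have h': "continuous_on UNIV ?h'"
    using nz by (intro continuous_intros) auto
  show ?thesis
    by (rule exI, rule C1_fun_comp[OF h h' assms(1)])
qed

lemma C1_fun_affine: "C1_fun (\<lambda>z. a \<bullet> z + c) (\<lambda>_. a)"
  unfolding C1_fun_def by (auto intro!: derivative_eq_intros)

lemma C1_fun_norm_squared: "C1_fun (\<lambda>z. c - (norm z)\<^sup>2) (\<lambda>z. - 2 *\<^sub>R z)"
  unfolding C1_fun_def dot_square_norm[symmetric]
  by (auto intro!: derivative_eq_intros continuous_intros simp: inner_commute algebra_simps)

text \<open>The first four factors cut off at the sides of the box, written as affine functions to
  fit \<open>C1_fun_affine\<close>. The last one confines the support to radius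
  \<open>sqrt r\<close>, hence to a compact subset of the open disk when r < 1.\<close>

definition box_bump :: "complex \<Rightarrow> complex \<Rightarrow> real \<Rightarrow> real \<Rightarrow> complex \<Rightarrow> real" where
  "box_bump l u r n z = smooth_step n (1 \<bullet> z + - Re l) * smooth_step n (-1 \<bullet> z + Re u)
     * smooth_step n (\<i> \<bullet> z + - Im l) * smooth_step n (- \<i> \<bullet> z + Im u)
     * smooth_step n (r - (norm z)\<^sup>2)"

lemma box_bump_test_fun:
  assumes "n \<ge> 0" "r < 1"
  shows "\<exists>D. test_fun (box_bump l u r n) D"
proof -
  have "\<exists>D. C1_fun (box_bump l u r n) D"
  proof -
    obtain E1 E2 E3 E4 E5 where E:
      "C1_fun (\<lambda>z. smooth_step n (1 \<bullet> z + - Re l)) E1"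
      "C1_fun (\<lambda>z. smooth_step n (-1 \<bullet> z + Re u)) E2"
      "C1_fun (\<lambda>z. smooth_step n (\<i> \<bullet> z + - Im l)) E3"
      "C1_fun (\<lambda>z. smooth_step n (- \<i> \<bullet> z + Im u)) E4"
      "C1_fun (\<lambda>z. smooth_step n (r - (norm z)\<^sup>2)) E5"
      using C1_fun_smooth_step[OF C1_fun_affine assms(1)] C1_fun_smooth_step[OF C1_fun_norm_squared assms(1)]
      by metis
    show ?thesis
      unfolding box_bump_def using C1_fun_mult[OF C1_fun_mult[OF C1_fun_mult[OF C1_fun_mult[OF E(1,2)] E(3)] E(4)] E(5)]
      by blast
  qed
  moreover have sub: "closure {z. box_bump l u r n z \<noteq> 0} \<subseteq> {z. (norm z)\<^sup>2 \<le> r}"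
  proof (rule closure_minimal)
    show "{z. box_bump l u r n z \<noteq> 0} \<subseteq> {z. (norm z)\<^sup>2 \<le> r}"
    proof
      fix z assume "z \<in> {z. box_bump l u r n z \<noteq> 0}"
      then have "smooth_step n (r - (norm z)\<^sup>2) \<noteq> 0" by (simp add: box_bump_def)
      then show "z \<in> {z. (norm z)\<^sup>2 \<le> r}"
        using smooth_step_nonpos[of "r - (norm z)\<^sup>2" n] by fastforce
    qed
    show "closed {z::complex. (norm z)\<^sup>2 \<le> r}"
      by (intro closed_Collect_le continuous_intros)
  qed
  moreover have O: "{z. (norm z)\<^sup>2 \<le> r} \<subseteq> Omega"
  proof
    fix z :: complex assume "z \<in> {z. (norm z)\<^sup>2 \<le> r}"
    then have "(norm z)\<^sup>2 < 1" using assms(2) by simp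
    then show "z \<in> Omega" by (simp add: Omega_def power2_less_1_iff abs_square_less_1)
  qed
  moreover have "compact (closure {z. box_bump l u r n z \<noteq> 0})"
    unfolding compact_closure
  proof (rule bounded_subset[of Omega])
    show "{z. box_bump l u r n z \<noteq> 0} \<subseteq> Omega"
      using closure_subset sub O by (rule order_trans[OF _ order_trans])
  qed (simp add: Omega_def)
  ultimately show ?thesis by (auto simp: test_fun_def)
qed

lemma box_bump_bounds: "n \<ge> 0 \<Longrightarrow> 0 \<le> box_bump l u r n z \<and> box_bump l u r n z \<le> 1"
  unfolding box_bump_def using smooth_step_bounds[of n]
  by (auto intro!: mult_nonneg_nonneg mult_le_one)

lemma box_bump_tendsto:
  "(\<lambda>n. box_bump l u r (real n) z) \<longlonglongrightarrow> indicator (box l u) z * indicator {z. (norm z)\<^sup>2 < r} z"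
proof -
  have "indicator (box l u) z * indicator {z. (norm z)\<^sup>2 < r} z
     = (indicator {0<..} (1 \<bullet> z + - Re l) * indicator {0<..} (-1 \<bullet> z + Re u)
     * indicator {0<..} (\<i> \<bullet> z + - Im l) * indicator {0<..} (- \<i> \<bullet> z + Im u)
     * indicator {0<..} (r - (norm z)\<^sup>2) :: real)"
    by (auto simp: indicator_def box_def Basis_complex_def inner_complex_def)
  then show ?thesis
    unfolding box_bump_def by (simp only:) (intro tendsto_mult smooth_step_tendsto)
qed

lemma box_bump_measurable [measurable]: "box_bump l u r n \<in> borel_measurable borel"
  unfolding box_bump_def smooth_step_def by measurable

text \<open>The bumps are bounded by 1 and tend to the indicator of a box cut by a smaller disk, so
  dominated convergence turns the hypothesis into vanishing integrals over boxes.\<close>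

lemma fundamental_lemma_Omega:
  assumes k: "integrable (lebesgue_on Omega) k"
    and test: "\<And>psi D. test_fun psi D \<Longrightarrow> (\<integral>x. k x * psi x \<partial>lebesgue_on Omega) = 0"
  shows "AE x in lebesgue_on Omega. k x = 0"
proof -
  have OmL: "Omega \<inter> space lebesgue \<in> sets lebesgue" by (simp add: Omega_def)
  have kL: "integrable lebesgue (\<lambda>x. indicator Omega x * k x)"
    using k by (simp add: integrable_restrict_space[OF OmL])
  then have "(\<lambda>x. indicator Omega x * k x) \<in> borel_measurable lebesgue" by auto
  \<comment> \<open>k is only Lebesgue measurable, whereas the argument with boxes lives on
    \<open>lborel\<close>; hence a Borel representative f.\<close>
  from completion_ex_borel_measurable_real[OF this] obtain f where
    f [measurable]: "f \<in> borel_measurable borel" and "AE x in lborel. indicator Omega x * k x = f x"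
    by auto
  then have fk: "AE x in lebesgue. indicator Omega x * k x = f x"
    by (intro AE_completion)
  have fL: "f \<in> borel_measurable lebesgue"
    using f by (intro measurable_completion) simp
  have fi: "integrable lborel f"
  proof -
    have "integrable lebesgue f"
      using kL fk fL by (subst integrable_cong_AE[where g = "\<lambda>x. indicator Omega x * k x"]) auto
    then show ?thesis by (simp add: integrable_completion)
  qed
  have zero: "AE x in lborel. f x * indicator {z. (norm z)\<^sup>2 < r} x = 0" if r: "r < 1" for r
  proof (rule AE_zero_if_integral_box_zero)
    show "integrable lborel (\<lambda>x. f x * indicator {z. (norm z)\<^sup>2 < r} x)"
      using integrable_mult_indicator[of "{z. (norm z)\<^sup>2 < r}" lborel f] fi by (simp add: mult.commute)
    fix l u :: complex
    have "(\<lambda>n. \<integral>x. f x * box_bump l u r (real n) x \<partial>lborel)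
      \<longlonglongrightarrow> (\<integral>x. f x * (indicator (box l u) x * indicator {z. (norm z)\<^sup>2 < r} x) \<partial>lborel)"
    proof (rule integral_dominated_convergence)
      show "integrable lborel (\<lambda>x. \<bar>f x\<bar>)" using fi by simp
      show "AE x in lborel. (\<lambda>n. f x * box_bump l u r (real n) x)
          \<longlonglongrightarrow> f x * (indicator (box l u) x * indicator {z. (norm z)\<^sup>2 < r} x)"
        by (intro AE_I2 tendsto_mult tendsto_const box_bump_tendsto)
      show "AE x in lborel. norm (f x * box_bump l u r (real n) x) \<le> \<bar>f x\<bar>" for n
        using box_bump_bounds[of "real n" l u r]
        by (intro AE_I2) (auto simp: abs_mult intro!: mult_left_le)
    qed measurable
    moreover have "(\<integral>x. f x * box_bump l u r (real n) x \<partial>lborel) = 0" for n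
    proof -
      obtain D where D: "test_fun (box_bump l u r (real n)) D"
        using box_bump_test_fun[of "real n" r l u] r by auto
      have bL: "(\<lambda>x. box_bump l u r (real n) x) \<in> borel_measurable lebesgue"
        by (intro measurable_completion) simp
      have "(\<integral>x. f x * box_bump l u r (real n) x \<partial>lborel) = (\<integral>x. f x * box_bump l u r (real n) x \<partial>lebesgue)"
        by (rule integral_completion[symmetric]) simp
      also have "\<dots> = (\<integral>x. indicator Omega x * k x * box_bump l u r (real n) x \<partial>lebesgue)"
        using fk kL fL bL by (intro integral_cong_AE) auto
      also have "\<dots> = (\<integral>x. k x * box_bump l u r (real n) x \<partial>lebesgue_on Omega)"
        by (subst integral_restrict_space[OF OmL]) (simp add: mult.assoc)
      also have "\<dots> = 0" by (rule test[OF D])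
      finally show ?thesis .
    qed
    ultimately have "(\<integral>x. f x * (indicator (box l u) x * indicator {z. (norm z)\<^sup>2 < r} x) \<partial>lborel) = 0"
      by (simp add: LIMSEQ_const_iff)
    then show "(\<integral>x. f x * indicator {z. (norm z)\<^sup>2 < r} x * indicator (box l u) x \<partial>lborel) = 0"
      by (simp add: mult_ac)
  qed
  \<comment> \<open>Bumps reach only disks of radius below 1, so countably many of them exhaust the
    open disk.\<close>
  have "AE x in lborel. \<forall>m. f x * indicator {z. (norm z)\<^sup>2 < 1 - 1 / real (Suc m)} x = 0"
    unfolding AE_all_countable by (intro allI zero) simp
  then have "AE x in lebesgue. \<forall>m. f x * indicator {z. (norm z)\<^sup>2 < 1 - 1 / real (Suc m)} x = 0"
    by (rule AE_completion)
  with fk have "AE x in lebesgue. x \<in> Omega \<longrightarrow> k x = 0"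
  proof eventually_elim
    case (elim x)
    show ?case
    proof
      assume x: "x \<in> Omega"
      then have "0 < 1 - (norm x)\<^sup>2" by (simp add: Omega_def abs_square_less_1)
      from reals_Archimedean[OF this] obtain m where "1 / real (Suc m) < 1 - (norm x)\<^sup>2"
        by (auto simp: inverse_eq_divide)
      then have "f x = 0" using elim(2) by (auto dest!: spec[of _ m] simp: algebra_simps)
      then show "k x = 0" using elim(1) x by simp
    qed
  qed
  then show ?thesis by (subst AE_restrict_space_iff[OF OmL]) auto
qed

section \<open>Square-integrable functions\<close>

text \<open>The squared L2 distance, kept in \<open>ennreal\<close> so that it makes sense without
  integrability and matches the integrals in \<open>has_trace\<close>.\<close>

definition sqd :: "'a measure \<Rightarrow> ('a \<Rightarrow> 'b::real_normed_vector) \<Rightarrow> ('a \<Rightarrow> 'b) \<Rightarrow> ennreal" where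
  "sqd M f g = (\<integral>\<^sup>+x. ennreal ((norm (f x - g x))\<^sup>2) \<partial>M)"

definition L2 :: "'a measure \<Rightarrow> ('a \<Rightarrow> 'b::real_normed_vector) \<Rightarrow> bool" where
  "L2 M f \<longleftrightarrow> f \<in> borel_measurable M \<and> integrable M (\<lambda>x. (norm (f x))\<^sup>2)"

lemma L2_measurable: "L2 M f \<Longrightarrow> f \<in> borel_measurable M"
  by (simp add: L2_def)

lemma L2_iff_sqd:
  assumes "f \<in> borel_measurable M"
  shows "L2 M f \<longleftrightarrow> sqd M f (\<lambda>_. 0) < \<infinity>"
  using assms by (simp add: L2_def sqd_def integrable_iff_bounded)

lemma sqd_commute: "sqd M f g = sqd M g f"
  by (simp add: sqd_def norm_minus_commute)

lemma norm_add_squared_le: "(norm (x + y))\<^sup>2 \<le> 2 * (norm x)\<^sup>2 + 2 * (norm (y::'b::real_normed_vector))\<^sup>2"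
proof -
  have "(norm (x + y))\<^sup>2 \<le> (norm x + norm y)\<^sup>2"
    by (intro power_mono norm_triangle_ineq) simp
  also have "\<dots> \<le> 2 * (norm x)\<^sup>2 + 2 * (norm y)\<^sup>2"
    using zero_le_power2[of "norm x - norm y"] by (simp add: power2_eq_square algebra_simps)
  finally show ?thesis .
qed

lemma sqd_triangle:
  fixes f g h :: "'a \<Rightarrow> 'b::{second_countable_topology, real_normed_vector}"
  assumes [measurable]: "f \<in> borel_measurable M" "g \<in> borel_measurable M" "h \<in> borel_measurable M"
  shows "sqd M f h \<le> 2 * sqd M f g + 2 * sqd M g h"
proof -
  have "sqd M f h \<le> (\<integral>\<^sup>+x. 2 * ennreal ((norm (f x - g x))\<^sup>2) + 2 * ennreal ((norm (g x - h x))\<^sup>2) \<partial>M)"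
    unfolding sqd_def
  proof (rule nn_integral_mono)
    fix x
    have "ennreal ((norm (f x - h x))\<^sup>2) \<le> ennreal (2 * (norm (f x - g x))\<^sup>2 + 2 * (norm (g x - h x))\<^sup>2)"
      using norm_add_squared_le[of "f x - g x" "g x - h x"] by (intro ennreal_leI) simp
    then show "ennreal ((norm (f x - h x))\<^sup>2) \<le> 2 * ennreal ((norm (f x - g x))\<^sup>2) + 2 * ennreal ((norm (g x - h x))\<^sup>2)"
      by (simp add: ennreal_plus ennreal_mult)
  qed
  also have "\<dots> = 2 * sqd M f g + 2 * sqd M g h"
    unfolding sqd_def by (simp add: nn_integral_add nn_integral_cmult)
  finally show ?thesis .
qed

lemma sqd_eq_0_iff:
  fixes f g :: "'a \<Rightarrow> 'b::{second_countable_topology, real_normed_vector}"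
  assumes [measurable]: "f \<in> borel_measurable M" "g \<in> borel_measurable M"
  shows "sqd M f g = 0 \<longleftrightarrow> (AE x in M. f x = g x)"
  unfolding sqd_def by (subst nn_integral_0_iff_AE) auto

lemma L2_lin:
  fixes f g :: "'a \<Rightarrow> 'b::{second_countable_topology, real_normed_vector}"
  assumes f: "L2 M f" and g: "L2 M g"
  shows "L2 M (\<lambda>x. a *\<^sub>R f x + b *\<^sub>R g x)"
proof -
  note [measurable] = L2_measurable[OF f] L2_measurable[OF g]
  have "integrable M (\<lambda>x. (norm (a *\<^sub>R f x + b *\<^sub>R g x))\<^sup>2)"
  proof (rule Bochner_Integration.integrable_bound)
    show "integrable M (\<lambda>x. 2 * (a\<^sup>2 * (norm (f x))\<^sup>2) + 2 * (b\<^sup>2 * (norm (g x))\<^sup>2))"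
      using f g by (intro Bochner_Integration.integrable_add integrable_mult_right) (auto simp: L2_def)
    show "AE x in M. norm ((norm (a *\<^sub>R f x + b *\<^sub>R g x))\<^sup>2) \<le> norm (2 * (a\<^sup>2 * (norm (f x))\<^sup>2) + 2 * (b\<^sup>2 * (norm (g x))\<^sup>2))"
    proof (rule AE_I2)
      fix x
      show "norm ((norm (a *\<^sub>R f x + b *\<^sub>R g x))\<^sup>2) \<le> norm (2 * (a\<^sup>2 * (norm (f x))\<^sup>2) + 2 * (b\<^sup>2 * (norm (g x))\<^sup>2))"
        using norm_add_squared_le[of "a *\<^sub>R f x" "b *\<^sub>R g x"] by (simp add: power_mult_distrib)
    qed
  qed measurable
  then show ?thesis by (simp add: L2_def)
qed

lemma L2_diff:
  fixes f g :: "'a \<Rightarrow> 'b::{second_countable_topology, real_normed_vector}"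
  assumes "L2 M f" "L2 M g"
  shows "L2 M (\<lambda>x. f x - g x)"
  using L2_lin[OF assms, of 1 "-1"] by simp

lemma sqd_eq_integral:
  fixes f g :: "'a \<Rightarrow> 'b::{second_countable_topology, real_normed_vector}"
  assumes "L2 M f" "L2 M g"
  shows "sqd M f g = ennreal (\<integral>x. (norm (f x - g x))\<^sup>2 \<partial>M)"
  unfolding sqd_def using L2_diff[OF assms] by (intro nn_integral_eq_integral) (auto simp: L2_def)

lemma L2_integrable_inner:
  fixes f g :: "'a \<Rightarrow> 'b::euclidean_space"
  assumes f: "L2 M f" and g: "L2 M g"
  shows "integrable M (\<lambda>x. f x \<bullet> g x)"
proof (rule Bochner_Integration.integrable_bound)
  show "integrable M (\<lambda>x. (norm (f x))\<^sup>2 + (norm (g x))\<^sup>2)"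
    using f g by (auto simp: L2_def)
  show "(\<lambda>x. f x \<bullet> g x) \<in> borel_measurable M"
    using L2_measurable[OF f] L2_measurable[OF g] by simp
  show "AE x in M. norm (f x \<bullet> g x) \<le> norm ((norm (f x))\<^sup>2 + (norm (g x))\<^sup>2)"
  proof (rule AE_I2)
    fix x
    have "2 * (norm (f x) * norm (g x)) \<le> (norm (f x))\<^sup>2 + (norm (g x))\<^sup>2"
      using sum_squares_bound[of "norm (f x)" "norm (g x)"] by simp
    moreover have "0 \<le> norm (f x) * norm (g x)" by simp
    ultimately show "norm (f x \<bullet> g x) \<le> norm ((norm (f x))\<^sup>2 + (norm (g x))\<^sup>2)"
      using Cauchy_Schwarz_ineq2[of "f x" "g x"] by simp
  qed
qed

lemma integral_norm_add_scaled:
  fixes f g :: "'a \<Rightarrow> 'b::euclidean_space"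
  assumes f: "L2 M f" and g: "L2 M g"
  shows "(\<integral>x. (norm (a *\<^sub>R f x + b *\<^sub>R g x))\<^sup>2 \<partial>M)
    = a\<^sup>2 * (\<integral>x. (norm (f x))\<^sup>2 \<partial>M) + 2 * a * b * (\<integral>x. f x \<bullet> g x \<partial>M) + b\<^sup>2 * (\<integral>x. (norm (g x))\<^sup>2 \<partial>M)"
proof -
  have "(norm (a *\<^sub>R f x + b *\<^sub>R g x))\<^sup>2
      = a\<^sup>2 * (norm (f x))\<^sup>2 + 2 * a * b * (f x \<bullet> g x) + b\<^sup>2 * (norm (g x))\<^sup>2" for x
    unfolding power2_norm_eq_inner
    by (simp add: inner_add_left inner_add_right inner_commute power2_eq_square algebra_simps)
  then show ?thesis
    using f g L2_integrable_inner[OF f g] by (simp add: L2_def)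
qed

text \<open>The integral of |a f + b g|^2 is a nonnegative quadratic form in (a, b); evaluating it
  at (C, -B) gives C (A C - B^2) >= 0.\<close>

lemma L2_Cauchy_Schwarz:
  fixes f g :: "'a \<Rightarrow> 'b::euclidean_space"
  assumes f: "L2 M f" and g: "L2 M g"
  shows "(\<integral>x. f x \<bullet> g x \<partial>M)\<^sup>2 \<le> (\<integral>x. (norm (f x))\<^sup>2 \<partial>M) * (\<integral>x. (norm (g x))\<^sup>2 \<partial>M)"
proof -
  define A B C where "A = (\<integral>x. (norm (f x))\<^sup>2 \<partial>M)" "B = (\<integral>x. f x \<bullet> g x \<partial>M)" "C = (\<integral>x. (norm (g x))\<^sup>2 \<partial>M)"
  note d = this
  have q: "0 \<le> a\<^sup>2 * A + 2 * a * b * B + b\<^sup>2 * C" for a b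
    using integral_norm_add_scaled[OF f g, of a b, symmetric] by (simp add: d)
  have C0: "C \<ge> 0" by (simp add: d)
  show ?thesis unfolding d[symmetric]
  proof (cases "C = 0")
    case True
    have "B = 0"
    proof (rule ccontr)
      assume "B \<noteq> 0"
      \<comment> \<open>For C = 0 the form is affine in b, and this b gives it the value -1.\<close>
      then show False using q[of 1 "- (A + 1) / (2 * B)"] True by (simp add: field_simps)
    qed
    then show "B\<^sup>2 \<le> A * C" using True by simp
  next
    case False
    then have "0 \<le> C * (A * C - B\<^sup>2)"
      using q[of C "-B"] by (simp add: power2_eq_square algebra_simps)
    then show "B\<^sup>2 \<le> A * C" using False C0 by (simp add: zero_le_mult_iff)
  qed
qed

lemma L2_inner_tendsto:
  fixes f g :: "'a \<Rightarrow> 'b::euclidean_space"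
  assumes f: "L2 M f" and g: "L2 M g" "\<And>n. L2 M (gs n)" and lim: "(\<lambda>n. sqd M (gs n) g) \<longlonglongrightarrow> 0"
  shows "(\<lambda>n. \<integral>x. f x \<bullet> gs n x \<partial>M) \<longlonglongrightarrow> (\<integral>x. f x \<bullet> g x \<partial>M)"
proof -
  define A where "A = (\<integral>x. (norm (f x))\<^sup>2 \<partial>M)"
  define c where "c = (\<lambda>n. \<integral>x. (norm (gs n x - g x))\<^sup>2 \<partial>M)"
  have "(\<lambda>n. ennreal (c n)) \<longlonglongrightarrow> ennreal 0"
    using lim by (simp add: sqd_eq_integral g c_def)
  then have c: "c \<longlonglongrightarrow> 0"
    by (subst (asm) tendsto_ennreal_iff) (auto simp: c_def)
  have "(\<lambda>n. (\<integral>x. f x \<bullet> gs n x \<partial>M) - (\<integral>x. f x \<bullet> g x \<partial>M)) \<longlonglongrightarrow> 0"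
  proof (rule Lim_null_comparison)
    show "\<forall>\<^sub>F n in sequentially. norm ((\<integral>x. f x \<bullet> gs n x \<partial>M) - (\<integral>x. f x \<bullet> g x \<partial>M)) \<le> sqrt (A * c n)"
    proof (rule always_eventually, rule allI)
      fix n
      have "(\<integral>x. f x \<bullet> gs n x \<partial>M) - (\<integral>x. f x \<bullet> g x \<partial>M) = (\<integral>x. f x \<bullet> (gs n x - g x) \<partial>M)"
        using L2_integrable_inner[OF f g(2)[of n]] L2_integrable_inner[OF f g(1)]
        by (simp add: inner_diff_right)
      moreover have "\<bar>\<integral>x. f x \<bullet> (gs n x - g x) \<partial>M\<bar> \<le> sqrt (A * c n)"
        unfolding A_def c_def
        using L2_Cauchy_Schwarz[OF f L2_diff[OF g(2)[of n] g(1)]] by (intro real_le_rsqrt) simp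
      ultimately show "norm ((\<integral>x. f x \<bullet> gs n x \<partial>M) - (\<integral>x. f x \<bullet> g x \<partial>M)) \<le> sqrt (A * c n)"
        by simp
    qed
    have "(\<lambda>n. sqrt (A * c n)) \<longlonglongrightarrow> sqrt (A * 0)"
      by (intro tendsto_intros c)
    then show "(\<lambda>n. sqrt (A * c n)) \<longlonglongrightarrow> 0" by simp
  qed
  then show ?thesis by (simp add: LIM_zero_iff)
qed

text \<open>Expanding the square of \<open>gs n - g\<close> reduces the claim to
  \<open>L2_inner_tendsto\<close> tested with g itself.\<close>

lemma L2_norm_tendsto:
  fixes g :: "'a \<Rightarrow> 'b::euclidean_space"
  assumes g: "L2 M g" "\<And>n. L2 M (gs n)" and lim: "(\<lambda>n. sqd M (gs n) g) \<longlonglongrightarrow> 0"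
  shows "(\<lambda>n. \<integral>x. (norm (gs n x))\<^sup>2 \<partial>M) \<longlonglongrightarrow> (\<integral>x. (norm (g x))\<^sup>2 \<partial>M)"
proof -
  define c where "c = (\<lambda>n. \<integral>x. (norm (gs n x - g x))\<^sup>2 \<partial>M)"
  have "(\<lambda>n. ennreal (c n)) \<longlonglongrightarrow> ennreal 0"
    using lim by (simp add: sqd_eq_integral g c_def)
  then have c: "c \<longlonglongrightarrow> 0"
    by (subst (asm) tendsto_ennreal_iff) (auto simp: c_def)
  have eq: "(\<integral>x. (norm (gs n x))\<^sup>2 \<partial>M)
      = c n + 2 * (\<integral>x. g x \<bullet> gs n x \<partial>M) - (\<integral>x. (norm (g x))\<^sup>2 \<partial>M)" for n
    using integral_norm_add_scaled[OF g(1) g(2)[of n], of "-1" 1] by (simp add: c_def)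
  have "(\<lambda>n. c n + 2 * (\<integral>x. g x \<bullet> gs n x \<partial>M) - (\<integral>x. (norm (g x))\<^sup>2 \<partial>M))
     \<longlonglongrightarrow> 0 + 2 * (\<integral>x. g x \<bullet> g x \<partial>M) - (\<integral>x. (norm (g x))\<^sup>2 \<partial>M)"
    by (intro tendsto_intros c L2_inner_tendsto g lim)
  moreover have "(\<integral>x. g x \<bullet> g x \<partial>M) = (\<integral>x. (norm (g x))\<^sup>2 \<partial>M)"
    by (simp add: power2_norm_eq_inner)
  ultimately show ?thesis by (simp add: eq)
qed

text \<open>Riesz-Fischer with a geometric rate, so the whole sequence converges a.e. The weight 2^n
  shares out the rate 4^-n: the weighted squared increments have integrals of order 2^-n, so their
  sum is finite a.e.; undoing the weight leaves pointwise squared increments of order 2^-n, and the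
  increments are dominated by a geometric series.\<close>

lemma L2_complete_fast:
  fixes f :: "nat \<Rightarrow> 'a \<Rightarrow> 'b::{second_countable_topology, banach}"
  assumes m [measurable]: "\<And>n. f n \<in> borel_measurable M"
    and K: "\<And>n m. n \<le> m \<Longrightarrow> sqd M (f n) (f m) \<le> ennreal (K * (1/4) ^ n)"
  shows "\<exists>g. g \<in> borel_measurable M \<and> (AE x in M. (\<lambda>n. f n x) \<longlonglongrightarrow> g x)
    \<and> (\<forall>n. sqd M (f n) g \<le> ennreal (K * (1/4) ^ n))"
proof -
  define d where "d = (\<lambda>n x. ennreal (2 ^ n * (norm (f n x - f (Suc n) x))\<^sup>2))"
  have [measurable]: "d n \<in> borel_measurable M" for n
    unfolding d_def by measurable
  have "(\<integral>\<^sup>+x. (\<Sum>n. d n x) \<partial>M) = (\<Sum>n. \<integral>\<^sup>+x. d n x \<partial>M)"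
    by (rule nn_integral_suminf) simp
  \<comment> \<open>The sign of K is left open; its absolute value keeps the dominating series
    nonnegative.\<close>
  also have "\<dots> \<le> (\<Sum>n. ennreal (\<bar>K\<bar> * (1/2) ^ n))"
  proof (intro suminf_le allI)
    fix n
    have "(\<integral>\<^sup>+x. d n x \<partial>M) = ennreal (2 ^ n) * sqd M (f n) (f (Suc n))"
      unfolding d_def sqd_def by (simp add: ennreal_mult' nn_integral_cmult)
    also have "\<dots> \<le> ennreal (2 ^ n) * ennreal (K * (1/4) ^ n)"
      by (intro mult_left_mono K) auto
    also have "\<dots> = ennreal (K * (2 ^ n * (1/4) ^ n))"
      by (simp add: ennreal_mult' [symmetric] mult_ac)
    also have "K * (2 ^ n * (1/4) ^ n) = K * (1/2) ^ n"
      by (simp flip: power_mult_distrib)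
    also have "ennreal (K * (1/2) ^ n) \<le> ennreal (\<bar>K\<bar> * (1/2) ^ n)"
      by (intro ennreal_leI mult_right_mono) auto
    finally show "(\<integral>\<^sup>+x. d n x \<partial>M) \<le> ennreal (\<bar>K\<bar> * (1/2) ^ n)" .
  qed auto
  also have "\<dots> < \<infinity>"
    by (subst suminf_ennreal2) (auto intro!: summable_mult summable_geometric)
  finally have "(\<integral>\<^sup>+x. (\<Sum>n. d n x) \<partial>M) \<noteq> \<infinity>" by simp
  then have "AE x in M. (\<Sum>n. d n x) \<noteq> \<infinity>"
    by (intro nn_integral_noteq_infinite) auto
  then have conv: "AE x in M. convergent (\<lambda>n. f n x)"
  proof eventually_elim
    case (elim x)
    then obtain S where S: "(\<Sum>n. d n x) = ennreal S" "S \<ge> 0"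
      by (metis ennreal_cases infinity_ennreal_def)
    have "norm (f (Suc n) x - f n x) \<le> sqrt S * (sqrt (1/2)) ^ n" for n
    proof -
      have "d n x \<le> (\<Sum>n. d n x)"
        using sum_le_suminf[OF summableI, of "{n}" "\<lambda>n. d n x"] by simp
      then have "ennreal (2 ^ n * (norm (f n x - f (Suc n) x))\<^sup>2) \<le> ennreal S"
        unfolding S by (simp add: d_def)
      then have "2 ^ n * (norm (f n x - f (Suc n) x))\<^sup>2 \<le> S"
        using S(2) by simp
      then have "(norm (f (Suc n) x - f n x))\<^sup>2 \<le> S * (1/2) ^ n"
        by (simp add: norm_minus_commute power_one_over field_simps)
      then have "norm (f (Suc n) x - f n x) \<le> sqrt (S * (1/2) ^ n)"
        by (rule real_le_rsqrt)
      then show ?thesis by (simp add: real_sqrt_mult real_sqrt_power)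
    qed
    then have "summable (\<lambda>n. f (Suc n) x - f n x)"
      by (intro summable_comparison_test[OF _ summable_mult[OF summable_geometric]]) (auto simp: real_sqrt_divide)
    then have "convergent (\<lambda>n. \<Sum>i<n. f (Suc i) x - f i x)"
      by (simp add: summable_iff_convergent)
    then have "convergent (\<lambda>n. f n x - f 0 x)"
      by (simp add: sum_lessThan_telescope[of "\<lambda>n. f n x"])
    then have "convergent (\<lambda>n. (f n x - f 0 x) + f 0 x)"
      by (rule convergent_add) (rule convergent_const)
    then show ?case by simp
  qed
  define g where "g = (\<lambda>x. lim (\<lambda>n. f n x))"
  have g [measurable]: "g \<in> borel_measurable M"
    unfolding g_def by measurable
  have lim: "AE x in M. (\<lambda>n. f n x) \<longlonglongrightarrow> g x"
    using conv by eventually_elim (simp add: g_def convergent_LIMSEQ_iff)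
  have "sqd M (f n) g \<le> ennreal (K * (1/4) ^ n)" for n
  proof -
    \<comment> \<open>Fatou in m with n fixed: the Cauchy rate is inherited by the distance to the
      limit.\<close>
    have "sqd M (f n) g = (\<integral>\<^sup>+x. liminf (\<lambda>m. ennreal ((norm (f n x - f m x))\<^sup>2)) \<partial>M)"
      unfolding sqd_def
    proof (rule nn_integral_cong_AE, use lim in eventually_elim)
      case (elim x)
      have "(\<lambda>m. ennreal ((norm (f n x - f m x))\<^sup>2)) \<longlonglongrightarrow> ennreal ((norm (f n x - g x))\<^sup>2)"
        by (intro tendsto_ennrealI tendsto_intros elim)
      then show ?case by (intro lim_imp_Liminf[symmetric]) simp_all
    qed
    also have "\<dots> \<le> liminf (\<lambda>m. sqd M (f n) (f m))"
      unfolding sqd_def by (intro nn_integral_liminf) simp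
    also have "\<dots> \<le> Liminf sequentially (\<lambda>m. ennreal (K * (1/4) ^ n))"
      by (intro Liminf_mono eventually_sequentiallyI[of n]) (rule K)
    also have "\<dots> = ennreal (K * (1/4) ^ n)"
      by (simp add: Liminf_const)
    finally show ?thesis .
  qed
  then show ?thesis using g lim by blast
qed

section \<open>Uniqueness of weak gradients and traces\<close>

abbreviation (input) lebO :: "complex measure" where "lebO \<equiv> lebesgue_on Omega"

lemma borel_measurable_lebO: "f \<in> borel_measurable borel \<Longrightarrow> f \<in> borel_measurable lebO"
  by (intro measurable_restrict_space1 measurable_completion) simp

lemma measurable_sigma: "f \<in> sigma \<rightarrow>\<^sub>M N \<longleftrightarrow> f \<in> borel \<rightarrow>\<^sub>M N"
  using measurable_cong_sets[OF sets_sigma refl, of N] by blast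

lemma L2_Omega_iff: "L2_Omega u \<longleftrightarrow> L2 lebO u"
  by (simp add: L2_Omega_def L2_def)

lemma L2_Omega_continuous:
  fixes f :: "complex \<Rightarrow> 'b::euclidean_space"
  assumes f: "continuous_on UNIV f"
  shows "L2 lebO f"
proof -
  have [measurable]: "f \<in> borel_measurable lebO"
    by (intro borel_measurable_lebO borel_measurable_continuous_onI f)
  have "compact (f ` cball 0 1)"
    by (intro compact_continuous_image continuous_on_subset[OF f]) auto
  then obtain B where B: "\<And>z. z \<in> cball 0 1 \<Longrightarrow> norm (f z) \<le> B"
    using compact_imp_bounded[of "f ` cball 0 1"] unfolding bounded_iff by blast
  have "integrable lebO (\<lambda>x. (norm (f x))\<^sup>2)"
  proof (rule Omega.integrable_const_bound)
    show "AE x in lebO. norm ((norm (f x))\<^sup>2) \<le> B\<^sup>2"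
      using B by (intro AE_I2) (auto simp: space_restrict_space Omega_def intro!: power_mono)
  qed measurable
  then show ?thesis by (simp add: L2_def)
qed

lemma weak_grad_L2: "weak_grad u g \<Longrightarrow> L2 lebO g"
  by (simp add: weak_grad_def L2_def)

lemma test_fun_L2:
  assumes "test_fun psi D"
  shows "L2 lebO (\<lambda>x. D x \<bullet> b)" "L2 lebO (\<lambda>x. psi x *\<^sub>R (b::complex))"
proof -
  have c: "C1_fun psi D" using assms by (simp add: test_fun_def)
  then have d: "continuous_on UNIV D" by (simp add: C1_fun_def)
  show "L2 lebO (\<lambda>x. D x \<bullet> b)" "L2 lebO (\<lambda>x. psi x *\<^sub>R (b::complex))"
    using C1_fun_continuous[OF c] d by (auto intro!: L2_Omega_continuous continuous_intros)
qed

text \<open>Both sides become inner products with fixed L2 functions, so linearity and stability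
  under L2 limits follow from the general facts on \<open>L2\<close>.\<close>

lemma weak_grad_iff:
  "weak_grad u g \<longleftrightarrow> L2 lebO g \<and> (\<forall>psi D. test_fun psi D \<longrightarrow> (\<forall>b\<in>Basis.
     (\<integral>x. (D x \<bullet> b) \<bullet> u x \<partial>lebO) + (\<integral>x. (psi x *\<^sub>R b) \<bullet> g x \<partial>lebO) = 0))"
proof -
  have "(\<integral>x. (D x \<bullet> b) \<bullet> u x \<partial>lebO) + (\<integral>x. (psi x *\<^sub>R b) \<bullet> g x \<partial>lebO) = 0 \<longleftrightarrow>
     (\<integral>x. u x * (D x \<bullet> b) \<partial>lebO) = - (\<integral>x. (g x \<bullet> b) * psi x \<partial>lebO)" for psi D b
    by (simp add: mult.commute inner_commute add_eq_0_iff2)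
  then show ?thesis by (simp add: weak_grad_def L2_def)
qed

lemma weak_grad_lin:
  assumes u: "L2 lebO u" "weak_grad u g" and v: "L2 lebO v" "weak_grad v h"
  shows "weak_grad (\<lambda>x. a * u x + b * v x) (\<lambda>x. a *\<^sub>R g x + b *\<^sub>R h x)"
  unfolding weak_grad_iff
proof (intro conjI allI impI ballI)
  show "L2 lebO (\<lambda>x. a *\<^sub>R g x + b *\<^sub>R h x)"
    using u v by (intro L2_lin weak_grad_L2)
  fix psi D and e :: complex assume t: "test_fun psi D" and e: "e \<in> Basis"
  note T = test_fun_L2[OF t, of e]
  have 1: "(\<integral>x. (D x \<bullet> e) \<bullet> (a * u x + b * v x) \<partial>lebO)
      = a * (\<integral>x. (D x \<bullet> e) \<bullet> u x \<partial>lebO) + b * (\<integral>x. (D x \<bullet> e) \<bullet> v x \<partial>lebO)"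
    using L2_integrable_inner[OF T(1) u(1)] L2_integrable_inner[OF T(1) v(1)]
    by (simp add: distrib_left mult.left_commute)
  have 2: "(\<integral>x. (psi x *\<^sub>R e) \<bullet> (a *\<^sub>R g x + b *\<^sub>R h x) \<partial>lebO)
      = a * (\<integral>x. (psi x *\<^sub>R e) \<bullet> g x \<partial>lebO) + b * (\<integral>x. (psi x *\<^sub>R e) \<bullet> h x \<partial>lebO)"
  proof -
    have "(psi x *\<^sub>R e) \<bullet> (a *\<^sub>R g x + b *\<^sub>R h x) = a * ((psi x *\<^sub>R e) \<bullet> g x) + b * ((psi x *\<^sub>R e) \<bullet> h x)" for x
      by (simp add: inner_add_right distrib_left mult.left_commute)
    then show ?thesis
      using L2_integrable_inner[OF T(2) weak_grad_L2[OF u(2)]] L2_integrable_inner[OF T(2) weak_grad_L2[OF v(2)]]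
      by (simp only: Bochner_Integration.integral_add integrable_mult_right integral_mult_right_zero)
  qed
  have 3: "(\<integral>x. (D x \<bullet> e) \<bullet> u x \<partial>lebO) + (\<integral>x. (psi x *\<^sub>R e) \<bullet> g x \<partial>lebO) = 0"
    "(\<integral>x. (D x \<bullet> e) \<bullet> v x \<partial>lebO) + (\<integral>x. (psi x *\<^sub>R e) \<bullet> h x \<partial>lebO) = 0"
    using u(2) v(2) t e unfolding weak_grad_iff by blast+
  have "a * P + b * Q + (a * P' + b * Q') = 0" if "P + P' = 0" "Q + Q' = 0" for P Q P' Q' :: real
    using that by (metis (no_types) add.commute add.left_commute add_0 distrib_left mult_zero_right)
  then show "(\<integral>x. (D x \<bullet> e) \<bullet> (a * u x + b * v x) \<partial>lebO)
     + (\<integral>x. (psi x *\<^sub>R e) \<bullet> (a *\<^sub>R g x + b *\<^sub>R h x) \<partial>lebO) = 0"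
    unfolding 1 2 using 3 by blast
qed

lemma weak_grad_limit:
  assumes u: "L2 lebO u" "\<And>n. L2 lebO (us n)" "(\<lambda>n. sqd lebO (us n) u) \<longlonglongrightarrow> 0"
    and g: "L2 lebO g" "(\<lambda>n. sqd lebO (gs n) g) \<longlonglongrightarrow> 0" and w: "\<And>n. weak_grad (us n) (gs n)"
  shows "weak_grad u g"
  unfolding weak_grad_iff
proof (intro conjI allI impI ballI g)
  fix psi D and e :: complex assume t: "test_fun psi D" and e: "e \<in> Basis"
  note T = test_fun_L2[OF t, of e]
  have "(\<lambda>n. (\<integral>x. (D x \<bullet> e) \<bullet> us n x \<partial>lebO) + (\<integral>x. (psi x *\<^sub>R e) \<bullet> gs n x \<partial>lebO))
      \<longlonglongrightarrow> (\<integral>x. (D x \<bullet> e) \<bullet> u x \<partial>lebO) + (\<integral>x. (psi x *\<^sub>R e) \<bullet> g x \<partial>lebO)"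
    by (intro tendsto_add L2_inner_tendsto T u g weak_grad_L2[OF w])
  moreover have "(\<integral>x. (D x \<bullet> e) \<bullet> us n x \<partial>lebO) + (\<integral>x. (psi x *\<^sub>R e) \<bullet> gs n x \<partial>lebO) = 0" for n
    using w[of n] t e unfolding weak_grad_iff by blast
  ultimately show "(\<integral>x. (D x \<bullet> e) \<bullet> u x \<partial>lebO) + (\<integral>x. (psi x *\<^sub>R e) \<bullet> g x \<partial>lebO) = 0"
    by (simp add: LIMSEQ_const_iff)
qed

text \<open>The fundamental lemma applied to each coordinate. Since \<open>H1_grad\<close> is a
  Hilbert choice, this is what allows any weak gradient to replace it under an integral.\<close>

lemma weak_grad_unique:
  assumes g: "weak_grad u g" "weak_grad u h"
  shows "AE x in lebO. g x = h x"
proof -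
  have "AE x in lebO. (g x - h x) \<bullet> b = 0" if b: "b \<in> Basis" for b
  proof (rule fundamental_lemma_Omega)
    have L: "L2 lebO (\<lambda>x. g x - h x)"
      using g by (intro L2_diff weak_grad_L2)
    have "L2 lebO (\<lambda>x. b)" by (intro L2_Omega_continuous continuous_intros)
    from L2_integrable_inner[OF L this] show "integrable lebO (\<lambda>x. (g x - h x) \<bullet> b)" .
    fix psi D assume t: "test_fun psi D"
    note T = test_fun_L2[OF t, of b]
    have "(\<integral>x. (psi x *\<^sub>R b) \<bullet> g x \<partial>lebO) = (\<integral>x. (psi x *\<^sub>R b) \<bullet> h x \<partial>lebO)"
    proof -
      have "(\<integral>x. (D x \<bullet> b) \<bullet> u x \<partial>lebO) + (\<integral>x. (psi x *\<^sub>R b) \<bullet> g x \<partial>lebO) = 0"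
        "(\<integral>x. (D x \<bullet> b) \<bullet> u x \<partial>lebO) + (\<integral>x. (psi x *\<^sub>R b) \<bullet> h x \<partial>lebO) = 0"
        using g b t unfolding weak_grad_iff by blast+
      then show ?thesis by linarith
    qed
    then have "(\<integral>x. (psi x *\<^sub>R b) \<bullet> g x - (psi x *\<^sub>R b) \<bullet> h x \<partial>lebO) = 0"
      using L2_integrable_inner[OF T(2) weak_grad_L2[OF g(1)]] L2_integrable_inner[OF T(2) weak_grad_L2[OF g(2)]]
      by (subst Bochner_Integration.integral_diff) auto
    moreover have "(g x - h x) \<bullet> b * psi x = (psi x *\<^sub>R b) \<bullet> g x - (psi x *\<^sub>R b) \<bullet> h x" for x
      by (simp add: inner_diff_left inner_commute algebra_simps)
    ultimately show "(\<integral>x. (g x - h x) \<bullet> b * psi x \<partial>lebO) = 0"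
      by (simp only:)
  qed
  then have "AE x in lebO. \<forall>b\<in>Basis. (g x - h x) \<bullet> b = 0"
    by (intro AE_finite_allI) auto
  then show ?thesis
    by eventually_elim (simp add: euclidean_all_zero_iff)
qed

section \<open>Null sets of the arc-length measure\<close>

lemma AE_sigma_iff:
  assumes [measurable]: "Measurable.pred borel P"
  shows "(AE z in sigma. P z) \<longleftrightarrow> (AE t in lborel. t \<in> {0..2*pi} \<longrightarrow> P (cis t))"
proof -
  have "(AE z in sigma. P z) \<longleftrightarrow> (\<integral>\<^sup>+z. indicator {z. \<not> P z} z \<partial>sigma) = 0"
    by (subst nn_integral_0_iff_AE) (auto simp: indicator_def)
  also have "\<dots> \<longleftrightarrow> (\<integral>\<^sup>+t. indicator {z. \<not> P z} (cis t) * indicator {0..2*pi} t \<partial>lborel) = 0"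
    by (subst nn_integral_sigma) auto
  also have "\<dots> \<longleftrightarrow> (AE t in lborel. t \<in> {0..2*pi} \<longrightarrow> P (cis t))"
  proof (subst nn_integral_0_iff_AE)
    show "(\<lambda>t. indicator {z. \<not> P z} (cis t) * indicator {0..2*pi} t :: ennreal) \<in> borel_measurable lborel"
      by measurable
  qed (auto simp: indicator_def)
  finally show ?thesis .
qed

lemma AE_sigma_norm: "AE z in sigma. norm z = 1"
  by (subst AE_sigma_iff) auto

lemma AE_sigma_Im_nonzero: "AE z in sigma. Im z \<noteq> 0"
proof (subst AE_sigma_iff)
  have "AE t in lborel. t \<noteq> 0 \<and> t \<noteq> pi \<and> t \<noteq> 2*pi"
    using AE_lborel_singleton[of "0::real"] AE_lborel_singleton[of pi] AE_lborel_singleton[of "2*pi"]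
    by eventually_elim auto
  then show "AE t in lborel. t \<in> {0..2*pi} \<longrightarrow> Im (cis t) \<noteq> 0"
  proof eventually_elim
    case (elim t)
    show ?case
    proof
      assume t: "t \<in> {0..2*pi}"
      show "Im (cis t) \<noteq> 0"
      proof (cases "t < pi")
        case True then show ?thesis using t elim sin_gt_zero[of t] by simp
      next
        case False then show ?thesis using t elim sin_gt_zero[of "t - pi"] by simp
      qed
    qed
  qed
qed measurable

text \<open>The condition in \<open>has_trace\<close> with the gradient as a parameter instead of
  \<open>H1_grad\<close>. Adding the three distances lets a diagonal argument choose one index that
  serves all of them.\<close>

definition C1_approximable :: "(complex \<Rightarrow> real) \<Rightarrow> (complex \<Rightarrow> complex) \<Rightarrow> (complex \<Rightarrow> real) \<Rightarrow> bool" where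
  "C1_approximable u g t \<longleftrightarrow> (\<exists>p D. (\<forall>n. C1_fun (p n) (D n)) \<and>
      (\<lambda>n. sqd lebO (p n) u + sqd lebO (D n) g + sqd sigma (p n) t) \<longlonglongrightarrow> 0)"

lemma tendsto_ennreal_add3_iff:
  fixes a b c :: "nat \<Rightarrow> ennreal"
  shows "(\<lambda>n. a n + b n + c n) \<longlonglongrightarrow> 0 \<longleftrightarrow> a \<longlonglongrightarrow> 0 \<and> b \<longlonglongrightarrow> 0 \<and> c \<longlonglongrightarrow> 0"
proof
  assume l: "(\<lambda>n. a n + b n + c n) \<longlonglongrightarrow> 0"
  have "a n \<le> a n + b n + c n" "b n \<le> a n + b n + c n" "c n \<le> a n + b n + c n" for n
    by (auto simp: add_increasing add_increasing2 add.assoc)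
  then show "a \<longlonglongrightarrow> 0 \<and> b \<longlonglongrightarrow> 0 \<and> c \<longlonglongrightarrow> 0"
    by (intro conjI tendsto_sandwich[OF _ _ tendsto_const l]) auto
next
  assume "a \<longlonglongrightarrow> 0 \<and> b \<longlonglongrightarrow> 0 \<and> c \<longlonglongrightarrow> 0"
  then have "(\<lambda>n. a n + b n + c n) \<longlonglongrightarrow> 0 + 0 + 0" by (intro tendsto_add) auto
  then show "(\<lambda>n. a n + b n + c n) \<longlonglongrightarrow> 0" by simp
qed

lemma has_trace_iff:
  "has_trace u t \<longleftrightarrow> t \<in> borel_measurable borel \<and> C1_approximable u (H1_grad u) t"
  by (simp add: has_trace_def C1_approximable_def tendsto_ennreal_add3_iff sqd_def measurable_sigma)

lemma C1_fun_measurable_lebO: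
  "C1_fun p D \<Longrightarrow> p \<in> borel_measurable lebO" "C1_fun p D \<Longrightarrow> D \<in> borel_measurable lebO"
  "C1_fun p D \<Longrightarrow> p \<in> borel_measurable sigma"
  using C1_fun_measurable[of p D] borel_measurable_lebO by (auto simp: measurable_sigma)

lemma sqd_cong_AE: "AE x in M. g x = h x \<Longrightarrow> sqd M f g = sqd M f h"
  unfolding sqd_def by (intro nn_integral_cong_AE) auto

lemma C1_approximable_cong:
  assumes "AE x in lebO. g x = h x"
  shows "C1_approximable u g t \<longleftrightarrow> C1_approximable u h t"
  using assms by (simp add: C1_approximable_def sqd_cong_AE)

text \<open>On the circle |Im z| is at most 1, so unweighted convergence of traces implies the
  weighted convergence that the chord estimates handle.\<close>

lemma sqd_sigma_Im_le: "sqd sigma (\<lambda>z. f z * Im z) (\<lambda>z. h z * Im z) \<le> sqd sigma f h" for f h :: "complex \<Rightarrow> real"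
  unfolding sqd_def
proof (rule nn_integral_mono_AE, use AE_sigma_norm in eventually_elim)
  case (elim z)
  have "\<bar>Im z\<bar> \<le> 1" using abs_Im_le_cmod[of z] elim by simp
  then have "\<bar>f z - h z\<bar> * \<bar>Im z\<bar> \<le> \<bar>f z - h z\<bar>" by (simp add: mult_left_le)
  then have "(norm (f z * Im z - h z * Im z))\<^sup>2 \<le> (norm (f z - h z))\<^sup>2"
    by (intro power_mono) (simp_all add: abs_mult flip: left_diff_distrib)
  then show ?case by (rule ennreal_leI)
qed

text \<open>Two approximating sequences share the limits u and g, so the first chord inequality,
  applied to their difference, shows that their weighted boundary values merge. Hence t and t' agree
  after multiplication by Im z, which is nonzero a.e.\<close>

lemma C1_approximable_trace_unique:
  assumes t: "t \<in> borel_measurable borel" "t' \<in> borel_measurable borel"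
    and u: "u \<in> borel_measurable lebO" and g: "g \<in> borel_measurable lebO"
    and a: "C1_approximable u g t" "C1_approximable u g t'"
  shows "AE z in sigma. t z = t' z"
proof -
  note t [measurable]
  have ts: "t \<in> borel_measurable sigma" "t' \<in> borel_measurable sigma"
    using t by (auto simp: measurable_sigma)
  from a(1) obtain p D where p: "\<And>n. C1_fun (p n) (D n)" and
    l: "(\<lambda>n. sqd lebO (p n) u) \<longlonglongrightarrow> 0" "(\<lambda>n. sqd lebO (D n) g) \<longlonglongrightarrow> 0" "(\<lambda>n. sqd sigma (p n) t) \<longlonglongrightarrow> 0"
    by (auto simp: C1_approximable_def tendsto_ennreal_add3_iff)
  from a(2) obtain p' D' where p': "\<And>n. C1_fun (p' n) (D' n)" and
    l': "(\<lambda>n. sqd lebO (p' n) u) \<longlonglongrightarrow> 0" "(\<lambda>n. sqd lebO (D' n) g) \<longlonglongrightarrow> 0" "(\<lambda>n. sqd sigma (p' n) t') \<longlonglongrightarrow> 0"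
    by (auto simp: C1_approximable_def tendsto_ennreal_add3_iff)
  let ?m = "\<lambda>f z. f z * Im z :: real"
  note ms = C1_fun_measurable_lebO
  have mI: "?m f \<in> borel_measurable sigma" if "f \<in> borel_measurable sigma" for f
    using that by measurable
  have bound: "sqd sigma (?m t) (?m t') \<le> 2 * sqd sigma (p n) t
      + 2 * (2 * (2 * (2 * sqd lebO (p n) u + 2 * sqd lebO (p' n) u)
         + (2 * sqd lebO (D n) g + 2 * sqd lebO (D' n) g)) + 2 * sqd sigma (p' n) t')" for n
  proof -
    have "sqd sigma (?m (p n)) (?m (p' n)) = (\<integral>\<^sup>+z. ennreal ((p n z - p' n z)\<^sup>2 * (Im z)\<^sup>2) \<partial>sigma)"
      by (simp add: sqd_def power_mult_distrib flip: left_diff_distrib)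
    also have "\<dots> \<le> 2 * sqd lebO (p n) (p' n) + sqd lebO (D n) (D' n)"
      using C1_fun_trace_inequalities(1)[OF C1_fun_diff[OF p p']] by (simp add: sqd_def)
    also have "\<dots> \<le> 2 * (2 * sqd lebO (p n) u + 2 * sqd lebO u (p' n))
        + (2 * sqd lebO (D n) g + 2 * sqd lebO g (D' n))"
      by (intro add_mono mult_left_mono sqd_triangle ms[OF p] ms[OF p'] u g) auto
    finally have 1: "sqd sigma (?m (p n)) (?m (p' n)) \<le> 2 * (2 * sqd lebO (p n) u + 2 * sqd lebO (p' n) u)
        + (2 * sqd lebO (D n) g + 2 * sqd lebO (D' n) g)"
      by (simp add: sqd_commute)
    have "sqd sigma (?m t) (?m t') \<le> 2 * sqd sigma (?m t) (?m (p n)) + 2 * sqd sigma (?m (p n)) (?m t')"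
      by (intro sqd_triangle mI ms[OF p] ts)
    also have "\<dots> \<le> 2 * sqd sigma (?m t) (?m (p n)) +
        2 * (2 * sqd sigma (?m (p n)) (?m (p' n)) + 2 * sqd sigma (?m (p' n)) (?m t'))"
      by (intro add_mono mult_left_mono order_refl sqd_triangle mI ms[OF p] ms[OF p'] ts) auto
    also have "\<dots> \<le> 2 * sqd sigma t (p n) +
        2 * (2 * (2 * (2 * sqd lebO (p n) u + 2 * sqd lebO (p' n) u)
        + (2 * sqd lebO (D n) g + 2 * sqd lebO (D' n) g)) + 2 * sqd sigma (p' n) t')"
      by (intro add_mono mult_left_mono sqd_sigma_Im_le 1) auto
    finally show ?thesis by (simp add: sqd_commute)
  qed
  have "(\<lambda>n. 2 * sqd sigma (p n) t
      + 2 * (2 * (2 * (2 * sqd lebO (p n) u + 2 * sqd lebO (p' n) u)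
         + (2 * sqd lebO (D n) g + 2 * sqd lebO (D' n) g)) + 2 * sqd sigma (p' n) t'))
     \<longlonglongrightarrow> 2 * 0 + 2 * (2 * (2 * (2 * 0 + 2 * 0) + (2 * 0 + 2 * 0)) + 2 * 0)"
    by (intro tendsto_add ennreal_tendsto_cmult l l') auto
  then have "sqd sigma (?m t) (?m t') \<le> 2 * 0 + 2 * (2 * (2 * (2 * 0 + 2 * 0) + (2 * 0 + 2 * 0)) + 2 * 0)"
    by (rule LIMSEQ_le_const) (use bound in blast)
  then have "AE z in sigma. ?m t z = ?m t' z"
    using sqd_eq_0_iff[OF mI[OF ts(1)] mI[OF ts(2)]] by simp
  then show ?thesis using AE_sigma_Im_nonzero by eventually_elim simp
qed

text \<open>The second chord inequality passed to the limit. Splitting off u - p, p - t and D - g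
  costs a factor 2 each time, so the constants 2 and 4 grow to 8 and 16. It supplies the control of
  u itself that the gradient norm of V leaves out.\<close>

lemma C1_approximable_Friedrichs:
  assumes t: "t \<in> borel_measurable borel"
    and u: "u \<in> borel_measurable lebO" and g: "g \<in> borel_measurable lebO"
    and a: "C1_approximable u g t"
  shows "sqd lebO u (\<lambda>_. 0) \<le> 8 * sqd sigma t (\<lambda>_. 0) + 16 * sqd lebO g (\<lambda>_. 0)"
proof -
  have ts: "t \<in> borel_measurable sigma"
    using t by (auto simp: measurable_sigma)
  from a obtain p D where p: "\<And>n. C1_fun (p n) (D n)" and
    l: "(\<lambda>n. sqd lebO (p n) u) \<longlonglongrightarrow> 0" "(\<lambda>n. sqd lebO (D n) g) \<longlonglongrightarrow> 0" "(\<lambda>n. sqd sigma (p n) t) \<longlonglongrightarrow> 0"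
    by (auto simp: C1_approximable_def tendsto_ennreal_add3_iff)
  note ms = C1_fun_measurable_lebO[OF p]
  let ?R = "\<lambda>n. 2 * sqd lebO (p n) u + 2 * (2 * (2 * sqd sigma (p n) t + 2 * sqd sigma t (\<lambda>_. 0))
      + 4 * (2 * sqd lebO (D n) g + 2 * sqd lebO g (\<lambda>_. 0)))"
  have bound: "sqd lebO u (\<lambda>_. 0) \<le> ?R n" for n
  proof -
    have "(\<integral>\<^sup>+z. ennreal ((p n z)\<^sup>2 * (Im z)\<^sup>2) \<partial>sigma) = sqd sigma (\<lambda>z. p n z * Im z) (\<lambda>z. 0 * Im z)"
      by (simp add: sqd_def power_mult_distrib)
    also have "\<dots> \<le> sqd sigma (p n) (\<lambda>_. 0)" by (rule sqd_sigma_Im_le)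
    finally have 1: "(\<integral>\<^sup>+z. ennreal ((p n z)\<^sup>2 * (Im z)\<^sup>2) \<partial>sigma) \<le> sqd sigma (p n) (\<lambda>_. 0)" .
    have "sqd lebO (p n) (\<lambda>_. 0) \<le> 2 * (\<integral>\<^sup>+z. ennreal ((p n z)\<^sup>2 * (Im z)\<^sup>2) \<partial>sigma)
        + 4 * sqd lebO (D n) (\<lambda>_. 0)"
      using C1_fun_trace_inequalities(2)[OF p, of n] by (simp add: sqd_def)
    also have "\<dots> \<le> 2 * sqd sigma (p n) (\<lambda>_. 0) + 4 * sqd lebO (D n) (\<lambda>_. 0)"
      by (intro add_mono mult_left_mono 1) auto
    finally have 2: "sqd lebO (p n) (\<lambda>_. 0) \<le> 2 * sqd sigma (p n) (\<lambda>_. 0) + 4 * sqd lebO (D n) (\<lambda>_. 0)" .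
    have "sqd lebO u (\<lambda>_. 0) \<le> 2 * sqd lebO u (p n) + 2 * sqd lebO (p n) (\<lambda>_. 0)"
      by (intro sqd_triangle u ms) auto
    also have "\<dots> \<le> 2 * sqd lebO u (p n) + 2 * (2 * sqd sigma (p n) (\<lambda>_. 0) + 4 * sqd lebO (D n) (\<lambda>_. 0))"
      by (intro add_mono mult_left_mono 2) auto
    also have "\<dots> \<le> 2 * sqd lebO u (p n) + 2 * (2 * (2 * sqd sigma (p n) t + 2 * sqd sigma t (\<lambda>_. 0))
      + 4 * (2 * sqd lebO (D n) g + 2 * sqd lebO g (\<lambda>_. 0)))"
      by (intro add_mono mult_left_mono order_refl sqd_triangle ms ts g) auto
    finally show ?thesis by (simp add: sqd_commute)
  qed
  have "?R \<longlonglongrightarrow> 2 * 0 + 2 * (2 * (2 * 0 + 2 * sqd sigma t (\<lambda>_. 0))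
      + 4 * (2 * 0 + 2 * sqd lebO g (\<lambda>_. 0)))"
    by (intro tendsto_add ennreal_tendsto_cmult l tendsto_const) auto
  then have "sqd lebO u (\<lambda>_. 0) \<le> 2 * 0 + 2 * (2 * (2 * 0 + 2 * sqd sigma t (\<lambda>_. 0))
      + 4 * (2 * 0 + 2 * sqd lebO g (\<lambda>_. 0)))"
    by (rule LIMSEQ_le_const) (use bound in auto)
  also have "\<dots> = 8 * sqd sigma t (\<lambda>_. 0) + 16 * sqd lebO g (\<lambda>_. 0)"
    by (simp add: distrib_left mult.assoc[symmetric])
  finally show ?thesis .
qed

lemma sqd_lin_le:
  fixes f g :: "'a \<Rightarrow> 'b::{second_countable_topology, real_normed_vector}"
  assumes [measurable]: "f \<in> borel_measurable M" "g \<in> borel_measurable M" "h \<in> borel_measurable M" "k \<in> borel_measurable M"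
  shows "sqd M (\<lambda>x. a *\<^sub>R f x + b *\<^sub>R g x) (\<lambda>x. a *\<^sub>R h x + b *\<^sub>R k x)
    \<le> ennreal (2 * a\<^sup>2) * sqd M f h + ennreal (2 * b\<^sup>2) * sqd M g k"
proof -
  have "sqd M (\<lambda>x. a *\<^sub>R f x + b *\<^sub>R g x) (\<lambda>x. a *\<^sub>R h x + b *\<^sub>R k x)
    \<le> (\<integral>\<^sup>+x. ennreal (2 * a\<^sup>2) * ennreal ((norm (f x - h x))\<^sup>2) + ennreal (2 * b\<^sup>2) * ennreal ((norm (g x - k x))\<^sup>2) \<partial>M)"
    unfolding sqd_def
  proof (rule nn_integral_mono)
    fix x
    have "(norm (a *\<^sub>R f x + b *\<^sub>R g x - (a *\<^sub>R h x + b *\<^sub>R k x)))\<^sup>2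
        = (norm (a *\<^sub>R (f x - h x) + b *\<^sub>R (g x - k x)))\<^sup>2"
      by (simp add: algebra_simps)
    also have "\<dots> \<le> 2 * (norm (a *\<^sub>R (f x - h x)))\<^sup>2 + 2 * (norm (b *\<^sub>R (g x - k x)))\<^sup>2"
      by (rule norm_add_squared_le)
    also have "\<dots> = 2 * a\<^sup>2 * (norm (f x - h x))\<^sup>2 + 2 * b\<^sup>2 * (norm (g x - k x))\<^sup>2"
      by (simp add: power_mult_distrib)
    finally show "ennreal ((norm (a *\<^sub>R f x + b *\<^sub>R g x - (a *\<^sub>R h x + b *\<^sub>R k x)))\<^sup>2)
      \<le> ennreal (2 * a\<^sup>2) * ennreal ((norm (f x - h x))\<^sup>2) + ennreal (2 * b\<^sup>2) * ennreal ((norm (g x - k x))\<^sup>2)"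
      by (simp add: ennreal_plus[symmetric] ennreal_mult'[symmetric] ennreal_leI del: ennreal_plus)
  qed
  also have "\<dots> = ennreal (2 * a\<^sup>2) * sqd M f h + ennreal (2 * b\<^sup>2) * sqd M g k"
    unfolding sqd_def by (simp add: nn_integral_add nn_integral_cmult)
  finally show ?thesis .
qed

lemma sqd_lin_tendsto:
  fixes f g :: "'a \<Rightarrow> 'b::{second_countable_topology, real_normed_vector}"
  assumes m: "\<And>n. fs n \<in> borel_measurable M" "\<And>n. gs n \<in> borel_measurable M" "f \<in> borel_measurable M" "g \<in> borel_measurable M"
    and l: "(\<lambda>n. sqd M (fs n) f) \<longlonglongrightarrow> 0" "(\<lambda>n. sqd M (gs n) g) \<longlonglongrightarrow> 0"
  shows "(\<lambda>n. sqd M (\<lambda>x. a *\<^sub>R fs n x + b *\<^sub>R gs n x) (\<lambda>x. a *\<^sub>R f x + b *\<^sub>R g x)) \<longlonglongrightarrow> 0"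
proof (rule tendsto_sandwich[OF _ _ tendsto_const])
  have "(\<lambda>n. ennreal (2 * a\<^sup>2) * sqd M (fs n) f + ennreal (2 * b\<^sup>2) * sqd M (gs n) g)
     \<longlonglongrightarrow> ennreal (2 * a\<^sup>2) * 0 + ennreal (2 * b\<^sup>2) * 0"
    by (intro tendsto_add ennreal_tendsto_cmult l) auto
  then show "(\<lambda>n. ennreal (2 * a\<^sup>2) * sqd M (fs n) f + ennreal (2 * b\<^sup>2) * sqd M (gs n) g) \<longlonglongrightarrow> 0"
    by simp
qed (use sqd_lin_le[OF m(1,2,3,4)] in auto)

lemma C1_approximable_lin:
  assumes u: "u \<in> borel_measurable lebO" "g \<in> borel_measurable lebO" "t \<in> borel_measurable sigma" "C1_approximable u g t"
    and v: "v \<in> borel_measurable lebO" "h \<in> borel_measurable lebO" "s \<in> borel_measurable sigma" "C1_approximable v h s"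
  shows "C1_approximable (\<lambda>x. a * u x + b * v x) (\<lambda>x. a *\<^sub>R g x + b *\<^sub>R h x) (\<lambda>x. a * t x + b * s x)"
proof -
  from u(4) obtain p D where p: "\<And>n. C1_fun (p n) (D n)" and
    l: "(\<lambda>n. sqd lebO (p n) u) \<longlonglongrightarrow> 0" "(\<lambda>n. sqd lebO (D n) g) \<longlonglongrightarrow> 0" "(\<lambda>n. sqd sigma (p n) t) \<longlonglongrightarrow> 0"
    by (auto simp: C1_approximable_def tendsto_ennreal_add3_iff)
  from v(4) obtain q E where q: "\<And>n. C1_fun (q n) (E n)" and
    l': "(\<lambda>n. sqd lebO (q n) v) \<longlonglongrightarrow> 0" "(\<lambda>n. sqd lebO (E n) h) \<longlonglongrightarrow> 0" "(\<lambda>n. sqd sigma (q n) s) \<longlonglongrightarrow> 0"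
    by (auto simp: C1_approximable_def tendsto_ennreal_add3_iff)
  note m = C1_fun_measurable_lebO[OF p] C1_fun_measurable_lebO[OF q]
  show ?thesis
    unfolding C1_approximable_def tendsto_ennreal_add3_iff
  proof (intro exI conjI allI)
    show "C1_fun (\<lambda>z. a * p n z + b * q n z) (\<lambda>z. a *\<^sub>R D n z + b *\<^sub>R E n z)" for n
      by (rule C1_fun_lin[OF p q])
    show "(\<lambda>n. sqd lebO (\<lambda>z. a * p n z + b * q n z) (\<lambda>x. a * u x + b * v x)) \<longlonglongrightarrow> 0"
      using sqd_lin_tendsto[OF m(1,4) u(1) v(1) l(1) l'(1), of a b] by simp
    show "(\<lambda>n. sqd lebO (\<lambda>z. a *\<^sub>R D n z + b *\<^sub>R E n z) (\<lambda>x. a *\<^sub>R g x + b *\<^sub>R h x)) \<longlonglongrightarrow> 0"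
      by (rule sqd_lin_tendsto[OF m(2,5) u(2) v(2) l(2) l'(2)])
    show "(\<lambda>n. sqd sigma (\<lambda>z. a * p n z + b * q n z) (\<lambda>x. a * t x + b * s x)) \<longlonglongrightarrow> 0"
      using sqd_lin_tendsto[OF m(3,6) u(3) v(3) l(3) l'(3), of a b] by simp
  qed
qed

text \<open>Diagonal choice: for the n-th member take one C1 function within 1/(n+1) of its value,
  gradient and trace together.\<close>

lemma C1_approximable_limit:
  assumes m: "\<And>n. us n \<in> borel_measurable lebO" "\<And>n. gs n \<in> borel_measurable lebO" "\<And>n. ts n \<in> borel_measurable sigma"
    "u \<in> borel_measurable lebO" "g \<in> borel_measurable lebO" "t \<in> borel_measurable sigma"
    and a: "\<And>n. C1_approximable (us n) (gs n) (ts n)"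
    and l: "(\<lambda>n. sqd lebO (us n) u) \<longlonglongrightarrow> 0" "(\<lambda>n. sqd lebO (gs n) g) \<longlonglongrightarrow> 0" "(\<lambda>n. sqd sigma (ts n) t) \<longlonglongrightarrow> 0"
  shows "C1_approximable u g t"
proof -
  have "\<exists>p D. C1_fun p D \<and> sqd lebO p (us n) + sqd lebO D (gs n) + sqd sigma p (ts n) < ennreal (1 / Suc n)" for n
  proof -
    from a[of n] obtain p D where p: "\<And>k. C1_fun (p k) (D k)" and
      l: "(\<lambda>k. sqd lebO (p k) (us n) + sqd lebO (D k) (gs n) + sqd sigma (p k) (ts n)) \<longlonglongrightarrow> 0"
      by (auto simp: C1_approximable_def)
    have "\<forall>\<^sub>F k in sequentially. sqd lebO (p k) (us n) + sqd lebO (D k) (gs n) + sqd sigma (p k) (ts n) < ennreal (1 / Suc n)"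
      using order_tendstoD(2)[OF l, of "ennreal (1 / Suc n)"] by simp
    then show ?thesis
      using p by (auto simp: eventually_sequentially)
  qed
  then obtain p D where p: "\<And>n. C1_fun (p n) (D n)"
    and s: "\<And>n. sqd lebO (p n) (us n) + sqd lebO (D n) (gs n) + sqd sigma (p n) (ts n) < ennreal (1 / Suc n)"
    by metis
  have "(\<lambda>n. sqd lebO (p n) (us n) + sqd lebO (D n) (gs n) + sqd sigma (p n) (ts n)) \<longlonglongrightarrow> 0"
  proof (rule tendsto_sandwich[OF _ _ tendsto_const])
    have "(\<lambda>n. ennreal (1 / real (Suc n))) \<longlonglongrightarrow> ennreal 0"
      by (intro tendsto_ennrealI LIMSEQ_Suc lim_1_over_n)
    then show "(\<lambda>n. ennreal (1 / real (Suc n))) \<longlonglongrightarrow> 0" by simp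
  qed (use s in \<open>auto intro!: always_eventually less_imp_le\<close>)
  then have k: "(\<lambda>n. sqd lebO (p n) (us n)) \<longlonglongrightarrow> 0" "(\<lambda>n. sqd lebO (D n) (gs n)) \<longlonglongrightarrow> 0"
    "(\<lambda>n. sqd sigma (p n) (ts n)) \<longlonglongrightarrow> 0"
    by (auto simp: tendsto_ennreal_add3_iff)
  have tri: "(\<lambda>n. sqd M (a n) c) \<longlonglongrightarrow> 0"
    if "(\<lambda>n. sqd M (a n) (b n)) \<longlonglongrightarrow> 0" "(\<lambda>n. sqd M (b n) c) \<longlonglongrightarrow> 0"
      "\<And>n. a n \<in> borel_measurable M" "\<And>n. b n \<in> borel_measurable M" "c \<in> borel_measurable M"
    for M :: "complex measure" and a b and c :: "complex \<Rightarrow> 'b::{second_countable_topology, real_normed_vector}"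
  proof (rule tendsto_sandwich[OF _ _ tendsto_const])
    have "(\<lambda>n. 2 * sqd M (a n) (b n) + 2 * sqd M (b n) c) \<longlonglongrightarrow> 2 * 0 + 2 * 0"
      by (intro tendsto_add ennreal_tendsto_cmult that) auto
    then show "(\<lambda>n. 2 * sqd M (a n) (b n) + 2 * sqd M (b n) c) \<longlonglongrightarrow> 0" by simp
  qed (use sqd_triangle[OF that(3,4,5)] in auto)
  note pm = C1_fun_measurable_lebO[OF p]
  show ?thesis
    unfolding C1_approximable_def tendsto_ennreal_add3_iff
    using p tri[OF k(1) l(1) pm(1) m(1) m(4)] tri[OF k(2) l(2) pm(2) m(2) m(5)] tri[OF k(3) l(3) pm(3) m(3) m(6)]
    by blast
qed

section \<open>The space V and exponential integrability of traces\<close>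

text \<open>Membership in V witnessed by arbitrary representatives of gradient and trace. Unlike the
  Hilbert choices \<open>H1_grad\<close> and \<open>trace_of\<close>, such representatives can be
  combined linearly and passed to limits.\<close>

definition V_data :: "complex set \<Rightarrow> (complex \<Rightarrow> real) \<Rightarrow> (complex \<Rightarrow> complex) \<Rightarrow> (complex \<Rightarrow> real) \<Rightarrow> bool" where
  "V_data GD u g t \<longleftrightarrow> L2 lebO u \<and> weak_grad u g \<and> t \<in> borel_measurable borel
     \<and> C1_approximable u g t \<and> (AE x in sigma. x \<in> GD \<longrightarrow> t x = 0)"

text \<open>Uniqueness of weak gradients and of traces identifies the chosen representatives with
  the given ones a.e.\<close>

lemma V_dataI:
  assumes u: "V_data GD u g t"
  shows "u \<in> V GD" "AE x in lebO. H1_grad u x = g x" "AE x in sigma. trace_of u x = t x"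
proof -
  have u': "L2 lebO u" "weak_grad u g" "t \<in> borel_measurable borel" "C1_approximable u g t"
    "AE x in sigma. x \<in> GD \<longrightarrow> t x = 0"
    using u by (auto simp: V_data_def)
  have H1: "H1 u" using u' by (auto simp: H1_def L2_Omega_iff)
  have "weak_grad u (H1_grad u)"
    unfolding H1_grad_def using u'(2) by (rule someI[of "weak_grad u"])
  then show g: "AE x in lebO. H1_grad u x = g x"
    using u'(2) by (rule weak_grad_unique)
  have ht: "has_trace u t"
    using u' C1_approximable_cong[OF g] by (simp add: has_trace_iff)
  then have "has_trace u (trace_of u)"
    unfolding trace_of_def by (rule someI[of "has_trace u"])
  then show t: "AE x in sigma. trace_of u x = t x"
    using u' C1_approximable_cong[OF g] unfolding has_trace_iff
    by (intro C1_approximable_trace_unique[where u = u and g = g]) (auto intro: L2_measurable weak_grad_L2)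
  have "AE x in sigma. x \<in> GD \<longrightarrow> trace_of u x = 0"
    using t u'(5) by eventually_elim simp
  then show "u \<in> V GD"
    using H1 ht by (auto simp: V_def)
qed

lemma V_data_of_V:
  assumes "u \<in> V GD"
  shows "V_data GD u (H1_grad u) (trace_of u)"
proof -
  have "H1 u" "\<exists>t. has_trace u t" "AE x in sigma. x \<in> GD \<longrightarrow> trace_of u x = 0"
    using assms by (auto simp: V_def)
  moreover from this have "has_trace u (trace_of u)"
    unfolding trace_of_def using someI_ex[of "has_trace u"] by simp
  moreover have "weak_grad u (H1_grad u)"
    using \<open>H1 u\<close> someI_ex[of "weak_grad u"] unfolding H1_grad_def H1_def by simp
  ultimately show ?thesis
    by (auto simp: V_data_def H1_def L2_Omega_iff has_trace_iff)
qed

lemma V_data_zero: "V_data GD (\<lambda>_. 0) (\<lambda>_. 0) (\<lambda>_. 0)"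
proof -
  have "C1_fun (\<lambda>_. 0) (\<lambda>_. 0)"
    using C1_fun_affine[of 0 0] by simp
  then have "C1_approximable (\<lambda>_. 0) (\<lambda>_. 0) (\<lambda>_. 0)"
    unfolding C1_approximable_def by (intro exI[of _ "\<lambda>n _. 0"]) (simp add: sqd_def)
  moreover have "weak_grad (\<lambda>_. 0) (\<lambda>_. 0)"
    by (simp add: weak_grad_def)
  ultimately show ?thesis by (simp add: V_data_def L2_def)
qed

lemma V_data_measurable:
  assumes "V_data GD u g t"
  shows "u \<in> borel_measurable lebO" "g \<in> borel_measurable lebO" "t \<in> borel_measurable sigma"
    "t \<in> borel_measurable borel" "L2 lebO u" "L2 lebO g"
  using assms by (auto simp: V_data_def measurable_sigma intro: L2_measurable weak_grad_L2)

lemma V_data_lin: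
  assumes u: "V_data GD u g t" and v: "V_data GD v k s"
  shows "V_data GD (\<lambda>x. a * u x + b * v x) (\<lambda>x. a *\<^sub>R g x + b *\<^sub>R k x) (\<lambda>x. a * t x + b * s x)"
proof -
  note m = V_data_measurable[OF u] V_data_measurable[OF v]
  have "AE x in sigma. x \<in> GD \<longrightarrow> a * t x + b * s x = 0"
  proof -
    have "AE x in sigma. x \<in> GD \<longrightarrow> t x = 0" "AE x in sigma. x \<in> GD \<longrightarrow> s x = 0"
      using u v by (simp_all add: V_data_def)
    then show ?thesis by eventually_elim simp
  qed
  moreover have "L2 lebO (\<lambda>x. a * u x + b * v x)"
    using L2_lin[OF m(5) m(11), of a b] by simp
  moreover have "(\<lambda>x. a * t x + b * s x) \<in> borel_measurable borel"
    using m(4,10) by simp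
  moreover have "weak_grad (\<lambda>x. a * u x + b * v x) (\<lambda>x. a *\<^sub>R g x + b *\<^sub>R k x)"
    using u v by (intro weak_grad_lin) (auto simp: V_data_def)
  moreover have "C1_approximable (\<lambda>x. a * u x + b * v x) (\<lambda>x. a *\<^sub>R g x + b *\<^sub>R k x) (\<lambda>x. a * t x + b * s x)"
    using u v m by (intro C1_approximable_lin) (auto simp: V_data_def)
  ultimately show ?thesis by (simp add: V_data_def)
qed

text \<open>The boundary condition on \<open>GD\<close> is carried over pointwise, which is why a.e.
  convergence of the traces accompanies their L2 convergence.\<close>

lemma V_data_limit:
  assumes d: "\<And>n. V_data GD (us n) (gs n) (ts n)"
    and m: "u \<in> borel_measurable lebO" "g \<in> borel_measurable lebO" "t \<in> borel_measurable sigma"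
    and L: "L2 lebO u" "L2 lebO g"
    and l: "(\<lambda>n. sqd lebO (us n) u) \<longlonglongrightarrow> 0" "(\<lambda>n. sqd lebO (gs n) g) \<longlonglongrightarrow> 0" "(\<lambda>n. sqd sigma (ts n) t) \<longlonglongrightarrow> 0"
    and ae: "AE x in sigma. (\<lambda>n. ts n x) \<longlonglongrightarrow> t x"
  shows "V_data GD u g t"
proof -
  note dm = V_data_measurable[OF d]
  have "weak_grad u g"
    using d by (intro weak_grad_limit[OF L(1) dm(5) l(1) L(2) l(2)]) (simp add: V_data_def)
  moreover have "C1_approximable u g t"
    using d by (intro C1_approximable_limit[OF dm(1,2,3) m _ l]) (simp add: V_data_def)
  moreover have "AE x in sigma. x \<in> GD \<longrightarrow> t x = 0"
  proof -
    have "AE x in sigma. x \<in> GD \<longrightarrow> ts n x = 0" for n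
      using d[of n] by (simp add: V_data_def)
    then have "AE x in sigma. \<forall>n. x \<in> GD \<longrightarrow> ts n x = 0"
      unfolding AE_all_countable by blast
    with ae show ?thesis
      by eventually_elim (auto simp: LIMSEQ_const_iff)
  qed
  ultimately show ?thesis
    using L m by (simp add: V_data_def measurable_sigma)
qed

section \<open>Moments and exponential moments of traces\<close>

definition gradsq :: "(complex \<Rightarrow> complex) \<Rightarrow> real" where
  "gradsq g = (\<integral>x. (norm (g x))\<^sup>2 \<partial>lebO)"

lemma gradsq_nonneg: "gradsq g \<ge> 0"
  by (simp add: gradsq_def)

text \<open>n^n / n! is a single term of the series for exp n, and exp 1 is at most 3.\<close>

lemma power_le_fact_mult_power_3: "real n ^ n \<le> 3 ^ n * fact n"
proof -
  have s: "(\<lambda>k. real n ^ k / fact k) sums exp (real n)"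
    using exp_converges[of "real n"] by (simp add: divide_inverse mult.commute)
  then have "real n ^ n / fact n \<le> exp (real n)"
    using sum_le_suminf[of "\<lambda>k. real n ^ k / fact k" "{n}"] by (simp add: sums_iff)
  also have "exp (real n) = exp 1 ^ n"
    by (simp flip: exp_of_nat_mult)
  also have "\<dots> \<le> 3 ^ n"
    by (intro power_mono exp_le) simp
  finally show ?thesis by (simp add: field_simps)
qed

text \<open>The embedding constants grow like n^(n/2) up to geometric factors, while n! is at least
  (n/3)^n. The n-th term is therefore at most (c / sqrt n)^n, which drops below 2^-n once n >=
  (2c)^2.\<close>

lemma summable_embedding_constants:
  fixes C N l :: real
  assumes C: "C > 0" and N: "N \<ge> 0" and l: "l \<ge> 0"
  shows "summable (\<lambda>n. l ^ n / fact n * (C powr (real n - 2) * real n powr ((real n - 2) / 2) * N powr real n))"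
proof (rule summable_comparison_test_ev)
  show "summable (\<lambda>n. (1/2::real) ^ n)" by (simp add: summable_geometric)
  \<comment> \<open>Replacing C by a number at least 1 allows its exponent to be raised from n - 2
    to n.\<close>
  define D where "D = max C 1"
  define c where "c = 3 * D * l * N"
  have c0: "c \<ge> 0" using assms by (simp add: c_def D_def)
  have "norm (l ^ n / fact n * (C powr (real n - 2) * real n powr ((real n - 2) / 2) * N powr real n)) \<le> (1/2) ^ n"
    if n: "n \<ge> nat \<lceil>(2 * c)\<^sup>2\<rceil> + 3" for n
  proof -
    have n3: "n \<ge> 3" and nc: "(2 * c)\<^sup>2 \<le> real n" using n by linarith+
    have s: "2 * c \<le> sqrt (real n)" using nc c0 by (simp add: real_le_rsqrt)
    have 1: "C powr (real n - 2) \<le> D ^ n"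
    proof -
      have "C powr (real n - 2) \<le> D powr (real n - 2)"
        using n3 C by (intro powr_mono2) (auto simp: D_def)
      also have "\<dots> \<le> D powr real n"
        by (intro powr_mono) (auto simp: D_def)
      also have "\<dots> = D ^ n" by (intro powr_realpow) (simp add: D_def)
      finally show ?thesis .
    qed
    have 2: "real n powr ((real n - 2) / 2) \<le> sqrt (real n) ^ n"
    proof -
      have "real n powr ((real n - 2) / 2) \<le> real n powr (1/2 * real n)"
        using n3 by (intro powr_mono) auto
      also have "\<dots> = sqrt (real n) powr real n"
        using n3 by (simp add: powr_half_sqrt[symmetric] powr_powr)
      also have "\<dots> = sqrt (real n) ^ n" using n3 by (intro powr_realpow) simp
      finally show ?thesis .
    qed
    have 3: "N powr real n = N ^ n"
      using N n3 by (cases "N = 0") (auto simp: powr_realpow)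
    have 4: "1 / fact n \<le> 3 ^ n / real n ^ n"
      using power_le_fact_mult_power_3[of n] n3 by (simp add: field_simps)
    have "l ^ n / fact n * (C powr (real n - 2) * real n powr ((real n - 2) / 2) * N powr real n)
      \<le> l ^ n * (3 ^ n / real n ^ n) * (D ^ n * sqrt (real n) ^ n * N ^ n)"
    proof (intro mult_mono)
      show "l ^ n / fact n \<le> l ^ n * (3 ^ n / real n ^ n)"
        using mult_left_mono[OF 4, of "l ^ n"] l by simp
    qed (use 1 2 3 l N in \<open>auto intro!: mult_nonneg_nonneg simp: D_def\<close>)
    also have "\<dots> = (c * sqrt (real n) / real n) ^ n"
      by (simp add: c_def power_mult_distrib power_divide mult_ac)
    also have "\<dots> = (c / sqrt (real n)) ^ n"
      by (metis real_div_sqrt[of "real n"] of_nat_0_le_iff divide_divide_eq_right times_divide_eq_right mult.commute)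
    also have "\<dots> \<le> (1/2) ^ n"
      using s n3 c0 by (intro power_mono) (auto simp: field_simps)
    finally show ?thesis
      using l N C by simp
  qed
  then show "\<forall>\<^sub>F n in sequentially. norm (l ^ n / fact n * (C powr (real n - 2) * real n powr ((real n - 2) / 2) * N powr real n)) \<le> (1/2) ^ n"
    unfolding eventually_sequentially by blast
qed

locale trace_embedding =
  fixes GD :: "complex set" and C :: real
  assumes C: "C > 0"
    and embedding: "\<And>p u. p \<ge> 3 \<Longrightarrow> u \<in> V GD \<Longrightarrow>
      (\<integral>\<^sup>+x. ennreal (\<bar>trace_of u x\<bar> powr p) \<partial>sigma)
             \<le> ennreal (C powr (p - 2) * p powr ((p - 2) / 2) * Vnorm u powr p)"
begin

lemma V_data_embedding:
  assumes u: "V_data GD u g t" and p: "p \<ge> 3"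
  shows "(\<integral>\<^sup>+x. ennreal (\<bar>t x\<bar> powr p) \<partial>sigma)
     \<le> ennreal (C powr (p - 2) * p powr ((p - 2) / 2) * sqrt (gradsq g) powr p)"
proof -
  note v = V_dataI[OF u]
  have "V_data GD u (H1_grad u) (trace_of u)" by (rule V_data_of_V) fact
  from V_data_measurable(2)[OF this] V_data_measurable(2)[OF u]
  have "Vnorm u = sqrt (gradsq g)"
    unfolding Vnorm_def gradsq_def
    by (intro arg_cong[where f = sqrt] integral_cong_AE) (use v(2) in \<open>auto\<close>)
  moreover have "(\<integral>\<^sup>+x. ennreal (\<bar>t x\<bar> powr p) \<partial>sigma) = (\<integral>\<^sup>+x. ennreal (\<bar>trace_of u x\<bar> powr p) \<partial>sigma)"
    by (rule nn_integral_cong_AE) (use v(3) in auto)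
  ultimately show ?thesis
    using embedding[OF p v(1)] by simp
qed

text \<open>The embedding at p = 4. Since \<open>gradsq g\<close> is the squared V-norm, the bound
  C^2 4 ||u||^4 is the square of 2 C \<open>gradsq g\<close>.\<close>

lemma V_data_L4:
  assumes u: "V_data GD u g t"
  shows "L2 sigma (\<lambda>x. (t x)\<^sup>2)" "(\<integral>x. ((t x)\<^sup>2)\<^sup>2 \<partial>sigma) \<le> (2 * C * gradsq g)\<^sup>2"
proof -
  note [measurable] = V_data_measurable(3)[OF u]
  have "\<bar>t x\<bar> powr 4 = ((t x)\<^sup>2)\<^sup>2" for x
    by (simp add: powr_numeral flip: power_mult)
  moreover have "C powr (4 - 2) * 4 powr ((4 - 2) / 2) * sqrt (gradsq g) powr 4 = (2 * C * gradsq g)\<^sup>2"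
  proof -
    have "sqrt (gradsq g) powr 4 = ((sqrt (gradsq g))\<^sup>2)\<^sup>2"
      by (simp add: powr_numeral gradsq_nonneg power4_eq_xxxx) (simp add: power2_eq_square gradsq_nonneg)
    then show ?thesis
      using C by (simp add: gradsq_nonneg power_mult_distrib powr_numeral)
  qed
  ultimately have b: "(\<integral>\<^sup>+x. ennreal (((t x)\<^sup>2)\<^sup>2) \<partial>sigma) \<le> ennreal ((2 * C * gradsq g)\<^sup>2)"
    using V_data_embedding[OF u, of 4] by simp
  have i: "integrable sigma (\<lambda>x. ((t x)\<^sup>2)\<^sup>2)"
    by (rule integrableI_bounded) (use b in \<open>auto intro: le_less_trans\<close>)
  then show "L2 sigma (\<lambda>x. (t x)\<^sup>2)"
    by (simp add: L2_def)
  show "(\<integral>x. ((t x)\<^sup>2)\<^sup>2 \<partial>sigma) \<le> (2 * C * gradsq g)\<^sup>2"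
    using b by (subst (asm) nn_integral_eq_integral[OF i]) auto
qed

text \<open>Cauchy-Schwarz for t^2 against the constant 1 turns the fourth-moment bound into one for
  the second moment; the root of the length of the circle is the norm of that constant.\<close>

definition trace_const :: real where
  "trace_const = 2 * C * sqrt (measure sigma UNIV)"

lemma V_data_L2_trace:
  assumes u: "V_data GD u g t"
  shows "L2 sigma t" "(\<integral>x. (t x)\<^sup>2 \<partial>sigma) \<le> trace_const * gradsq g"
proof -
  note [measurable] = V_data_measurable(3)[OF u]
  note L4 = V_data_L4[OF u]
  have one: "L2 sigma (\<lambda>_. 1::real)" by (simp add: L2_def)
  show "L2 sigma t"
    using L2_integrable_inner[OF L4(1) one] by (simp add: L2_def)
  have "(\<integral>x. (t x)\<^sup>2 \<partial>sigma)\<^sup>2 \<le> (\<integral>x. ((t x)\<^sup>2)\<^sup>2 \<partial>sigma) * measure sigma UNIV"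
    using L2_Cauchy_Schwarz[OF L4(1) one] by simp
  also have "\<dots> \<le> (2 * C * gradsq g)\<^sup>2 * measure sigma UNIV"
    using L4(2) by (intro mult_right_mono) auto
  also have "\<dots> = (trace_const * gradsq g)\<^sup>2"
    by (simp add: trace_const_def power_mult_distrib)
  finally show "(\<integral>x. (t x)\<^sup>2 \<partial>sigma) \<le> trace_const * gradsq g"
    by (rule power2_le_imp_le) (use C gradsq_nonneg[of g] in \<open>simp add: trace_const_def\<close>)
qed

lemma trace_const_nonneg: "trace_const \<ge> 0"
  using C by (simp add: trace_const_def)

text \<open>Expand the exponential and integrate termwise: the embedding at p = n bounds the n-th
  moment, and \<open>summable_embedding_constants\<close> sums the bounds. An arbitrary rate l is
  allowed so that products of exponentials can be split later.\<close>

lemma V_data_exp_integrable: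
  assumes u: "V_data GD u g t" and l: "l \<ge> 0"
  shows "integrable sigma (\<lambda>x. exp (l * \<bar>t x\<bar>))"
proof (rule integrableI_bounded)
  note [measurable] = V_data_measurable(3)[OF u]
  show "(\<lambda>x. exp (l * \<bar>t x\<bar>)) \<in> borel_measurable sigma" by measurable
  define N where "N = sqrt (gradsq g)"
  define B where "B = (\<lambda>n. C powr (real n - 2) * real n powr ((real n - 2) / 2) * N powr real n)"
  \<comment> \<open>The embedding starts at p = 3; lower moments are dominated through |t|^n <= 1 +
    |t|^3.\<close>
  define c where "c = (\<lambda>n. if n < 3 then measure sigma UNIV + B 3 else B n)"
  have B0: "B n \<ge> 0" for n by (simp add: B_def)
  have c0: "c n \<ge> 0" for n by (simp add: c_def B0)
  have Bn: "(\<integral>\<^sup>+x. ennreal (\<bar>t x\<bar> ^ n) \<partial>sigma) \<le> ennreal (B n)" if "n \<ge> 3" for n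
  proof -
    have "\<bar>t x\<bar> powr real n = \<bar>t x\<bar> ^ n" for x
      using that by (cases "t x = 0") (auto simp: powr_realpow)
    then show ?thesis
      using V_data_embedding[OF u, of "real n"] that by (simp add: B_def N_def)
  qed
  have cn: "(\<integral>\<^sup>+x. ennreal (\<bar>t x\<bar> ^ n) \<partial>sigma) \<le> ennreal (c n)" for n
  proof (cases "n < 3")
    case True
    have "\<bar>t x\<bar> ^ n \<le> 1 + \<bar>t x\<bar> ^ 3" for x
    proof (cases "\<bar>t x\<bar> \<le> 1")
      case True
      then have "\<bar>t x\<bar> ^ n \<le> 1" by (intro power_le_one) auto
      then show ?thesis by (simp add: add_increasing2)
    next
      case False
      then have "\<bar>t x\<bar> ^ n \<le> \<bar>t x\<bar> ^ 3" using \<open>n < 3\<close> by (intro power_increasing) auto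
      then show ?thesis by simp
    qed
    then have "(\<integral>\<^sup>+x. ennreal (\<bar>t x\<bar> ^ n) \<partial>sigma) \<le> (\<integral>\<^sup>+x. 1 + ennreal (\<bar>t x\<bar> ^ 3) \<partial>sigma)"
      by (intro nn_integral_mono) (simp add: ennreal_leI flip: ennreal_1 ennreal_plus)
    also have "\<dots> = emeasure sigma UNIV + (\<integral>\<^sup>+x. ennreal (\<bar>t x\<bar> ^ 3) \<partial>sigma)"
      by (simp add: nn_integral_add)
    also have "\<dots> \<le> ennreal (measure sigma UNIV) + ennreal (B 3)"
      using Bn[of 3] by (intro add_mono) (simp_all add: sigma.emeasure_eq_measure)
    finally show ?thesis using True by (simp add: c_def B0 ennreal_plus)
  qed (use Bn in \<open>auto simp: c_def\<close>)
  have "(\<integral>\<^sup>+x. ennreal (norm (exp (l * \<bar>t x\<bar>))) \<partial>sigma)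
      = (\<integral>\<^sup>+x. (\<Sum>n. ennreal (l ^ n / fact n) * ennreal (\<bar>t x\<bar> ^ n)) \<partial>sigma)"
  proof (rule nn_integral_cong)
    fix x
    have s: "(\<lambda>n. l ^ n / fact n * \<bar>t x\<bar> ^ n) sums exp (l * \<bar>t x\<bar>)"
      using exp_converges[of "l * \<bar>t x\<bar>"] by (simp add: power_mult_distrib divide_inverse mult_ac)
    have "(\<Sum>n. ennreal (l ^ n / fact n * \<bar>t x\<bar> ^ n)) = ennreal (exp (l * \<bar>t x\<bar>))"
      using s l by (subst suminf_ennreal2) (auto simp: sums_iff)
    then show "ennreal (norm (exp (l * \<bar>t x\<bar>))) = (\<Sum>n. ennreal (l ^ n / fact n) * ennreal (\<bar>t x\<bar> ^ n))"
      using l by (simp add: ennreal_mult[symmetric])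
  qed
  also have "\<dots> = (\<Sum>n. ennreal (l ^ n / fact n) * (\<integral>\<^sup>+x. ennreal (\<bar>t x\<bar> ^ n) \<partial>sigma))"
    by (subst nn_integral_suminf) (auto simp: nn_integral_cmult)
  also have "\<dots> \<le> (\<Sum>n. ennreal (l ^ n / fact n * c n))"
  proof (intro suminf_le allI)
    fix n
    have "ennreal (l ^ n / fact n) * (\<integral>\<^sup>+x. ennreal (\<bar>t x\<bar> ^ n) \<partial>sigma)
        \<le> ennreal (l ^ n / fact n) * ennreal (c n)"
      by (intro mult_left_mono cn) simp
    then show "ennreal (l ^ n / fact n) * (\<integral>\<^sup>+x. ennreal (\<bar>t x\<bar> ^ n) \<partial>sigma)
        \<le> ennreal (l ^ n / fact n * c n)"
      using l c0[of n] by (subst ennreal_mult) auto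
  qed auto
  also have "\<dots> < \<infinity>"
  proof -
    have "summable (\<lambda>n. l ^ n / fact n * B n)"
      unfolding B_def using C gradsq_nonneg[of g] l by (intro summable_embedding_constants) (auto simp: N_def)
    moreover have "\<forall>\<^sub>F n in sequentially. l ^ n / fact n * c n = l ^ n / fact n * B n"
      by (intro eventually_sequentiallyI[of 3]) (simp add: c_def)
    ultimately have "summable (\<lambda>n. l ^ n / fact n * c n)"
      by (rule summable_cong[THEN iffD2, rotated])
    then show ?thesis using l c0 by (subst suminf_ennreal2) auto
  qed
  finally show "(\<integral>\<^sup>+x. ennreal (norm (exp (l * \<bar>t x\<bar>))) \<partial>sigma) < \<infinity>" .
qed

end

section \<open>The energy functional\<close>

text \<open>From exp h - 1 <= h exp h the remainder is at most h (exp h - 1), and |exp h - 1| <= |h|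
  exp |h|. The estimate holds for all h, so it can be integrated over unbounded traces.\<close>

lemma exp_le_quadratic: "exp h \<le> 1 + h + h\<^sup>2 * exp \<bar>h\<bar>" for h :: real
proof -
  have *: "exp x - 1 \<le> x * exp x" for x :: real
    using mult_left_mono[OF exp_ge_add_one_self[of "-x"], of "exp x"]
    by (simp add: exp_minus algebra_simps)
  have "\<bar>exp h - 1\<bar> \<le> \<bar>h\<bar> * exp \<bar>h\<bar>"
  proof (cases "h \<ge> 0")
    case True
    then show ?thesis using *[of h] by simp
  next
    case False
    then have 1: "exp h \<le> 1" by simp
    have "1 - exp h \<le> \<bar>h\<bar> * 1" using exp_ge_add_one_self[of h] by linarith
    also have "\<bar>h\<bar> * 1 \<le> \<bar>h\<bar> * exp \<bar>h\<bar>" by (intro mult_left_mono) auto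
    finally show ?thesis using 1 by simp
  qed
  then have "\<bar>h\<bar> * \<bar>exp h - 1\<bar> \<le> \<bar>h\<bar> * (\<bar>h\<bar> * exp \<bar>h\<bar>)"
    by (intro mult_left_mono) auto
  then have "h * (exp h - 1) \<le> h\<^sup>2 * exp \<bar>h\<bar>"
  proof -
    have "h * (exp h - 1) \<le> \<bar>h\<bar> * \<bar>exp h - 1\<bar>"
      using abs_ge_self[of "h * (exp h - 1)"] by (simp add: abs_mult)
    also have "\<dots> \<le> \<bar>h\<bar> * (\<bar>h\<bar> * exp \<bar>h\<bar>)" by fact
    also have "\<dots> = \<bar>h\<bar>\<^sup>2 * exp \<bar>h\<bar>" by (simp only: power2_eq_square mult.assoc)
    finally show ?thesis by simp
  qed
  then show ?thesis using *[of h] by (simp add: algebra_simps)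
qed

lemma exp_midpoint_le: "exp ((x + y) / 2) \<le> (exp x + exp y) / 2" for x y :: real
proof -
  have "exp x = (exp (x/2))\<^sup>2" "exp y = (exp (y/2))\<^sup>2" "exp ((x + y) / 2) = exp (x/2) * exp (y/2)"
    by (simp_all add: add_divide_distrib exp_add flip: exp_double)
  then show ?thesis
    using zero_le_power2[of "exp (x/2) - exp (y/2)"] by (simp add: power2_eq_square algebra_simps)
qed

definition F_bv :: "real \<Rightarrow> real \<Rightarrow> real" where
  "F_bv \<alpha> r = exp (\<alpha> * r) - exp (- (1 - \<alpha>) * r)"

text \<open>The primitive of \<open>F_bv\<close> with no additive constant: both terms are positive
  for 0 < \<alpha> < 1, as Fatou's lemma requires.\<close>

definition G_bv :: "real \<Rightarrow> real \<Rightarrow> real" where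
  "G_bv \<alpha> r = exp (\<alpha> * r) / \<alpha> + exp (- (1 - \<alpha>) * r) / (1 - \<alpha>)"

lemma f_alpha_mult: "f_alpha \<alpha> r * r = F_bv \<alpha> r"
  by (simp add: f_alpha_def F_bv_def)

context
  fixes \<alpha> :: real
  assumes \<alpha>: "0 < \<alpha>" "\<alpha> < 1"
begin

lemma exp_bounds: "exp (\<alpha> * r) \<le> exp \<bar>r\<bar>" "exp (- (1 - \<alpha>) * r) \<le> exp \<bar>r\<bar>"
proof -
  have "\<bar>\<alpha> * r\<bar> \<le> \<bar>r\<bar>" "\<bar>(1 - \<alpha>) * r\<bar> \<le> \<bar>r\<bar>"
    using \<alpha> by (auto simp: abs_mult intro!: mult_left_le_one_le)
  then show "exp (\<alpha> * r) \<le> exp \<bar>r\<bar>" "exp (- (1 - \<alpha>) * r) \<le> exp \<bar>r\<bar>"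
    by (simp_all add: abs_le_iff algebra_simps)
qed

lemma F_bv_abs_le: "\<bar>F_bv \<alpha> r\<bar> \<le> exp \<bar>r\<bar>"
  using exp_bounds[of r] exp_gt_zero[of "\<alpha> * r"] exp_gt_zero[of "- (1 - \<alpha>) * r"]
  unfolding F_bv_def by linarith

lemma F_bv_mono: "(F_bv \<alpha> r - F_bv \<alpha> s) * (r - s) \<ge> 0"
proof -
  have "F_bv \<alpha> x \<le> F_bv \<alpha> y" if "x \<le> y" for x y
    unfolding F_bv_def using \<alpha> that by (intro diff_mono) (auto simp: mult_left_mono)
  then show ?thesis
    by (cases "r \<le> s") (auto simp: zero_le_mult_iff)
qed

lemma G_bv_nonneg: "G_bv \<alpha> r \<ge> 0"
  using \<alpha> by (simp add: G_bv_def)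

lemma G_bv_le: "G_bv \<alpha> r \<le> (1 / \<alpha> + 1 / (1 - \<alpha>)) * exp \<bar>r\<bar>"
  using exp_bounds[of r] \<alpha> unfolding G_bv_def
  by (simp add: distrib_right) (intro add_mono divide_right_mono; simp)

lemma G_bv_midpoint: "G_bv \<alpha> (1/2 * r + 1/2 * s) \<le> (G_bv \<alpha> r + G_bv \<alpha> s) / 2"
proof -
  have 1: "exp (\<alpha> * (1/2 * r + 1/2 * s)) / \<alpha> \<le> (exp (\<alpha> * r) + exp (\<alpha> * s)) / 2 / \<alpha>"
    using exp_midpoint_le[of "\<alpha> * r" "\<alpha> * s"] \<alpha>
    by (intro divide_right_mono) (simp_all add: algebra_simps add_divide_distrib)
  have 2: "exp (- (1 - \<alpha>) * (1/2 * r + 1/2 * s)) / (1 - \<alpha>)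
      \<le> (exp (- (1 - \<alpha>) * r) + exp (- (1 - \<alpha>) * s)) / 2 / (1 - \<alpha>)"
  proof (intro divide_right_mono)
    have "- (1 - \<alpha>) * (1/2 * r + 1/2 * s) = (- (1 - \<alpha>) * r + - (1 - \<alpha>) * s) / 2"
      by (simp add: field_simps)
    then show "exp (- (1 - \<alpha>) * (1/2 * r + 1/2 * s)) \<le> (exp (- (1 - \<alpha>) * r) + exp (- (1 - \<alpha>) * s)) / 2"
      using exp_midpoint_le[of "- (1 - \<alpha>) * r" "- (1 - \<alpha>) * s"] by (simp only:)
  qed (use \<alpha> in simp)
  show ?thesis
    using add_mono[OF 1 2] unfolding G_bv_def by (simp only: add_divide_distrib) (simp add: mult.commute)
qed

text \<open>\<open>exp_le_quadratic\<close> is applied to the exponentials with rates b = \<alpha>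
  and b = - (1 - \<alpha>). Both rates have modulus at most 1, so one exponential weight dominates
  both remainders.\<close>

lemma G_bv_quadratic:
  assumes e: "\<bar>e\<bar> \<le> 1"
  shows "G_bv \<alpha> (t + e * s) \<le> G_bv \<alpha> t + e * (F_bv \<alpha> t * s) + e\<^sup>2 * (s\<^sup>2 * exp (\<bar>t\<bar> + \<bar>s\<bar>))"
proof -
  have es: "\<bar>e * s\<bar> \<le> \<bar>s\<bar>"
    using e by (simp add: abs_mult mult_left_le_one_le)
  have B: "exp (b * (t + e * s)) \<le> exp (b * t) + b * e * s * exp (b * t) + b\<^sup>2 * (e\<^sup>2 * (s\<^sup>2 * exp (\<bar>t\<bar> + \<bar>s\<bar>)))"
    if b: "\<bar>b\<bar> \<le> 1" for b
  proof -
    let ?h = "b * (e * s)"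
    have bt: "b * t \<le> \<bar>t\<bar>"
      using mult_left_le_one_le[of "\<bar>t\<bar>" "\<bar>b\<bar>"] b by (simp add: abs_le_iff flip: abs_mult)
    have bh: "\<bar>?h\<bar> \<le> \<bar>s\<bar>"
      using mult_left_le_one_le[of "\<bar>e * s\<bar>" "\<bar>b\<bar>"] b es by (simp flip: abs_mult)
    have "exp (b * (t + e * s)) = exp (b * t) * exp ?h"
      by (simp add: distrib_left exp_add)
    also have "\<dots> \<le> exp (b * t) * (1 + ?h + ?h\<^sup>2 * exp \<bar>?h\<bar>)"
      by (intro mult_left_mono exp_le_quadratic) simp
    also have "\<dots> = exp (b * t) + b * e * s * exp (b * t) + ?h\<^sup>2 * exp (b * t + \<bar>?h\<bar>)"
      by (simp add: distrib_left exp_add mult_ac)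
    also have "?h\<^sup>2 * exp (b * t + \<bar>?h\<bar>) \<le> ?h\<^sup>2 * exp (\<bar>t\<bar> + \<bar>s\<bar>)"
      using bt bh by (intro mult_left_mono) auto
    also have "?h\<^sup>2 * exp (\<bar>t\<bar> + \<bar>s\<bar>) = b\<^sup>2 * (e\<^sup>2 * (s\<^sup>2 * exp (\<bar>t\<bar> + \<bar>s\<bar>)))"
      by (simp add: power_mult_distrib)
    finally show ?thesis by simp
  qed
  define R where "R = e\<^sup>2 * (s\<^sup>2 * exp (\<bar>t\<bar> + \<bar>s\<bar>))"
  define c where "c = 1 - \<alpha>"
  have c: "0 < c" "c < 1" "\<alpha> + c = 1" using \<alpha> by (auto simp: c_def)
  have 1: "exp (\<alpha> * (t + e * s)) / \<alpha> \<le> (exp (\<alpha> * t) + \<alpha> * e * s * exp (\<alpha> * t) + \<alpha>\<^sup>2 * R) / \<alpha>"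
    unfolding R_def using \<alpha> by (intro divide_right_mono B) auto
  have 2: "exp (- c * (t + e * s)) / c \<le> (exp (- c * t) + - c * e * s * exp (- c * t) + (- c)\<^sup>2 * R) / c"
    unfolding R_def using c by (intro divide_right_mono B) auto
  have 3: "(x + \<alpha> * e * s * x + \<alpha>\<^sup>2 * R) / \<alpha> = x / \<alpha> + e * s * x + \<alpha> * R" for x
    using \<alpha> by (simp add: field_simps power2_eq_square)
  have 4: "(x + - c * e * s * x + (- c)\<^sup>2 * R) / c = x / c - e * s * x + c * R" for x
    using c by (simp add: field_simps power2_eq_square)
  \<comment> \<open>Each remainder carries b^2 divided by |b|, that is \<alpha> or 1 - \<alpha>, so
    together they give exactly one R.\<close>
  have "\<alpha> * R + c * R = R"
    using c(3) by (simp flip: distrib_right)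
  then show ?thesis
    using add_mono[OF 1 2] unfolding 3 4 G_bv_def F_bv_def R_def[symmetric] c_def[symmetric]
    by (simp add: algebra_simps)
qed

end

text \<open>Stands in for the derivative test at a minimum: an upper bound of the energy by a
  quadratic polynomial in the step is enough.\<close>

lemma linear_coeff_zero_if_nonneg:
  fixes L Q :: real
  assumes "\<And>e. \<bar>e\<bar> \<le> 1 \<Longrightarrow> 0 \<le> e * L + e\<^sup>2 * Q" "Q \<ge> 0"
  shows "L = 0"
proof (rule ccontr)
  assume L: "L \<noteq> 0"
  \<comment> \<open>The step -L/d has modulus at most 1, and d > Q makes the value (L/d)^2 (Q - d)
    negative.\<close>
  define d where "d = \<bar>L\<bar> + Q + 1"
  have d: "d > 0" "\<bar>L\<bar> \<le> d" "Q < d" using assms(2) by (auto simp: d_def)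
  have "0 \<le> (- L / d) * L + (- L / d)\<^sup>2 * Q"
    by (rule assms(1)) (use d in simp)
  also have "\<dots> = (L / d)\<^sup>2 * (Q - d)"
    using d by (simp add: power2_eq_square field_simps)
  also have "\<dots> < 0"
    using d L by (intro mult_pos_neg) auto
  finally show False by simp
qed

text \<open>All boundary integrals are taken over the whole circle: \<open>rho\<close> will be the
  Robin coefficient extended by 0 off \<open>GR\<close>, and h the sum of the Neumann and Robin
  data, each extended by 0.\<close>

locale robin_problem = trace_embedding +
  fixes \<alpha> K :: real and rho h :: "complex \<Rightarrow> real"
  assumes \<alpha>: "0 < \<alpha>" "\<alpha> < 1"
    and rho_measurable: "rho \<in> borel_measurable borel"
    and rho: "\<And>x. 0 \<le> rho x" "\<And>x. rho x \<le> K"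
    and h: "L2 sigma h"
begin

section \<open>Integrability of the boundary terms\<close>

lemma rho_sigma [measurable]: "rho \<in> borel_measurable sigma"
  using rho_measurable by (simp add: measurable_sigma)

lemma F_bv_measurable [measurable]: "F_bv \<alpha> \<in> borel_measurable borel"
  and G_bv_measurable [measurable]: "G_bv \<alpha> \<in> borel_measurable borel"
  unfolding F_bv_def[abs_def] G_bv_def[abs_def] by measurable

lemma integrable_rho:
  assumes i: "integrable sigma w" and b [measurable]: "f \<in> borel_measurable sigma" and le: "\<And>x. \<bar>f x\<bar> \<le> w x"
  shows "integrable sigma (\<lambda>x. rho x * f x)"
proof (rule Bochner_Integration.integrable_bound)
  show "integrable sigma (\<lambda>x. K * w x)" using i by simp
  show "(\<lambda>x. rho x * f x) \<in> borel_measurable sigma" by measurable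
  show "AE x in sigma. norm (rho x * f x) \<le> norm (K * w x)"
  proof (rule AE_I2)
    fix x
    have "rho x * \<bar>f x\<bar> \<le> K * w x"
      using rho[of x] le[of x] by (intro mult_mono) auto
    then show "norm (rho x * f x) \<le> norm (K * w x)"
      using rho(1)[of x] abs_ge_self[of "K * w x"] by (simp add: abs_mult)
  qed
qed

lemma integrable_rho_G:
  assumes u: "V_data GD u g t"
  shows "integrable sigma (\<lambda>x. rho x * G_bv \<alpha> (t x))"
proof (rule integrable_rho)
  note [measurable] = V_data_measurable(3)[OF u]
  show "integrable sigma (\<lambda>x. (1 / \<alpha> + 1 / (1 - \<alpha>)) * exp (1 * \<bar>t x\<bar>))"
    using V_data_exp_integrable[OF u, of 1] by simp
  show "(\<lambda>x. G_bv \<alpha> (t x)) \<in> borel_measurable sigma" by measurable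
  show "\<bar>G_bv \<alpha> (t x)\<bar> \<le> (1 / \<alpha> + 1 / (1 - \<alpha>)) * exp (1 * \<bar>t x\<bar>)" for x
    using G_bv_le[OF \<alpha>, of "t x"] G_bv_nonneg[OF \<alpha>, of "t x"] by simp
qed

lemma abs_power_le_exp: "\<bar>s\<bar> \<le> exp \<bar>s\<bar>" "s\<^sup>2 \<le> exp (2 * \<bar>s\<bar>)" for s :: real
proof -
  show 1: "\<bar>s\<bar> \<le> exp \<bar>s\<bar>" using exp_ge_add_one_self[of "\<bar>s\<bar>"] by linarith
  have "\<bar>s\<bar>\<^sup>2 \<le> (exp \<bar>s\<bar>)\<^sup>2" by (intro power_mono 1) simp
  then show "s\<^sup>2 \<le> exp (2 * \<bar>s\<bar>)" by (simp flip: exp_double)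
qed

text \<open>Separates a product of exponentials of two different traces into exponentials of one
  trace each, which \<open>V_data_exp_integrable\<close> covers.\<close>

lemma exp_add_le: "exp (a + b) \<le> exp (2 * a) + exp (2 * b)" for a b :: real
proof -
  have "exp (a + b) \<le> (exp (2 * a) + exp (2 * b)) / 2"
    using exp_midpoint_le[of "2 * a" "2 * b"] by (simp add: add_divide_distrib)
  also have "\<dots> \<le> exp (2 * a) + exp (2 * b)"
    using exp_gt_zero[of "2 * a"] exp_gt_zero[of "2 * b"] by simp
  finally show ?thesis .
qed

lemma integrable_rho_F:
  assumes u: "V_data GD u g t" and v: "V_data GD v k s"
  shows "integrable sigma (\<lambda>x. rho x * (F_bv \<alpha> (t x) * s x))"
proof (rule integrable_rho)
  note [measurable] = V_data_measurable(3)[OF u] V_data_measurable(3)[OF v]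
  show "integrable sigma (\<lambda>x. exp (2 * \<bar>t x\<bar>) + exp (2 * \<bar>s x\<bar>))"
    using V_data_exp_integrable[OF u] V_data_exp_integrable[OF v] by simp
  show "(\<lambda>x. F_bv \<alpha> (t x) * s x) \<in> borel_measurable sigma" by measurable
  show "\<bar>F_bv \<alpha> (t x) * s x\<bar> \<le> exp (2 * \<bar>t x\<bar>) + exp (2 * \<bar>s x\<bar>)" for x
  proof -
    have "\<bar>F_bv \<alpha> (t x) * s x\<bar> \<le> exp \<bar>t x\<bar> * exp \<bar>s x\<bar>"
      unfolding abs_mult using F_bv_abs_le[OF \<alpha>] abs_power_le_exp(1) by (intro mult_mono) auto
    also have "\<dots> \<le> exp (2 * \<bar>t x\<bar>) + exp (2 * \<bar>s x\<bar>)"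
      using exp_add_le[of "\<bar>t x\<bar>" "\<bar>s x\<bar>"] by (simp add: exp_add)
    finally show ?thesis .
  qed
qed

lemma integrable_rho_remainder:
  assumes u: "V_data GD u g t" and v: "V_data GD v k s"
  shows "integrable sigma (\<lambda>x. rho x * ((s x)\<^sup>2 * exp (\<bar>t x\<bar> + \<bar>s x\<bar>)))"
proof (rule integrable_rho)
  note [measurable] = V_data_measurable(3)[OF u] V_data_measurable(3)[OF v]
  \<comment> \<open>The rate 6 arises from s^2 <= exp (2 |s|), which makes the exponent |t| + 3 |s|,
    and from the doubling in \<open>exp_add_le\<close>.\<close>
  show "integrable sigma (\<lambda>x. exp (2 * \<bar>t x\<bar>) + exp (6 * \<bar>s x\<bar>))"
    using V_data_exp_integrable[OF u] V_data_exp_integrable[OF v] by simp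
  show "(\<lambda>x. (s x)\<^sup>2 * exp (\<bar>t x\<bar> + \<bar>s x\<bar>)) \<in> borel_measurable sigma" by measurable
  show "\<bar>(s x)\<^sup>2 * exp (\<bar>t x\<bar> + \<bar>s x\<bar>)\<bar> \<le> exp (2 * \<bar>t x\<bar>) + exp (6 * \<bar>s x\<bar>)" for x
  proof -
    have "(s x)\<^sup>2 * exp (\<bar>t x\<bar> + \<bar>s x\<bar>) \<le> exp (2 * \<bar>s x\<bar>) * exp (\<bar>t x\<bar> + \<bar>s x\<bar>)"
      by (intro mult_right_mono abs_power_le_exp) simp
    also have "\<dots> = exp (\<bar>t x\<bar> + 3 * \<bar>s x\<bar>)" by (simp flip: exp_add)
    also have "\<dots> \<le> exp (2 * \<bar>t x\<bar>) + exp (2 * (3 * \<bar>s x\<bar>))"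
      by (rule exp_add_le)
    finally show ?thesis by simp
  qed
qed

text \<open>Taken as a function of gradient and trace, so that it is insensitive to the Hilbert
  choices made for u.\<close>

definition energy :: "(complex \<Rightarrow> complex) \<Rightarrow> (complex \<Rightarrow> real) \<Rightarrow> real" where
  "energy g t = gradsq g / 2 + (\<integral>x. rho x * G_bv \<alpha> (t x) \<partial>sigma) - (\<integral>x. h x * t x \<partial>sigma)"

definition h_normsq :: real where "h_normsq = (\<integral>x. (h x)\<^sup>2 \<partial>sigma)"

lemma integrable_h:
  assumes u: "V_data GD u g t"
  shows "integrable sigma (\<lambda>x. h x * t x)"
  using L2_integrable_inner[OF h V_data_L2_trace(1)[OF u]] by simp

text \<open>Cauchy-Schwarz and the arithmetic-geometric mean bound the linear term by (S + A)/2. Its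
  share A/2 cancels the Dirichlet term exactly and leaves -S/2.\<close>

lemma energy_bounded_below:
  assumes u: "V_data GD u g t"
  shows "energy g t \<ge> - (h_normsq * trace_const / 2)"
proof -
  define A where "A = gradsq g"
  define S where "S = h_normsq * trace_const"
  have A: "A \<ge> 0" by (simp add: A_def gradsq_nonneg)
  have S: "S \<ge> 0" by (simp add: S_def h_normsq_def trace_const_nonneg)
  have "(\<integral>x. h x * t x \<partial>sigma)\<^sup>2 \<le> h_normsq * (\<integral>x. (t x)\<^sup>2 \<partial>sigma)"
    using L2_Cauchy_Schwarz[OF h V_data_L2_trace(1)[OF u]] by (simp add: h_normsq_def)
  also have "\<dots> \<le> h_normsq * (trace_const * A)"
    unfolding A_def by (intro mult_left_mono V_data_L2_trace[OF u]) (simp add: h_normsq_def)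
  finally have "(\<integral>x. h x * t x \<partial>sigma)\<^sup>2 \<le> S * A" by (simp add: S_def mult.assoc)
  also have "S * A \<le> ((S + A) / 2)\<^sup>2"
    using zero_le_power2[of "S - A"] by (simp add: power2_eq_square field_simps)
  finally have "(\<integral>x. h x * t x \<partial>sigma) \<le> (S + A) / 2"
    by (rule power2_le_imp_le) (use A S in simp)
  moreover have "(\<integral>x. rho x * G_bv \<alpha> (t x) \<partial>sigma) \<ge> 0"
    by (intro integral_nonneg_AE AE_I2 mult_nonneg_nonneg rho G_bv_nonneg[OF \<alpha>])
  ultimately show ?thesis by (simp add: energy_def A_def S_def add_divide_distrib)
qed

text \<open>The parallelogram law gives a gain of a quarter of the squared gradient distance, halved
  by the factor in the energy; the G-term is midpoint convex and the linear term is exact.\<close>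

lemma energy_midpoint:
  assumes u: "V_data GD u g t" and v: "V_data GD v k s"
  shows "energy (\<lambda>x. (1/2) *\<^sub>R g x + (1/2) *\<^sub>R k x) (\<lambda>x. 1/2 * t x + 1/2 * s x)
    \<le> (energy g t + energy k s) / 2 - gradsq (\<lambda>x. g x - k x) / 8"
proof -
  note Lu = V_data_measurable(6)[OF u] and Lv = V_data_measurable(6)[OF v]
  have 1: "gradsq (\<lambda>x. (1/2) *\<^sub>R g x + (1/2) *\<^sub>R k x)
      = (gradsq g + gradsq k) / 2 - gradsq (\<lambda>x. g x - k x) / 4"
    using integral_norm_add_scaled[OF Lu Lv, of "1/2" "1/2"] integral_norm_add_scaled[OF Lu Lv, of 1 "-1"]
    by (simp add: gradsq_def power2_eq_square field_simps)
  have "(\<integral>x. rho x * G_bv \<alpha> (1/2 * t x + 1/2 * s x) \<partial>sigma)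
      \<le> (\<integral>x. (rho x * G_bv \<alpha> (t x) + rho x * G_bv \<alpha> (s x)) / 2 \<partial>sigma)"
  proof (rule integral_mono)
    show "integrable sigma (\<lambda>x. rho x * G_bv \<alpha> (1/2 * t x + 1/2 * s x))"
      by (rule integrable_rho_G[OF V_data_lin[OF u v]])
    show "integrable sigma (\<lambda>x. (rho x * G_bv \<alpha> (t x) + rho x * G_bv \<alpha> (s x)) / 2)"
      using integrable_rho_G[OF u] integrable_rho_G[OF v] by simp
    show "rho x * G_bv \<alpha> (1/2 * t x + 1/2 * s x) \<le> (rho x * G_bv \<alpha> (t x) + rho x * G_bv \<alpha> (s x)) / 2" for x
      using mult_left_mono[OF G_bv_midpoint[OF \<alpha>, of "t x" "s x"] rho(1)[of x]] by (simp add: algebra_simps)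
  qed
  also have "\<dots> = ((\<integral>x. rho x * G_bv \<alpha> (t x) \<partial>sigma) + (\<integral>x. rho x * G_bv \<alpha> (s x) \<partial>sigma)) / 2"
    using integrable_rho_G[OF u] integrable_rho_G[OF v] by simp
  finally have 2: "(\<integral>x. rho x * G_bv \<alpha> (1/2 * t x + 1/2 * s x) \<partial>sigma)
      \<le> ((\<integral>x. rho x * G_bv \<alpha> (t x) \<partial>sigma) + (\<integral>x. rho x * G_bv \<alpha> (s x) \<partial>sigma)) / 2" .
  have "h x * (1/2 * t x + 1/2 * s x) = (h x * t x + h x * s x) / 2" for x
    by (simp add: algebra_simps)
  then have "(\<integral>x. h x * (1/2 * t x + 1/2 * s x) \<partial>sigma) = (\<integral>x. (h x * t x + h x * s x) / 2 \<partial>sigma)"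
    by (simp only:)
  also have "\<dots> = ((\<integral>x. h x * t x \<partial>sigma) + (\<integral>x. h x * s x \<partial>sigma)) / 2"
    using integrable_h[OF u] integrable_h[OF v] by simp
  finally have 3: "(\<integral>x. h x * (1/2 * t x + 1/2 * s x) \<partial>sigma)
      = ((\<integral>x. h x * t x \<partial>sigma) + (\<integral>x. h x * s x \<partial>sigma)) / 2" .
  show ?thesis
    unfolding energy_def 1 3 using 2 by (simp add: field_simps)
qed

text \<open>The polynomial bound in the step e whose linear coefficient is the defect in the weak
  equation. The factors 1 are kept so that the arguments match \<open>V_data_lin\<close>
  literally.\<close>

lemma energy_perturbation:
  assumes u: "V_data GD u g t" and v: "V_data GD v k s" and e: "\<bar>e\<bar> \<le> 1"
  shows "energy (\<lambda>x. 1 *\<^sub>R g x + e *\<^sub>R k x) (\<lambda>x. 1 * t x + e * s x)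
    \<le> energy g t + e * ((\<integral>x. g x \<bullet> k x \<partial>lebO) + (\<integral>x. rho x * (F_bv \<alpha> (t x) * s x) \<partial>sigma)
         - (\<integral>x. h x * s x \<partial>sigma))
       + e\<^sup>2 * (gradsq k / 2 + (\<integral>x. rho x * ((s x)\<^sup>2 * exp (\<bar>t x\<bar> + \<bar>s x\<bar>)) \<partial>sigma))"
proof -
  note Lu = V_data_measurable(6)[OF u] and Lv = V_data_measurable(6)[OF v]
  have 1: "gradsq (\<lambda>x. 1 *\<^sub>R g x + e *\<^sub>R k x) = gradsq g + 2 * e * (\<integral>x. g x \<bullet> k x \<partial>lebO) + e\<^sup>2 * gradsq k"
    using integral_norm_add_scaled[OF Lu Lv, of 1 e] by (simp add: gradsq_def)
  note i = integrable_rho_G[OF u] integrable_rho_F[OF u v] integrable_rho_remainder[OF u v]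
  have "(\<integral>x. rho x * G_bv \<alpha> (1 * t x + e * s x) \<partial>sigma)
      \<le> (\<integral>x. rho x * G_bv \<alpha> (t x) + e * (rho x * (F_bv \<alpha> (t x) * s x))
          + e\<^sup>2 * (rho x * ((s x)\<^sup>2 * exp (\<bar>t x\<bar> + \<bar>s x\<bar>))) \<partial>sigma)"
  proof (rule integral_mono)
    show "integrable sigma (\<lambda>x. rho x * G_bv \<alpha> (1 * t x + e * s x))"
      by (rule integrable_rho_G[OF V_data_lin[OF u v]])
    show "integrable sigma (\<lambda>x. rho x * G_bv \<alpha> (t x) + e * (rho x * (F_bv \<alpha> (t x) * s x))
          + e\<^sup>2 * (rho x * ((s x)\<^sup>2 * exp (\<bar>t x\<bar> + \<bar>s x\<bar>))))"
      by (intro Bochner_Integration.integrable_add integrable_mult_right i)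
    fix x
    show "rho x * G_bv \<alpha> (1 * t x + e * s x) \<le> rho x * G_bv \<alpha> (t x) + e * (rho x * (F_bv \<alpha> (t x) * s x))
          + e\<^sup>2 * (rho x * ((s x)\<^sup>2 * exp (\<bar>t x\<bar> + \<bar>s x\<bar>)))"
      using mult_left_mono[OF G_bv_quadratic[OF \<alpha> e, of "t x" "s x"] rho(1)[of x]]
      by (simp add: distrib_left mult.left_commute)
  qed
  also have "\<dots> = (\<integral>x. rho x * G_bv \<alpha> (t x) \<partial>sigma) + e * (\<integral>x. rho x * (F_bv \<alpha> (t x) * s x) \<partial>sigma)
      + e\<^sup>2 * (\<integral>x. rho x * ((s x)\<^sup>2 * exp (\<bar>t x\<bar> + \<bar>s x\<bar>)) \<partial>sigma)"
    using i by (simp only: Bochner_Integration.integral_add Bochner_Integration.integrable_add integrable_mult_right integral_mult_right_zero)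
  finally have 2: "(\<integral>x. rho x * G_bv \<alpha> (1 * t x + e * s x) \<partial>sigma) \<le> \<dots>" .
  have 3: "(\<integral>x. h x * (1 * t x + e * s x) \<partial>sigma) = (\<integral>x. h x * t x \<partial>sigma) + e * (\<integral>x. h x * s x \<partial>sigma)"
    using integrable_h[OF u] integrable_h[OF v] by (simp add: distrib_left mult.left_commute)
  show ?thesis
    unfolding energy_def 1 3 using 2 by (simp add: field_simps)
qed

lemma minimiser_weak_form:
  assumes u: "V_data GD u g t" and v: "V_data GD v k s"
    and min: "\<And>u' g' t'. V_data GD u' g' t' \<Longrightarrow> energy g t \<le> energy g' t'"
  shows "(\<integral>x. g x \<bullet> k x \<partial>lebO) + (\<integral>x. rho x * (F_bv \<alpha> (t x) * s x) \<partial>sigma) = (\<integral>x. h x * s x \<partial>sigma)"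
proof -
  define L where "L = (\<integral>x. g x \<bullet> k x \<partial>lebO) + (\<integral>x. rho x * (F_bv \<alpha> (t x) * s x) \<partial>sigma) - (\<integral>x. h x * s x \<partial>sigma)"
  define Q where "Q = gradsq k / 2 + (\<integral>x. rho x * ((s x)\<^sup>2 * exp (\<bar>t x\<bar> + \<bar>s x\<bar>)) \<partial>sigma)"
  have "L = 0"
  proof (rule linear_coeff_zero_if_nonneg)
    show "0 \<le> e * L + e\<^sup>2 * Q" if "\<bar>e\<bar> \<le> 1" for e
      using energy_perturbation[OF u v that] min[OF V_data_lin[OF u v, of 1 e]]
      unfolding L_def Q_def by linarith
    show "Q \<ge> 0"
      unfolding Q_def using rho(1)
      by (intro add_nonneg_nonneg integral_nonneg_AE AE_I2) (auto simp: gradsq_nonneg)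
  qed
  then show ?thesis by (simp add: L_def)
qed

end

section \<open>Existence and uniqueness\<close>

lemma sqd_tendsto_zero_fast:
  assumes "\<And>n. sqd M (f n) g \<le> ennreal (K * (1/4) ^ n)"
  shows "(\<lambda>n. sqd M (f n) g) \<longlonglongrightarrow> 0"
proof (rule tendsto_sandwich[OF _ _ tendsto_const])
  have "(\<lambda>n. ennreal (K * (1/4) ^ n)) \<longlonglongrightarrow> ennreal (K * 0)"
    by (intro tendsto_ennrealI tendsto_intros LIMSEQ_power_zero) simp
  then show "(\<lambda>n. ennreal (K * (1/4) ^ n)) \<longlonglongrightarrow> 0" by simp
qed (use assms in auto)

context robin_problem
begin

lemma V_data_diff:
  assumes u: "V_data GD u g t" and v: "V_data GD v k s"
  shows "V_data GD (\<lambda>x. u x - v x) (\<lambda>x. g x - k x) (\<lambda>x. t x - s x)"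
  using V_data_lin[OF u v, of 1 "-1"] by simp

text \<open>Only the gradients are assumed Cauchy. Their rate passes to the traces by
  \<open>trace_const\<close> and then to the functions by the Friedrichs inequality, and all three
  limits assemble into one element of V.\<close>

lemma V_data_complete:
  assumes d: "\<And>n. V_data GD (us n) (gs n) (ts n)"
    and c: "\<And>n m. n \<le> m \<Longrightarrow> gradsq (\<lambda>x. gs n x - gs m x) \<le> 8 * (1/4) ^ n"
  obtains u g t where "V_data GD u g t" "(\<lambda>n. sqd lebO (gs n) g) \<longlonglongrightarrow> 0"
    "(\<lambda>n. sqd sigma (ts n) t) \<longlonglongrightarrow> 0" "AE x in sigma. (\<lambda>n. ts n x) \<longlonglongrightarrow> t x"
proof -
  note m = V_data_measurable[OF d]
  have G: "sqd lebO (gs n) (gs m) \<le> ennreal (8 * (1/4) ^ n)" if "n \<le> m" for n m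
    using c[OF that] sqd_eq_integral[OF m(6)[of n] m(6)[of m]] by (simp add: gradsq_def ennreal_leI)
  define K1 where "K1 = trace_const * 8"
  have T: "sqd sigma (ts n) (ts m) \<le> ennreal (K1 * (1/4) ^ n)" if "n \<le> m" for n m
  proof -
    have "sqd sigma (ts n) (ts m) = ennreal (\<integral>x. (ts n x - ts m x)\<^sup>2 \<partial>sigma)"
      using sqd_eq_integral[OF V_data_L2_trace(1)[OF d[of n]] V_data_L2_trace(1)[OF d[of m]]] by simp
    also have "\<dots> \<le> ennreal (trace_const * gradsq (\<lambda>x. gs n x - gs m x))"
      by (intro ennreal_leI V_data_L2_trace(2)[OF V_data_diff[OF d d]])
    also have "\<dots> \<le> ennreal (K1 * (1/4) ^ n)"
      using mult_left_mono[OF c[OF that] trace_const_nonneg] by (intro ennreal_leI) (simp add: K1_def)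
    finally show ?thesis .
  qed
  \<comment> \<open>The Friedrichs constants 8 and 16 applied to the trace rate K1 and the gradient
    rate 8.\<close>
  define K2 where "K2 = 8 * K1 + 16 * 8"
  have U: "sqd lebO (us n) (us m) \<le> ennreal (K2 * (1/4) ^ n)" if "n \<le> m" for n m
  proof -
    have K10: "K1 \<ge> 0" using trace_const_nonneg by (simp add: K1_def)
    note D = V_data_diff[OF d[of n] d[of m]]
    have "sqd lebO (us n) (us m) = sqd lebO (\<lambda>x. us n x - us m x) (\<lambda>_. 0)"
      by (simp add: sqd_def)
    also have "\<dots> \<le> 8 * sqd sigma (\<lambda>x. ts n x - ts m x) (\<lambda>_. 0) + 16 * sqd lebO (\<lambda>x. gs n x - gs m x) (\<lambda>_. 0)"
      using D V_data_measurable[OF D] by (intro C1_approximable_Friedrichs) (auto simp: V_data_def)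
    also have "\<dots> = 8 * sqd sigma (ts n) (ts m) + 16 * sqd lebO (gs n) (gs m)"
      by (simp add: sqd_def)
    also have "\<dots> \<le> 8 * ennreal (K1 * (1/4) ^ n) + 16 * ennreal (8 * (1/4) ^ n)"
      by (intro add_mono mult_left_mono G T that) auto
    also have "\<dots> = ennreal (8 * (K1 * (1/4) ^ n) + 16 * (8 * (1/4) ^ n))"
      using K10 by (simp add: ennreal_plus ennreal_mult)
    also have "8 * (K1 * (1/4) ^ n) + 16 * (8 * (1/4) ^ n) = K2 * (1/4) ^ n"
      by (simp add: K2_def algebra_simps)
    finally show ?thesis .
  qed
  obtain g where g: "g \<in> borel_measurable lebO" "AE x in lebO. (\<lambda>n. gs n x) \<longlonglongrightarrow> g x"
      "\<And>n. sqd lebO (gs n) g \<le> ennreal (8 * (1/4) ^ n)"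
    using L2_complete_fast[of gs lebO 8, OF m(2) G] by blast
  obtain t where t: "t \<in> borel_measurable sigma" "AE x in sigma. (\<lambda>n. ts n x) \<longlonglongrightarrow> t x"
      "\<And>n. sqd sigma (ts n) t \<le> ennreal (K1 * (1/4) ^ n)"
    using L2_complete_fast[of ts sigma K1, OF m(3) T] by blast
  obtain u where u: "u \<in> borel_measurable lebO" "AE x in lebO. (\<lambda>n. us n x) \<longlonglongrightarrow> u x"
      "\<And>n. sqd lebO (us n) u \<le> ennreal (K2 * (1/4) ^ n)"
    using L2_complete_fast[of us lebO K2, OF m(1) U] by blast
  have lim: "L2 lebO f"
    if f: "f \<in> borel_measurable lebO" "f0 \<in> borel_measurable lebO" "L2 lebO f0" and b: "sqd lebO f0 f \<le> ennreal b"
    for f f0 :: "complex \<Rightarrow> 'b::{second_countable_topology, real_normed_vector}" and b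
  proof -
    have "sqd lebO f (\<lambda>_. 0) \<le> 2 * sqd lebO f f0 + 2 * sqd lebO f0 (\<lambda>_. 0)"
      by (intro sqd_triangle f) auto
    also have "\<dots> < \<infinity>"
      using b f(3) L2_iff_sqd[OF f(2)]
      by (auto simp: sqd_commute[of lebO f f0] ennreal_mult_less_top intro: le_less_trans)
    finally show ?thesis using L2_iff_sqd[OF f(1)] by simp
  qed
  have L: "L2 lebO u" "L2 lebO g"
    using lim[OF u(1) m(1,5) u(3)[of 0]] lim[OF g(1) m(2,6) g(3)[of 0]] by auto
  note l = sqd_tendsto_zero_fast[OF u(3)] sqd_tendsto_zero_fast[OF g(3)] sqd_tendsto_zero_fast[OF t(3)]
  have "V_data GD u g t"
    by (rule V_data_limit[OF d u(1) g(1) t(1) L l t(2)])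
  then show thesis using l t(2) that by blast
qed

text \<open>Gradients converge strongly and the linear term converges, so Fatou is applied to the
  nonlinear boundary integral alone.\<close>

lemma energy_lower_semicontinuous:
  assumes d: "\<And>n. V_data GD (us n) (gs n) (ts n)" and u: "V_data GD u g t"
    and l: "(\<lambda>n. sqd lebO (gs n) g) \<longlonglongrightarrow> 0" "(\<lambda>n. sqd sigma (ts n) t) \<longlonglongrightarrow> 0"
    and ae: "AE x in sigma. (\<lambda>n. ts n x) \<longlonglongrightarrow> t x"
    and e: "(\<lambda>n. energy (gs n) (ts n)) \<longlonglongrightarrow> m"
  shows "energy g t \<le> m"
proof -
  define b where "b = (\<lambda>t. \<integral>x. rho x * G_bv \<alpha> (t x) \<partial>sigma)"
  have a: "(\<lambda>n. gradsq (gs n)) \<longlonglongrightarrow> gradsq g"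
    unfolding gradsq_def by (intro L2_norm_tendsto V_data_measurable(6)[OF u] V_data_measurable(6)[OF d] l)
  have c: "(\<lambda>n. \<integral>x. h x * ts n x \<partial>sigma) \<longlonglongrightarrow> (\<integral>x. h x * t x \<partial>sigma)"
    using L2_inner_tendsto[OF h V_data_L2_trace(1)[OF u] V_data_L2_trace(1)[OF d] l(2)] by simp
  \<comment> \<open>The value that the boundary integrals must approach, obtained by solving the
    energy for them.\<close>
  define B where "B = m - gradsq g / 2 + (\<integral>x. h x * t x \<partial>sigma)"
  have "(\<lambda>n. energy (gs n) (ts n) - gradsq (gs n) / 2 + (\<integral>x. h x * ts n x \<partial>sigma)) \<longlonglongrightarrow> B"
    unfolding B_def by (intro tendsto_intros a c e) simp
  then have bB: "(\<lambda>n. b (ts n)) \<longlonglongrightarrow> B"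
    by (simp add: energy_def b_def)
  have pos: "0 \<le> rho x * G_bv \<alpha> r" for x r
    by (intro mult_nonneg_nonneg rho G_bv_nonneg[OF \<alpha>])
  have b0: "b s \<ge> 0" for s
    unfolding b_def by (intro integral_nonneg_AE AE_I2 pos)
  have B0: "B \<ge> 0" using bB b0 by (intro LIMSEQ_le_const) auto
  have nb: "(\<integral>\<^sup>+x. ennreal (rho x * G_bv \<alpha> (s x)) \<partial>sigma) = ennreal (b s)" if "V_data GD v k s" for v k s
    unfolding b_def using integrable_rho_G[OF that] pos by (intro nn_integral_eq_integral) auto
  have Gc: "isCont (G_bv \<alpha>) r" for r
    unfolding G_bv_def[abs_def] using \<alpha> by (intro continuous_intros) auto
  note [measurable] = V_data_measurable(3)[OF d] V_data_measurable(3)[OF u]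
  have "ennreal (b t) = (\<integral>\<^sup>+x. liminf (\<lambda>n. ennreal (rho x * G_bv \<alpha> (ts n x))) \<partial>sigma)"
    unfolding nb[OF u, symmetric]
  proof (rule nn_integral_cong_AE, use ae in eventually_elim)
    case (elim x)
    have "(\<lambda>n. ennreal (rho x * G_bv \<alpha> (ts n x))) \<longlonglongrightarrow> ennreal (rho x * G_bv \<alpha> (t x))"
      by (intro tendsto_ennrealI tendsto_mult tendsto_const isCont_tendsto_compose[OF Gc elim])
    then show ?case by (intro lim_imp_Liminf[symmetric]) simp_all
  qed
  also have "\<dots> \<le> liminf (\<lambda>n. \<integral>\<^sup>+x. ennreal (rho x * G_bv \<alpha> (ts n x)) \<partial>sigma)"
    by (rule nn_integral_liminf) measurable
  also have "\<dots> = liminf (\<lambda>n. ennreal (b (ts n)))"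
    by (simp add: nb[OF d])
  also have "\<dots> = ennreal B"
    by (intro lim_imp_Liminf tendsto_ennrealI bB) simp
  finally have "b t \<le> B" using B0 by simp
  then show ?thesis by (simp add: energy_def B_def b_def)
qed

lemma minimiser_exists:
  obtains u g t where "V_data GD u g t"
    "\<And>u' g' t'. V_data GD u' g' t' \<Longrightarrow> energy g t \<le> energy g' t'"
proof -
  define E where "E = {energy g t | u g t. V_data GD u g t}"
  have ne: "E \<noteq> {}" using V_data_zero[of GD] by (auto simp: E_def)
  have bd: "bdd_below E"
    unfolding E_def bdd_below_def using energy_bounded_below by blast
  define m where "m = Inf E"
  have m: "m \<le> energy g t" if "V_data GD u g t" for u g t
    unfolding m_def using that bd by (intro cInf_lower) (auto simp: E_def)
  have "\<exists>u g t. V_data GD u g t \<and> energy g t < m + (1/4) ^ n" for n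
  proof -
    have "\<exists>e\<in>E. e < m + (1/4) ^ n"
      using cInf_lessD[OF ne, of "m + (1/4) ^ n"] by (auto simp: m_def)
    then show ?thesis by (auto simp: E_def)
  qed
  then obtain us gs ts where d: "\<And>n. V_data GD (us n) (gs n) (ts n)"
    and e: "\<And>n. energy (gs n) (ts n) < m + (1/4) ^ n"
    by metis
  \<comment> \<open>Both energies are below m + 4^-n and the energy of the midpoint is at least m,
    so the gain of one eighth in \<open>energy_midpoint\<close> is at most 4^-n. This is the source
    of the constant 8.\<close>
  have "gradsq (\<lambda>x. gs n x - gs k x) \<le> 8 * (1/4) ^ n" if "n \<le> k" for n k
  proof -
    have "m \<le> (energy (gs n) (ts n) + energy (gs k) (ts k)) / 2 - gradsq (\<lambda>x. gs n x - gs k x) / 8"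
      using m[OF V_data_lin[OF d[of n] d[of k], of "1/2" "1/2"]] energy_midpoint[OF d[of n] d[of k]] by simp
    moreover have "(1/4::real) ^ k \<le> (1/4) ^ n"
      using that by (intro power_decreasing) auto
    moreover have "x \<le> 8 * a" if "m \<le> (p + q) / 2 - x / 8" "b \<le> a" "p < m + a" "q < m + b"
      for x a b p q :: real
    proof -
      have "8 * m \<le> 4 * p + 4 * q - x" using that(1) by (simp add: field_simps)
      then show ?thesis using that(2,3,4) by linarith
    qed
    ultimately show ?thesis using e by blast
  qed
  from V_data_complete[OF d this] obtain u g t where u: "V_data GD u g t"
    and l: "(\<lambda>n. sqd lebO (gs n) g) \<longlonglongrightarrow> 0" "(\<lambda>n. sqd sigma (ts n) t) \<longlonglongrightarrow> 0"
      "AE x in sigma. (\<lambda>n. ts n x) \<longlonglongrightarrow> t x"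
    by blast
  have "(\<lambda>n. energy (gs n) (ts n)) \<longlonglongrightarrow> m"
  proof (rule tendsto_sandwich)
    show "\<forall>\<^sub>F n in sequentially. m \<le> energy (gs n) (ts n)"
      using m[OF d] by simp
    show "\<forall>\<^sub>F n in sequentially. energy (gs n) (ts n) \<le> m + (1/4) ^ n"
      by (intro always_eventually allI less_imp_le e)
    show "(\<lambda>n. m + (1/4) ^ n) \<longlonglongrightarrow> m"
      using tendsto_add[OF tendsto_const LIMSEQ_power_zero[of "1/4::real"], of m] by simp
    show "(\<lambda>_. m) \<longlonglongrightarrow> m" by simp
  qed
  from energy_lower_semicontinuous[OF d u l this] have "energy g t \<le> m" .
  then have "energy g t \<le> energy g' t'" if "V_data GD u' g' t'" for u' g' t'
    using m[OF that] by linarith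
  with u show thesis by (rule that)
qed

text \<open>Monotonicity of \<open>F_bv\<close> gives the boundary term the sign that forces the
  gradients to agree; the trace bound and the Friedrichs inequality then make the functions
  agree.\<close>

lemma weak_form_unique:
  assumes u: "V_data GD u g t" and v: "V_data GD v k s"
    and wu: "\<And>w l r. V_data GD w l r \<Longrightarrow>
       (\<integral>x. g x \<bullet> l x \<partial>lebO) + (\<integral>x. rho x * (F_bv \<alpha> (t x) * r x) \<partial>sigma) = (\<integral>x. h x * r x \<partial>sigma)"
    and wv: "\<And>w l r. V_data GD w l r \<Longrightarrow>
       (\<integral>x. k x \<bullet> l x \<partial>lebO) + (\<integral>x. rho x * (F_bv \<alpha> (s x) * r x) \<partial>sigma) = (\<integral>x. h x * r x \<partial>sigma)"
  shows "AE x in lebO. u x = v x"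
proof -
  note D = V_data_diff[OF u v]
  note m = V_data_measurable[OF D]
  have "gradsq (\<lambda>x. g x - k x) = (\<integral>x. g x \<bullet> (g x - k x) - k x \<bullet> (g x - k x) \<partial>lebO)"
    by (simp add: gradsq_def power2_norm_eq_inner inner_diff_left)
  also have "\<dots> = (\<integral>x. g x \<bullet> (g x - k x) \<partial>lebO) - (\<integral>x. k x \<bullet> (g x - k x) \<partial>lebO)"
    using L2_integrable_inner[OF V_data_measurable(6)[OF u] m(6)] L2_integrable_inner[OF V_data_measurable(6)[OF v] m(6)]
    by (rule Bochner_Integration.integral_diff)
  also have "\<dots> = (\<integral>x. rho x * (F_bv \<alpha> (s x) * (t x - s x)) \<partial>sigma) - (\<integral>x. rho x * (F_bv \<alpha> (t x) * (t x - s x)) \<partial>sigma)"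
    using wu[OF D] wv[OF D] by linarith
  also have "\<dots> = (\<integral>x. rho x * (F_bv \<alpha> (s x) * (t x - s x)) - rho x * (F_bv \<alpha> (t x) * (t x - s x)) \<partial>sigma)"
    using integrable_rho_F[OF v D] integrable_rho_F[OF u D] by simp
  also have "\<dots> = (\<integral>x. - (rho x * ((F_bv \<alpha> (t x) - F_bv \<alpha> (s x)) * (t x - s x))) \<partial>sigma)"
    by (rule Bochner_Integration.integral_cong) (simp_all add: algebra_simps)
  also have "\<dots> = - (\<integral>x. rho x * ((F_bv \<alpha> (t x) - F_bv \<alpha> (s x)) * (t x - s x)) \<partial>sigma)"
    by (rule integral_minus)
  also have "\<dots> \<le> 0"
    unfolding neg_le_0_iff_le
    by (intro integral_nonneg_AE AE_I2 mult_nonneg_nonneg rho F_bv_mono[OF \<alpha>])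
  finally have g0: "gradsq (\<lambda>x. g x - k x) = 0" using gradsq_nonneg by (simp add: order_antisym)
  have t0: "(\<integral>x. (t x - s x)\<^sup>2 \<partial>sigma) = 0"
    using V_data_L2_trace(2)[OF D] g0 by (simp add: order_antisym)
  have z: "L2 lebO (\<lambda>_. 0 :: complex)" "L2 sigma (\<lambda>_. 0 :: real)" by (simp_all add: L2_def)
  have "sqd lebO (\<lambda>x. g x - k x) (\<lambda>_. 0) = 0" "sqd sigma (\<lambda>x. t x - s x) (\<lambda>_. 0) = 0"
    using sqd_eq_integral[OF m(6) z(1)] sqd_eq_integral[OF V_data_L2_trace(1)[OF D] z(2)] g0 t0
    by (simp_all add: gradsq_def)
  moreover have "sqd lebO (\<lambda>x. u x - v x) (\<lambda>_. 0) \<le> 8 * sqd sigma (\<lambda>x. t x - s x) (\<lambda>_. 0) + 16 * sqd lebO (\<lambda>x. g x - k x) (\<lambda>_. 0)"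
    using D m by (intro C1_approximable_Friedrichs) (auto simp: V_data_def)
  ultimately have "sqd lebO (\<lambda>x. u x - v x) (\<lambda>_. 0) = 0" by simp
  then show ?thesis
    using sqd_eq_0_iff[OF m(1)] by simp
qed

end

theorem mainTheorem1:
  fixes GD GN GR :: "complex set" and phi g rob :: "complex \<Rightarrow> real" and \<alpha> \<xi> C :: real
  assumes "openin (top_of_set Gamma) GD" "openin (top_of_set Gamma) GN" "openin (top_of_set Gamma) GR"
    and "GD \<inter> GN = {}" "GD \<inter> GR = {}" "GN \<inter> GR = {}"
    and "Gamma = closure GD \<union> closure GN \<union> closure GR"
    and "measure sigma GD > 0" "measure sigma GN > 0" "measure sigma GR > 0"
    and "L2_on GN phi" "\<not> (AE x in sigma. x \<in> GN \<longrightarrow> phi x = 0)"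
    and "L2_on GR g"
    and "0 < \<alpha>" "\<alpha> < 1"
    and "C > 0"
    and "\<forall>p::real. p \<ge> 3 \<longrightarrow> (\<forall>u\<in>V GD.
           (\<integral>\<^sup>+x. ennreal (\<bar>trace_of u x\<bar> powr p) \<partial>sigma)
             \<le> ennreal (C powr (p - 2) * p powr ((p - 2) / 2) * Vnorm u powr p))"
    and "0 < \<xi>" "\<xi> < 1"
    and "continuous_on (closure GR) rob"
    and "\<forall>x\<in>closure GR. 0 \<le> rob x \<and> rob x \<le> \<xi> * Lambda GD C (M0 GD GN GR phi g)"
  shows "(\<exists>u. weak_solution GD GN GR phi g rob \<alpha> u) \<and>
         (\<forall>v1 v2. weak_solution GD GN GR phi g rob \<alpha> v1 \<and> weak_solution GD GN GR phi g rob \<alpha> v2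
            \<and> Vnorm v1 \<le> M0 GD GN GR phi g \<and> Vnorm v2 \<le> M0 GD GN GR phi g
            \<longrightarrow> (AE x in lebesgue_on Omega. v1 x = v2 x))"
proof -
  have borel_if_openin: "A \<in> sets borel" if "openin (top_of_set Gamma) A" for A
    using that by (auto simp: openin_open Gamma_def)
  have [measurable]: "GN \<in> sets borel" "GR \<in> sets borel"
    using borel_if_openin assms(2,3) by auto
  note [measurable] = \<open>L2_on GN phi\<close>[unfolded L2_on_def, THEN conjunct1] \<open>L2_on GR g\<close>[unfolded L2_on_def, THEN conjunct1]
  \<comment> \<open>The absolute value makes K dominate \<open>rho\<close> also off
    \<open>GR\<close>, where \<open>rho\<close> is 0.\<close>
  define K where "K = \<bar>\<xi> * Lambda GD C (M0 GD GN GR phi g)\<bar>"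
  define rho where "rho = (\<lambda>x. indicator GR x * rob x)"
  define hN hR where "hN = (\<lambda>x. indicator GN x * phi x)" and "hR = (\<lambda>x. indicator GR x * g x)"
  define h where "h = (\<lambda>x. hN x + hR x)"
  have L2_indicator: "L2 sigma (\<lambda>x. indicator A x * f x)" if "L2_on A f" "A \<in> sets borel" for A f
  proof -
    have [measurable]: "f \<in> borel_measurable sigma" "A \<in> sets sigma"
      using that by (simp_all add: L2_on_def)
    have "(indicator A x * f x)\<^sup>2 = indicator A x * (f x)\<^sup>2" for x
      by (simp add: indicator_def)
    moreover have "(\<lambda>x. indicator A x * f x) \<in> borel_measurable sigma"
      by measurable
    ultimately show ?thesis
      using that by (simp add: L2_def L2_on_def set_integrable_def)
  qed
  have hNR: "L2 sigma hN" "L2 sigma hR"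
    unfolding hN_def hR_def using assms by (auto intro: L2_indicator)
  interpret robin_problem GD C \<alpha> K rho h
  proof
    show "rho \<in> borel_measurable borel"
      unfolding rho_def using borel_measurable_continuous_on_indicator[of GR rob]
        continuous_on_subset[OF \<open>continuous_on (closure GR) rob\<close> closure_subset] by simp
    show "0 \<le> rho x" "rho x \<le> K" for x
      using assms closure_subset[of GR] by (auto simp: rho_def K_def indicator_def intro: order_trans[OF _ abs_ge_self])
    show "L2 sigma h"
      unfolding h_def using L2_lin[OF hNR, of 1 1] by simp
  qed (use assms in auto)
  \<comment> \<open>With data extended by 0 the set integrals become integrals over the circle. The
    integrability clause of \<open>weak_solution\<close> is discharged by
    \<open>integrable_rho_F\<close>.\<close>
  have weak_iff: "weak_solution GD GN GR phi g rob \<alpha> u \<longleftrightarrow> u \<in> V GD \<and>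
      (\<forall>v\<in>V GD. (\<integral>x. H1_grad u x \<bullet> H1_grad v x \<partial>lebO)
         + (\<integral>x. rho x * (F_bv \<alpha> (trace_of u x) * trace_of v x) \<partial>sigma)
         = (\<integral>x. h x * trace_of v x \<partial>sigma))" for u
  proof -
    have f: "indicator GR x *\<^sub>R (rob x * f_alpha \<alpha> (trace_of u x) * trace_of u x * trace_of v x)
        = rho x * (F_bv \<alpha> (trace_of u x) * trace_of v x)" for x v
      by (simp add: rho_def f_alpha_mult[symmetric])
    have i: "set_integrable sigma GR (\<lambda>x. rob x * f_alpha \<alpha> (trace_of u x) * trace_of u x * trace_of v x)"
      if "u \<in> V GD" "v \<in> V GD" for v
      unfolding set_integrable_def f
      using integrable_rho_F[OF V_data_of_V[OF that(1)] V_data_of_V[OF that(2)]] .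
    have l: "set_lebesgue_integral sigma GR (\<lambda>x. rob x * f_alpha \<alpha> (trace_of u x) * trace_of u x * trace_of v x)
        = (\<integral>x. rho x * (F_bv \<alpha> (trace_of u x) * trace_of v x) \<partial>sigma)" for v
      unfolding set_lebesgue_integral_def f ..
    have r: "set_lebesgue_integral sigma GN (\<lambda>x. phi x * trace_of v x)
          + set_lebesgue_integral sigma GR (\<lambda>x. g x * trace_of v x) = (\<integral>x. h x * trace_of v x \<partial>sigma)"
      if "v \<in> V GD" for v
    proof -
      have "L2 sigma (trace_of v)" by (rule V_data_L2_trace(1)[OF V_data_of_V[OF that]])
      then have "integrable sigma (\<lambda>x. hN x * trace_of v x)" "integrable sigma (\<lambda>x. hR x * trace_of v x)"
        using L2_integrable_inner[OF hNR(1)] L2_integrable_inner[OF hNR(2)] by auto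
      then have "(\<integral>x. h x * trace_of v x \<partial>sigma)
          = (\<integral>x. hN x * trace_of v x \<partial>sigma) + (\<integral>x. hR x * trace_of v x \<partial>sigma)"
        by (simp add: h_def distrib_right)
      then show ?thesis
        by (simp add: set_lebesgue_integral_def hN_def hR_def mult.assoc)
    qed
    show ?thesis
      unfolding weak_solution_def l using i by (auto simp: r)
  qed
  show ?thesis
  proof (intro conjI allI impI)
    \<comment> \<open>The minimiser comes with its own gradient and trace; a.e. equality moves its
      equation over to \<open>H1_grad\<close> and \<open>trace_of\<close>.\<close>
    obtain u dg t where u: "V_data GD u dg t"
      and min: "\<And>u' g' t'. V_data GD u' g' t' \<Longrightarrow> energy dg t \<le> energy g' t'"
      using minimiser_exists by blast
    have uV: "u \<in> V GD" by (rule V_dataI(1)[OF u])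
    note mu = V_data_measurable[OF V_data_of_V[OF uV]] V_data_measurable[OF u]
    have "(\<integral>x. H1_grad u x \<bullet> H1_grad v x \<partial>lebO)
         + (\<integral>x. rho x * (F_bv \<alpha> (trace_of u x) * trace_of v x) \<partial>sigma)
         = (\<integral>x. h x * trace_of v x \<partial>sigma)" if v: "v \<in> V GD" for v
    proof -
      note mv = V_data_measurable[OF V_data_of_V[OF v]]
      note [measurable] = mu(2,3,8,9) mv(2,3)
      have "(\<integral>x. H1_grad u x \<bullet> H1_grad v x \<partial>lebO) = (\<integral>x. dg x \<bullet> H1_grad v x \<partial>lebO)"
        by (rule integral_cong_AE) (use V_dataI(2)[OF u] in \<open>auto\<close>)
      moreover have "(\<integral>x. rho x * (F_bv \<alpha> (trace_of u x) * trace_of v x) \<partial>sigma)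
          = (\<integral>x. rho x * (F_bv \<alpha> (t x) * trace_of v x) \<partial>sigma)"
        by (rule integral_cong_AE) (measurable, use V_dataI(3)[OF u] in \<open>auto\<close>)
      ultimately show ?thesis
        using minimiser_weak_form[OF u V_data_of_V[OF v] min] by simp
    qed
    then show "\<exists>u. weak_solution GD GN GR phi g rob \<alpha> u"
      using uV unfolding weak_iff by blast
  next
    fix v1 v2
    assume *: "weak_solution GD GN GR phi g rob \<alpha> v1 \<and> weak_solution GD GN GR phi g rob \<alpha> v2
            \<and> Vnorm v1 \<le> M0 GD GN GR phi g \<and> Vnorm v2 \<le> M0 GD GN GR phi g"
    then have V: "v1 \<in> V GD" "v2 \<in> V GD" by (auto simp: weak_iff)
    \<comment> \<open>Uniqueness tests with a difference of representatives, which need not be the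
      chosen gradient and trace of v1 - v2; the equation is therefore extended to arbitrary
      representatives of the test function.\<close>
    have w: "(\<integral>x. H1_grad v x \<bullet> l x \<partial>lebO) + (\<integral>x. rho x * (F_bv \<alpha> (trace_of v x) * r x) \<partial>sigma)
         = (\<integral>x. h x * r x \<partial>sigma)"
      if v: "weak_solution GD GN GR phi g rob \<alpha> v" and w: "V_data GD w l r" for v w l r
    proof -
      have vV: "v \<in> V GD" using v by (simp add: weak_iff)
      have wV: "w \<in> V GD" by (rule V_dataI(1)[OF w])
      note mv = V_data_measurable[OF V_data_of_V[OF vV]]
      note mw = V_data_measurable[OF V_data_of_V[OF wV]] V_data_measurable[OF w]
      note [measurable] = mv(2,3) mw(2,3,8,9) L2_measurable[OF h]
      have 1: "(\<integral>x. H1_grad v x \<bullet> H1_grad w x \<partial>lebO) = (\<integral>x. H1_grad v x \<bullet> l x \<partial>lebO)"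
        by (rule integral_cong_AE) (use V_dataI(2)[OF w] in \<open>auto\<close>)
      have 2: "(\<integral>x. rho x * (F_bv \<alpha> (trace_of v x) * trace_of w x) \<partial>sigma)
          = (\<integral>x. rho x * (F_bv \<alpha> (trace_of v x) * r x) \<partial>sigma)"
        by (rule integral_cong_AE) (measurable, use V_dataI(3)[OF w] in \<open>auto\<close>)
      have 3: "(\<integral>x. h x * trace_of w x \<partial>sigma) = (\<integral>x. h x * r x \<partial>sigma)"
        by (rule integral_cong_AE) (measurable, use V_dataI(3)[OF w] in \<open>auto\<close>)
      show ?thesis
        using v wV unfolding weak_iff 1[symmetric] 2[symmetric] 3[symmetric] by blast
    qed
    show "AE x in lebesgue_on Omega. v1 x = v2 x"
      using * by (intro weak_form_unique[OF V_data_of_V[OF V(1)] V_data_of_V[OF V(2)]] w) auto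
  qed
qed

end
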